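(* Let $M$ be a Lorentzian minimal surface in $\mathbb{E}^4_1$. Suppose that no open part of $M$ is contained in a hyperplane of $\mathbb{E}^4_1$. Then the following conditions are equivalent: (i) $M$ has pointwise 1-type Gauss map; (ii) $M$ has pointwise 1-type Gauss map of the first kind; (iii) $M$ has harmonic Gauss map; (iv) $M$ has degenerated relative null bundle; (v) $M$ has flat normal bundle; (vi) $M$ is congruent to the surface given by $x(s,t)=s\eta_0+\beta(t)$ for a constant light-like vector $\eta_0\in\mathbb{E}^4_1$ and a null curve $\beta$ in $\mathbb{E}^4_1$ satisfying $\langle\eta_0,\beta'(t)\rangle\neq 0$.
   Context: $\mathbb{E}^4_1$ is Minkowski space-time: $\mathbb{R}^4$ with the metric $\langle\cdot,\cdot\rangle$ of signature $(-,+,+,+)$. All surfaces are smooth and connected. A surface $M\subset\mathbb{E}^4_1$ is Lorentzian if its induced metric is non-degenerate of index 1. Let $\widetilde\nabla,\nabla$ be the Levi-Civita connections of the ambient space and of $M$, $D$ the normal connection, and $h$ the second fundamental form, so $\widetilde\nabla_XY=\nabla_XY+h(X,Y)$. Let $\{f_1,f_2\}$ be a local pseudo-orthonormal frame of the tangent bundle: $\langle f_1,f_1\rangle=\langle f_2,f_2\rangle=0$, $\langle f_1,f_2\rangle=-1$, compatible with a fixed orientation of $M$. The mean curvature vector is $H=-h(f_1,f_2)$, and $M$ is minimal if $H=0$. The Laplace operator of $M$ is $\Delta=f_1f_2+f_2f_1-\nabla_{f_1}f_2-\nabla_{f_2}f_1$, applied componentwise to vector-valued maps. The Gauss map of $M$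 is $\nu=f_1\wedge f_2:M\to\Lambda^2\mathbb{E}^4_1\cong\mathbb{E}^6_3$. $M$ has pointwise 1-type Gauss map if $\Delta\nu=f(\nu+C)$ for some smooth function $f$ on $M$ and some constant vector $C\in\mathbb{E}^6_3$; it is of the first kind if this holds with $C=0$, i.e. $\Delta\nu=f\nu$ for some smooth function $f$. The Gauss map is harmonic if $\Delta\nu=0$. The relative null space at $p\in M$ is $\mathcal{N}_p(M)=\{X\in T_pM : h(X,Y)=0 \text{ for all } Y\in T_pM\}$; $M$ has degenerated relative null bundle if $(\mathcal{N}_p(M),\langle\cdot,\cdot\rangle)$ is a degenerate inner product space for all $p\in M$. $M$ has flat normal bundle if the curvature tensor $R^D$ of $D$ vanishes identically. A vector is light-like if it is non-zero and has zero square norm; a null curve is a curve whose velocity is light-like everywhere. Congruent means equal up to an isometry of the ambient space.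
   Formalization: (iv) is required only where h≠0, since (vi) allows points with h=0, where the relative null space is the whole tangent plane; literal (iv) is shown equivalent to (i) plus no such points. (vi) has one isometry and one η₀ for all of M, but β only near each point, as one global β may not exist. *)

theory Defs
  imports "HOL-Analysis.Analysis"
begin

section \<open>Smooth maps between normed spaces\<close>

text \<open>Meant for open \<open>S\<close>: all iterated directional derivatives up to order \<open>k\<close> exist and are
  continuous.\<close>

primrec Ck_on :: "nat \<Rightarrow> 'a::real_normed_vector set \<Rightarrow> ('a \<Rightarrow> 'b::real_normed_vector) \<Rightarrow> bool" where
  "Ck_on 0 S f \<longleftrightarrow> continuous_on S f"
| "Ck_on (Suc k) S f \<longleftrightarrow>
     (\<forall>u\<in>S. f differentiable (at u)) \<and> (\<forall>w. Ck_on k S (\<lambda>u. frechet_derivative f (at u) w))"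

definition smooth_on :: "'a::real_normed_vector set \<Rightarrow> ('a \<Rightarrow> 'b::real_normed_vector) \<Rightarrow> bool" where
  "smooth_on S f \<longleftrightarrow> (\<forall>k. Ck_on k S f)"

section \<open>Minkowski space-time\<close>

definition mink :: "real^4 \<Rightarrow> real^4 \<Rightarrow> real" where
  "mink v w = - (v$1 * w$1) + v$2 * w$2 + v$3 * w$3 + v$4 * w$4"

definition lightlike :: "real^4 \<Rightarrow> bool" where
  "lightlike v \<longleftrightarrow> v \<noteq> 0 \<and> mink v v = 0"

definition degenerate_space :: "(real^4) set \<Rightarrow> bool" where
  "degenerate_space W \<longleftrightarrow> (\<exists>v\<in>W. v \<noteq> 0 \<and> (\<forall>w\<in>W. mink v w = 0))"

definition index_of :: "(real^4) set \<Rightarrow> nat" where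
  "index_of W = Max (dim ` {N. subspace N \<and> N \<subseteq> W \<and> (\<forall>v\<in>N. v \<noteq> 0 \<longrightarrow> mink v v < 0)})"

definition pseudo_orthonormal :: "real^4 \<Rightarrow> real^4 \<Rightarrow> bool" where
  "pseudo_orthonormal v w \<longleftrightarrow> mink v v = 0 \<and> mink w w = 0 \<and> mink v w = - 1"

definition mink_isometry :: "(real^4 \<Rightarrow> real^4) \<Rightarrow> bool" where
  "mink_isometry F \<longleftrightarrow> bij F \<and> smooth_on UNIV F \<and> smooth_on UNIV (inv F) \<and>
     (\<forall>y v w. mink (frechet_derivative F (at y) v) (frechet_derivative F (at y) w) = mink v w)"

text \<open>The space \<open>\<Lambda>\<^sup>2 \<real>\<^sup>4\<close>, of dimension 6, is realised as the space of skew-symmetric matrices.\<close>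

definition wedge :: "real^4 \<Rightarrow> real^4 \<Rightarrow> real^4^4" where
  "wedge v w = (\<chi> i j. v$i * w$j - v$j * w$i)"

definition bivectors :: "(real^4^4) set" where
  "bivectors = {C. transpose C = - C}"

section \<open>Immersed surfaces\<close>

text \<open>A surface is a space \<open>M\<close> with a map \<open>x\<close> into space-time that is locally, in suitable
  homeomorphic parametrisations by plane domains, a smooth immersion. No atlas has to be specified:
  since \<open>x \<circ> \<phi>\<close> is an immersion for each local parametrisation \<open>\<phi>\<close>, changes of parametrisation are
  automatically smooth, so that \<open>x\<close> determines the smooth structure of \<open>M\<close>. A surface that is a
  subset of space-time is the case where \<open>x\<close> is the identity.\<close>

definition local_param ::
    "'a::topological_space set \<Rightarrow> ('a \<Rightarrow> real^4) \<Rightarrow> (real \<times> real) set \<Rightarrow> (real \<times> real \<Rightarrow> 'a) \<Rightarrow> bool" where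
  "local_param M x U \<phi> \<longleftrightarrow>
     open U \<and> openin (top_of_set M) (\<phi> ` U) \<and> (\<exists>\<psi>. homeomorphism U (\<phi> ` U) \<phi> \<psi>) \<and>
     smooth_on U (x \<circ> \<phi>) \<and> (\<forall>u\<in>U. inj (frechet_derivative (x \<circ> \<phi>) (at u)))"

definition immersed_surface :: "'a::topological_space set \<Rightarrow> ('a \<Rightarrow> real^4) \<Rightarrow> bool" where
  "immersed_surface M x \<longleftrightarrow>
     M \<noteq> {} \<and> connected M \<and> (\<forall>p\<in>M. \<exists>U \<phi>. local_param M x U \<phi> \<and> p \<in> \<phi> ` U)"

definition smooth_map_on ::
    "'a::topological_space set \<Rightarrow> ('a \<Rightarrow> real^4) \<Rightarrow> 'a set \<Rightarrow> ('a \<Rightarrow> 'b::real_normed_vector) \<Rightarrow> bool" where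
  "smooth_map_on M x V g \<longleftrightarrow> (\<forall>U \<phi>. local_param M x U \<phi> \<and> \<phi> ` U \<subseteq> V \<longrightarrow> smooth_on U (g \<circ> \<phi>))"

text \<open>Tangent vectors at \<open>p\<close> are identified with their images under the differential of \<open>x\<close>.\<close>

definition tangent_space :: "'a::topological_space set \<Rightarrow> ('a \<Rightarrow> real^4) \<Rightarrow> 'a \<Rightarrow> (real^4) set" where
  "tangent_space M x p =
     {v. \<exists>U \<phi> u w. local_param M x U \<phi> \<and> u \<in> U \<and> \<phi> u = p \<and> v = frechet_derivative (x \<circ> \<phi>) (at u) w}"

definition normal_space :: "'a::topological_space set \<Rightarrow> ('a \<Rightarrow> real^4) \<Rightarrow> 'a \<Rightarrow> (real^4) set" where
  "normal_space M x p = {n. \<forall>v\<in>tangent_space M x p. mink v n = 0}"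

definition lorentzian :: "'a::topological_space set \<Rightarrow> ('a \<Rightarrow> real^4) \<Rightarrow> bool" where
  "lorentzian M x \<longleftrightarrow>
     (\<forall>p\<in>M. \<not> degenerate_space (tangent_space M x p) \<and> index_of (tangent_space M x p) = 1)"

text \<open>An orientation assigns to each \<open>p\<close> the set of its positively oriented bases of the tangent
  plane; locally these are the bases having the same orientation as the coordinate basis of some
  parametrisation.\<close>

definition surface_orientation ::
    "'a::topological_space set \<Rightarrow> ('a \<Rightarrow> real^4) \<Rightarrow> ('a \<Rightarrow> ((real^4) \<times> (real^4)) set) \<Rightarrow> bool" where
  "surface_orientation M x Or \<longleftrightarrow>
     (\<forall>p\<in>M. \<exists>U \<phi>. local_param M x U \<phi> \<and> p \<in> \<phi> ` U \<and>
        (\<forall>u\<in>U. let d = frechet_derivative (x \<circ> \<phi>) (at u) in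
           Or (\<phi> u) = {(d (a, b), d (a', b')) | a b a' b'. a * b' - a' * b > 0}))"

section \<open>Connections and second fundamental form\<close>

text \<open>\<open>deriv_along M x g p v\<close> is the derivative at \<open>p\<close> of a map \<open>g\<close> on \<open>M\<close> in the direction of the
  tangent vector \<open>v\<close>. For maps into space-time this is the ambient Levi-Civita connection.\<close>

definition deriv_along ::
    "'a::topological_space set \<Rightarrow> ('a \<Rightarrow> real^4) \<Rightarrow> ('a \<Rightarrow> 'b::real_normed_vector) \<Rightarrow> 'a \<Rightarrow> real^4 \<Rightarrow> 'b" where
  "deriv_along M x g p v =
     (THE z. \<exists>U \<phi> u w. local_param M x U \<phi> \<and> u \<in> U \<and> \<phi> u = p \<and>
        v = frechet_derivative (x \<circ> \<phi>) (at u) w \<and> z = frechet_derivative (g \<circ> \<phi>) (at u) w)"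

definition tangent_part :: "'a::topological_space set \<Rightarrow> ('a \<Rightarrow> real^4) \<Rightarrow> 'a \<Rightarrow> real^4 \<Rightarrow> real^4" where
  "tangent_part M x p z = (THE v. v \<in> tangent_space M x p \<and> z - v \<in> normal_space M x p)"

definition normal_part :: "'a::topological_space set \<Rightarrow> ('a \<Rightarrow> real^4) \<Rightarrow> 'a \<Rightarrow> real^4 \<Rightarrow> real^4" where
  "normal_part M x p z = z - tangent_part M x p z"

definition tangent_field ::
    "'a::topological_space set \<Rightarrow> ('a \<Rightarrow> real^4) \<Rightarrow> 'a set \<Rightarrow> ('a \<Rightarrow> real^4) \<Rightarrow> bool" where
  "tangent_field M x V X \<longleftrightarrow> smooth_map_on M x V X \<and> (\<forall>p\<in>V. X p \<in> tangent_space M x p)"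

definition normal_field ::
    "'a::topological_space set \<Rightarrow> ('a \<Rightarrow> real^4) \<Rightarrow> 'a set \<Rightarrow> ('a \<Rightarrow> real^4) \<Rightarrow> bool" where
  "normal_field M x V \<xi> \<longleftrightarrow> smooth_map_on M x V \<xi> \<and> (\<forall>p\<in>V. \<xi> p \<in> normal_space M x p)"

definition levi_civita ::
    "'a::topological_space set \<Rightarrow> ('a \<Rightarrow> real^4) \<Rightarrow> ('a \<Rightarrow> real^4) \<Rightarrow> ('a \<Rightarrow> real^4) \<Rightarrow> 'a \<Rightarrow> real^4" where
  "levi_civita M x X Y p = tangent_part M x p (deriv_along M x Y p (X p))"

definition normal_connection ::
    "'a::topological_space set \<Rightarrow> ('a \<Rightarrow> real^4) \<Rightarrow> ('a \<Rightarrow> real^4) \<Rightarrow> ('a \<Rightarrow> real^4) \<Rightarrow> 'a \<Rightarrow> real^4" where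
  "normal_connection M x X \<xi> p = normal_part M x p (deriv_along M x \<xi> p (X p))"

definition bracket ::
    "'a::topological_space set \<Rightarrow> ('a \<Rightarrow> real^4) \<Rightarrow> ('a \<Rightarrow> real^4) \<Rightarrow> ('a \<Rightarrow> real^4) \<Rightarrow> 'a \<Rightarrow> real^4" where
  "bracket M x X Y p = deriv_along M x Y p (X p) - deriv_along M x X p (Y p)"

text \<open>The tensor \<open>h\<close> at \<open>p\<close>; \<open>Y\<close> is any local extension of \<open>w\<close> to a tangent vector field.\<close>

definition second_ff ::
    "'a::topological_space set \<Rightarrow> ('a \<Rightarrow> real^4) \<Rightarrow> 'a \<Rightarrow> real^4 \<Rightarrow> real^4 \<Rightarrow> real^4" where
  "second_ff M x p v w =
     (THE z. \<exists>V Y. openin (top_of_set M) V \<and> p \<in> V \<and> tangent_field M x V Y \<and> Y p = w \<and>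
        z = normal_part M x p (deriv_along M x Y p v))"

definition mean_curvature :: "'a::topological_space set \<Rightarrow> ('a \<Rightarrow> real^4) \<Rightarrow> 'a \<Rightarrow> real^4" where
  "mean_curvature M x p =
     (THE H. \<exists>f1\<in>tangent_space M x p. \<exists>f2\<in>tangent_space M x p.
        pseudo_orthonormal f1 f2 \<and> H = - second_ff M x p f1 f2)"

definition minimal_surface :: "'a::topological_space set \<Rightarrow> ('a \<Rightarrow> real^4) \<Rightarrow> bool" where
  "minimal_surface M x \<longleftrightarrow> (\<forall>p\<in>M. mean_curvature M x p = 0)"

definition relative_null_space :: "'a::topological_space set \<Rightarrow> ('a \<Rightarrow> real^4) \<Rightarrow> 'a \<Rightarrow> (real^4) set" where
  "relative_null_space M x p =
     {v \<in> tangent_space M x p. \<forall>w\<in>tangent_space M x p. second_ff M x p v w = 0}"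

definition geodesic_points :: "'a::topological_space set \<Rightarrow> ('a \<Rightarrow> real^4) \<Rightarrow> 'a set" where
  "geodesic_points M x =
     {p \<in> M. \<forall>v\<in>tangent_space M x p. \<forall>w\<in>tangent_space M x p. second_ff M x p v w = 0}"

text \<open>A minimal Lorentzian surface swept out by parallel null lines may contain geodesic points
  (\<open>h = 0\<close>) without being flat near them. At such a point the relative null space is the whole
  Lorentzian tangent plane, hence not degenerate. Therefore the set of points at which degeneracy is
  required is kept as a parameter.\<close>

definition degenerate_relative_null_on :: "'a::topological_space set \<Rightarrow> ('a \<Rightarrow> real^4) \<Rightarrow> 'a set \<Rightarrow> bool" where
  "degenerate_relative_null_on M x A \<longleftrightarrow> (\<forall>p\<in>A. degenerate_space (relative_null_space M x p))"

definition degenerate_relative_null_bundle :: "'a::topological_space set \<Rightarrow> ('a \<Rightarrow> real^4) \<Rightarrow> bool" where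
  "degenerate_relative_null_bundle M x \<longleftrightarrow> degenerate_relative_null_on M x M"

definition normal_curvature ::
    "'a::topological_space set \<Rightarrow> ('a \<Rightarrow> real^4) \<Rightarrow> ('a \<Rightarrow> real^4) \<Rightarrow> ('a \<Rightarrow> real^4) \<Rightarrow> ('a \<Rightarrow> real^4) \<Rightarrow> 'a \<Rightarrow> real^4" where
  "normal_curvature M x X Y \<xi> p =
     normal_connection M x X (normal_connection M x Y \<xi>) p
     - normal_connection M x Y (normal_connection M x X \<xi>) p
     - normal_connection M x (bracket M x X Y) \<xi> p"

definition flat_normal_bundle :: "'a::topological_space set \<Rightarrow> ('a \<Rightarrow> real^4) \<Rightarrow> bool" where
  "flat_normal_bundle M x \<longleftrightarrow>
     (\<forall>V X Y \<xi>. openin (top_of_set M) V \<and> tangent_field M x V X \<and> tangent_field M x V Y \<and>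
        normal_field M x V \<xi> \<longrightarrow> (\<forall>p\<in>V. normal_curvature M x X Y \<xi> p = 0))"

section \<open>Gauss map and Laplacian\<close>

definition pseudo_orthonormal_frame ::
    "'a::topological_space set \<Rightarrow> ('a \<Rightarrow> real^4) \<Rightarrow> ('a \<Rightarrow> ((real^4) \<times> (real^4)) set) \<Rightarrow>
     'a set \<Rightarrow> ('a \<Rightarrow> real^4) \<Rightarrow> ('a \<Rightarrow> real^4) \<Rightarrow> bool" where
  "pseudo_orthonormal_frame M x Or V f1 f2 \<longleftrightarrow>
     openin (top_of_set M) V \<and> tangent_field M x V f1 \<and> tangent_field M x V f2 \<and>
     (\<forall>p\<in>V. pseudo_orthonormal (f1 p) (f2 p) \<and> (f1 p, f2 p) \<in> Or p)"

definition gauss_map ::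
    "'a::topological_space set \<Rightarrow> ('a \<Rightarrow> real^4) \<Rightarrow> ('a \<Rightarrow> ((real^4) \<times> (real^4)) set) \<Rightarrow> 'a \<Rightarrow> real^4^4" where
  "gauss_map M x Or p =
     (THE z. \<exists>V f1 f2. pseudo_orthonormal_frame M x Or V f1 f2 \<and> p \<in> V \<and> z = wedge (f1 p) (f2 p))"

definition laplacian ::
    "'a::topological_space set \<Rightarrow> ('a \<Rightarrow> real^4) \<Rightarrow> ('a \<Rightarrow> ((real^4) \<times> (real^4)) set) \<Rightarrow>
     ('a \<Rightarrow> 'b::real_normed_vector) \<Rightarrow> 'a \<Rightarrow> 'b" where
  "laplacian M x Or g p =
     (THE z. \<exists>V f1 f2. pseudo_orthonormal_frame M x Or V f1 f2 \<and> p \<in> V \<and>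
        z = deriv_along M x (\<lambda>q. deriv_along M x g q (f2 q)) p (f1 p)
          + deriv_along M x (\<lambda>q. deriv_along M x g q (f1 q)) p (f2 p)
          - deriv_along M x g p (levi_civita M x f1 f2 p)
          - deriv_along M x g p (levi_civita M x f2 f1 p))"

definition pointwise_1_type_gauss_map ::
    "'a::topological_space set \<Rightarrow> ('a \<Rightarrow> real^4) \<Rightarrow> ('a \<Rightarrow> ((real^4) \<times> (real^4)) set) \<Rightarrow> bool" where
  "pointwise_1_type_gauss_map M x Or \<longleftrightarrow>
     (\<exists>(f :: 'a \<Rightarrow> real) C. smooth_map_on M x M f \<and> C \<in> bivectors \<and>
        (\<forall>p\<in>M. laplacian M x Or (gauss_map M x Or) p = f p *\<^sub>R (gauss_map M x Or p + C)))"

definition pointwise_1_type_gauss_map_first_kind ::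
    "'a::topological_space set \<Rightarrow> ('a \<Rightarrow> real^4) \<Rightarrow> ('a \<Rightarrow> ((real^4) \<times> (real^4)) set) \<Rightarrow> bool" where
  "pointwise_1_type_gauss_map_first_kind M x Or \<longleftrightarrow>
     (\<exists>f :: 'a \<Rightarrow> real. smooth_map_on M x M f \<and>
        (\<forall>p\<in>M. laplacian M x Or (gauss_map M x Or) p = f p *\<^sub>R gauss_map M x Or p))"

definition harmonic_gauss_map ::
    "'a::topological_space set \<Rightarrow> ('a \<Rightarrow> real^4) \<Rightarrow> ('a \<Rightarrow> ((real^4) \<times> (real^4)) set) \<Rightarrow> bool" where
  "harmonic_gauss_map M x Or \<longleftrightarrow> (\<forall>p\<in>M. laplacian M x Or (gauss_map M x Or) p = 0)"

section \<open>Surfaces swept out by parallel null lines\<close>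

definition null_curve_on :: "real set \<Rightarrow> (real \<Rightarrow> real^4) \<Rightarrow> bool" where
  "null_curve_on J \<beta> \<longleftrightarrow> smooth_on J \<beta> \<and> (\<forall>t\<in>J. lightlike (vector_derivative \<beta> (at t)))"

text \<open>Congruence, by one ambient isometry, with a surface \<open>x(s,t) = s \<eta>\<^sub>0 + \<beta>(t)\<close> for one direction
  \<open>\<eta>\<^sub>0\<close>. The curve \<open>\<beta>\<close> is only required to exist near each point: the lines in direction \<open>\<eta>\<^sub>0\<close> may
  meet \<open>M\<close> in several pieces, or the space of these pieces may be branched, and then no single \<open>\<beta>\<close>
  describes all of \<open>M\<close>.\<close>

definition congruent_to_null_line_surface :: "'a::topological_space set \<Rightarrow> ('a \<Rightarrow> real^4) \<Rightarrow> bool" where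
  "congruent_to_null_line_surface M x \<longleftrightarrow>
     (\<exists>F \<eta>\<^sub>0. mink_isometry F \<and> lightlike \<eta>\<^sub>0 \<and>
        (\<forall>p\<in>M. \<exists>I J \<phi> \<beta>. is_interval I \<and> is_interval J \<and> local_param M x (I \<times> J) \<phi> \<and> p \<in> \<phi> ` (I \<times> J) \<and>
           null_curve_on J \<beta> \<and> (\<forall>t\<in>J. mink \<eta>\<^sub>0 (vector_derivative \<beta> (at t)) \<noteq> 0) \<and>
           (\<forall>s\<in>I. \<forall>t\<in>J. F (x (\<phi> (s, t))) = s *\<^sub>R \<eta>\<^sub>0 + \<beta> t)))"

end

(* The coordinate vector fields of a Lorentzian minimal surface can be chosen null. Indeed, let N1 and
   N2 be the null tangent fields with time component 1. By minimality the derivative of N2 along N1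
   is tangent; it is orthogonal to N2 and has time component 0, so it vanishes, and likewise with N1
   and N2 exchanged. Hence the coefficients of dx with respect to N1, N2 are closed forms, and locally
   x(s,t) = alpha(s) + beta(t) with null curves alpha, beta. Write A = h(alpha',alpha'),
   B = h(beta',beta') and m = <alpha',beta'>; A vanishes iff alpha'' does, B iff beta'' does. Then
   Delta nu = (2/m^2) (<A,B> nu + A wedge B) and R^D(alpha',beta') xi = (<xi,B> A - <xi,A> B) / m.
   If Delta nu = f (nu + C), then alpha' and beta' are eigenvectors of C where f is not 0;
   differentiating this shows that A and B are parallel everywhere, as they are if R^D = 0. If
   alpha''(s0) and beta''(t0) are both nonzero, parallelism puts all alpha'(s) and beta'(t) into
   one hyperplane. So on each chart alpha' or beta' is constant, and by connectedness the same one of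
   the two null directions is constant on the whole surface. *)

theory Submission
  imports Defs
begin

section \<open>Calculus of smooth maps\<close>

text \<open>Directional derivatives, the second fundamental form, the mean curvature, the Gauss map
  and the Laplacian are definite descriptions over charts, fields or frames, so each must be shown
  independent of these choices before it can be computed. Normalising null vectors to time component
  1 attaches the null directions to points of the surface instead of charts; the orientation orders
  them, so they can be compared globally. All conditions are linked through the alternative
  alpha''(s) = 0 or beta''(t) = 0. Since s and t vary independently in a box, it makes one curve
  straight on the whole box. The hyperplane hypothesis enters twice. A common normal n of
  alpha'(s0), beta'(t0), alpha''(s0) stays normal to both curves, because <n,alpha'> and <n,beta'>
  solve homogeneous linear equations; this excludes two nonzero accelerations. Moreover no region
  has both null directions constant, which makes the two open sets of the connectedness argument
  disjoint. The alternative is not exclusive: both accelerations vanish at geodesic points, where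
  the relative null space is the whole tangent plane. Hence the separate treatment of these points
  in (iv).\<close>

lemma frechet_derivative_eqI: "(f has_derivative f') (at u) \<Longrightarrow> frechet_derivative f (at u) = f'"
  by (metis frechet_derivative_at)

lemma Ck_on_cong:
  assumes "open S" "\<And>u. u \<in> S \<Longrightarrow> f u = g u" "Ck_on k S f"
  shows "Ck_on k S g"
  using assms(2,3)
proof (induction k arbitrary: f g)
  case 0
  then show ?case by (simp cong: continuous_on_cong)
next
  case (Suc k)
  have eq: "frechet_derivative f (at u) = frechet_derivative g (at u)" if "u \<in> S" for u
    using Suc.prems assms(1) that by (intro frechet_derivative_transform_within_open[where X = S]) auto
  have "g differentiable (at u)" if "u \<in> S" for u
  proof -
    have "(f has_derivative frechet_derivative f (at u)) (at u)"
      using Suc.prems(2) that by (simp add: frechet_derivative_works)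
    then have "(g has_derivative frechet_derivative f (at u)) (at u)"
      by (rule has_derivative_transform_within_open[OF _ assms(1) that]) (rule Suc.prems(1))
    then show ?thesis by (rule differentiableI)
  qed
  moreover have "Ck_on k S (\<lambda>u. frechet_derivative g (at u) w)" for w
    by (rule Suc.IH[of "\<lambda>u. frechet_derivative f (at u) w"]) (use Suc.prems eq in auto)
  ultimately show ?case by simp
qed

lemma Ck_on_subset: "Ck_on k S f \<Longrightarrow> T \<subseteq> S \<Longrightarrow> Ck_on k T f"
  by (induction k arbitrary: f) (auto intro: continuous_on_subset)

lemma Ck_on_SucD: "Ck_on (Suc k) S f \<Longrightarrow> Ck_on k S f"
proof (induction k arbitrary: f)
  case 0
  then show ?case
    by (auto intro!: differentiable_imp_continuous_on simp: differentiable_on_def differentiable_at_withinI)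
next
  case (Suc k)
  have "Ck_on k S (\<lambda>u. frechet_derivative f (at u) w)" for w
    using Suc.prems by (intro Suc.IH) simp
  with Suc.prems show ?case by simp
qed

lemma Ck_on_const: "Ck_on k S (\<lambda>u. c)"
  by (induction k arbitrary: c) auto

lemma Ck_on_bounded_linear: "bounded_linear L \<Longrightarrow> Ck_on k S L"
proof (cases k)
  case (Suc j)
  assume L: "bounded_linear L"
  have "frechet_derivative L (at u) = L" for u
    using L by (simp add: bounded_linear_imp_has_derivative frechet_derivative_eqI)
  then show ?thesis
    using L Suc by (auto simp: Ck_on_const bounded_linear_imp_differentiable)
qed (simp add: linear_continuous_on)

lemma Ck_on_comp_linear:
  assumes L: "bounded_linear L" and "open S" "Ck_on k S f"
  shows "Ck_on k S (\<lambda>u. L (f u))"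
  using assms(3)
proof (induction k arbitrary: f)
  case 0
  then show ?case using L by (simp add: bounded_linear.continuous_on)
next
  case (Suc k)
  have d: "((\<lambda>u. L (f u)) has_derivative (\<lambda>w. L (frechet_derivative f (at u) w))) (at u)" if "u \<in> S" for u
    using Suc.prems that by (intro bounded_linear.has_derivative[OF L]) (simp add: frechet_derivative_works)
  have "Ck_on k S (\<lambda>u. frechet_derivative (\<lambda>u. L (f u)) (at u) w)" for w
    by (rule Ck_on_cong[OF assms(2) _ Suc.IH[of "\<lambda>u. frechet_derivative f (at u) w"]])
       (use Suc.prems frechet_derivative_eqI[OF d] in auto)
  with d show ?case by (auto simp: differentiable_def)
qed

lemma Ck_on_add:
  assumes "open S" "Ck_on k S f" "Ck_on k S g"
  shows "Ck_on k S (\<lambda>u. f u + g u)"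
  using assms(2,3)
proof (induction k arbitrary: f g)
  case 0
  then show ?case by (simp add: continuous_on_add)
next
  case (Suc k)
  have d: "((\<lambda>u. f u + g u) has_derivative (\<lambda>w. frechet_derivative f (at u) w + frechet_derivative g (at u) w)) (at u)"
    if "u \<in> S" for u
    using Suc.prems that by (intro has_derivative_add) (simp_all add: frechet_derivative_works)
  have "Ck_on k S (\<lambda>u. frechet_derivative (\<lambda>u. f u + g u) (at u) w)" for w
    by (rule Ck_on_cong[OF assms(1) _ Suc.IH[of "\<lambda>u. frechet_derivative f (at u) w" "\<lambda>u. frechet_derivative g (at u) w"]])
       (use Suc.prems frechet_derivative_eqI[OF d] in auto)
  with d show ?case by (auto simp: differentiable_def)
qed

lemma Ck_on_sum:
  assumes "open S" "\<And>i. i \<in> I \<Longrightarrow> Ck_on k S (f i)"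
  shows "Ck_on k S (\<lambda>u. \<Sum>i\<in>I. f i u)"
  using assms(2)
  by (induction I rule: infinite_finite_induct) (auto simp: Ck_on_const Ck_on_add[OF assms(1)])

lemma Ck_on_bilinear:
  assumes L: "bounded_bilinear L" and "open S" "Ck_on k S f" "Ck_on k S g"
  shows "Ck_on k S (\<lambda>u. L (f u) (g u))"
  using assms(3,4)
proof (induction k arbitrary: f g)
  case 0
  then show ?case using L by (simp add: bounded_bilinear.continuous_on)
next
  case (Suc k)
  have d: "((\<lambda>u. L (f u) (g u)) has_derivative
      (\<lambda>w. L (f u) (frechet_derivative g (at u) w) + L (frechet_derivative f (at u) w) (g u))) (at u)"
    if "u \<in> S" for u
    using Suc.prems that by (intro bounded_bilinear.FDERIV[OF L]) (simp_all add: frechet_derivative_works)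
  have "Ck_on k S (\<lambda>u. L (f u) (frechet_derivative g (at u) w) + L (frechet_derivative f (at u) w) (g u))" for w
    using Suc.prems Ck_on_SucD[OF Suc.prems(1)] Ck_on_SucD[OF Suc.prems(2)]
    by (intro Ck_on_add[OF assms(2)] Suc.IH) auto
  then have "Ck_on k S (\<lambda>u. frechet_derivative (\<lambda>u. L (f u) (g u)) (at u) w)" for w
    by (rule Ck_on_cong[OF assms(2), rotated]) (use frechet_derivative_eqI[OF d] in auto)
  with d show ?case by (auto simp: differentiable_def)
qed

text \<open>The chain rule yields a derivative of \<open>f\<close> applied to a varying vector,
  whereas \<open>Ck_on\<close> controls derivatives in fixed directions only. Expanding that vector
  in a finite basis turns the expression into a sum of products, to which the induction hypothesis
  applies.\<close>

lemma Ck_on_compose: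
  fixes g :: "'a::real_normed_vector \<Rightarrow> 'b::euclidean_space"
  assumes "open S" "open T" "Ck_on k S g" "Ck_on k T f" "g ` S \<subseteq> T"
  shows "Ck_on k S (\<lambda>u. f (g u))"
  using assms(3,4)
proof (induction k arbitrary: f)
  case 0
  then show ?case using assms(5) by (auto intro: continuous_on_compose2)
next
  case (Suc k)
  have d: "((\<lambda>u. f (g u)) has_derivative
      (\<lambda>w. frechet_derivative f (at (g u)) (frechet_derivative g (at u) w))) (at u)" if "u \<in> S" for u
    using Suc.prems that assms(5)
    by (intro has_derivative_compose[where f = g and g = f]) (auto simp: frechet_derivative_works)
  have expand: "frechet_derivative f (at (g u)) (frechet_derivative g (at u) w) =
      (\<Sum>b\<in>Basis. (frechet_derivative g (at u) w \<bullet> b) *\<^sub>R frechet_derivative f (at (g u)) b)" if "u \<in> S" for u w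
  proof -
    have "linear (frechet_derivative f (at (g u)))"
      using Suc.prems that assms(5) by (auto intro!: linear_frechet_derivative)
    then show ?thesis
      by (subst (1) euclidean_representation[of "frechet_derivative g (at u) w", symmetric])
         (simp add: linear_sum linear_cmul)
  qed
  have "Ck_on k S (\<lambda>u. \<Sum>b\<in>Basis. (frechet_derivative g (at u) w \<bullet> b) *\<^sub>R frechet_derivative f (at (g u)) b)" for w
    using Suc.prems Ck_on_SucD[OF Suc.prems(1)] assms(1)
    by (intro Ck_on_sum[OF assms(1)] Ck_on_bilinear[OF bounded_bilinear_scaleR] Suc.IH
        Ck_on_comp_linear[OF bounded_linear_inner_left]) auto
  then have "Ck_on k S (\<lambda>u. frechet_derivative (\<lambda>u. f (g u)) (at u) w)" for w
    by (rule Ck_on_cong[OF assms(1), rotated]) (use frechet_derivative_eqI[OF d] expand in auto)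
  with d show ?case by (auto simp: differentiable_def)
qed

text \<open>The derivative is a polynomial in the function itself, so regularity of order k for the
  function gives the same order for its derivative.\<close>

lemma Ck_on_inverse: "Ck_on k (- {0}) (inverse :: real \<Rightarrow> real)"
proof (induction k)
  case 0
  then show ?case by (auto intro!: continuous_intros)
next
  case (Suc k)
  have d: "(inverse has_derivative (\<lambda>w. - (inverse u * w * inverse u))) (at u)" if "u \<in> - {0}" for u :: real
    using that by (intro has_derivative_inverse') auto
  have "Ck_on k (- {0}) (\<lambda>u. (- w) * (inverse u * inverse u))" for w :: real
    by (intro Ck_on_bilinear[OF bounded_bilinear_mult] Ck_on_const Suc) auto
  then have "Ck_on k (- {0}) (\<lambda>u. frechet_derivative inverse (at u) w)" for w :: real
    by (rule Ck_on_cong[rotated 2]) (use frechet_derivative_eqI[OF d] in auto)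
  with d show ?case by (auto simp: differentiable_def)
qed

lemma Ck_on_sqrt: "Ck_on k {0<..} sqrt"
proof (induction k)
  case 0
  then show ?case by (auto intro!: continuous_intros)
next
  case (Suc k)
  have d: "(sqrt has_derivative (\<lambda>w. w * (inverse (sqrt u) / 2))) (at u)" if "u \<in> {0<..}" for u :: real
  proof (rule has_derivative_eq_rhs)
    show "(sqrt has_derivative (*) (inverse (sqrt u) / 2)) (at u)"
      using DERIV_real_sqrt[of u] that by (simp add: has_field_derivative_def)
  qed (simp add: fun_eq_iff)
  have "Ck_on k {0<..} (\<lambda>u. inverse (sqrt u))"
    by (rule Ck_on_compose[OF _ _ Suc Ck_on_inverse]) auto
  then have "Ck_on k {0<..} (\<lambda>u. (w / 2) * inverse (sqrt u))" for w :: real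
    by (intro Ck_on_bilinear[OF bounded_bilinear_mult] Ck_on_const) auto
  then have "Ck_on k {0<..} (\<lambda>u. frechet_derivative sqrt (at u) w)" for w :: real
    by (rule Ck_on_cong[rotated 2]) (use frechet_derivative_eqI[OF d] in auto)
  with d show ?case by (auto simp: differentiable_def)
qed

lemma smooth_on_cong:
  "smooth_on S f \<Longrightarrow> open S \<Longrightarrow> (\<And>u. u \<in> S \<Longrightarrow> f u = g u) \<Longrightarrow> smooth_on S g"
  unfolding smooth_on_def using Ck_on_cong by blast

lemma smooth_on_subset: "smooth_on S f \<Longrightarrow> T \<subseteq> S \<Longrightarrow> smooth_on T f"
  unfolding smooth_on_def using Ck_on_subset by blast

lemma smooth_on_differentiable: "smooth_on S f \<Longrightarrow> u \<in> S \<Longrightarrow> f differentiable (at u)"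
  unfolding smooth_on_def by (metis Ck_on.simps(2))

lemma smooth_on_has_derivative:
  "smooth_on S f \<Longrightarrow> u \<in> S \<Longrightarrow> (f has_derivative frechet_derivative f (at u)) (at u)"
  using smooth_on_differentiable frechet_derivative_works by blast

lemma smooth_on_frechet: "smooth_on S f \<Longrightarrow> smooth_on S (\<lambda>u. frechet_derivative f (at u) w)"
  unfolding smooth_on_def by (metis Ck_on.simps(2))

lemma smooth_on_continuous: "smooth_on S f \<Longrightarrow> continuous_on S f"
  unfolding smooth_on_def by (metis Ck_on.simps(1))

lemma smooth_onI:
  assumes "\<And>u. u \<in> S \<Longrightarrow> f differentiable (at u)"
    and "\<And>w. smooth_on S (\<lambda>u. frechet_derivative f (at u) w)"
  shows "smooth_on S f"
  unfolding smooth_on_def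
proof
  fix k show "Ck_on k S f"
    using assms Ck_on_SucD[of k S f] unfolding smooth_on_def by auto
qed

lemma smooth_on_local:
  assumes "\<And>u. u \<in> S \<Longrightarrow> \<exists>T. open T \<and> u \<in> T \<and> smooth_on T f"
  shows "smooth_on S f"
proof -
  have "Ck_on k S f" for k
    using assms
  proof (induction k arbitrary: f)
    case 0
    have "continuous (at u) f" if "u \<in> S" for u
    proof -
      obtain T where "open T" "u \<in> T" "smooth_on T f" using 0[OF \<open>u \<in> S\<close>] by auto
      then show ?thesis using smooth_on_continuous continuous_on_eq_continuous_at by metis
    qed
    then show ?case by (simp add: continuous_at_imp_continuous_on)
  next
    case (Suc k)
    have "f differentiable at u" if "u \<in> S" for u
    proof -
      obtain T where "open T" "u \<in> T" "smooth_on T f" using Suc.prems[OF \<open>u \<in> S\<close>] by auto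
      then show ?thesis using smooth_on_differentiable by metis
    qed
    moreover have "Ck_on k S (\<lambda>u. frechet_derivative f (at u) w)" for w
    proof (rule Suc.IH)
      fix u assume "u \<in> S"
      then obtain T where "open T" "u \<in> T" "smooth_on T f" using Suc.prems by auto
      then show "\<exists>T. open T \<and> u \<in> T \<and> smooth_on T (\<lambda>u. frechet_derivative f (at u) w)"
        using smooth_on_frechet by metis
    qed
    ultimately show ?case by simp
  qed
  then show ?thesis by (simp add: smooth_on_def)
qed

lemma smooth_on_const [simp, intro]: "smooth_on S (\<lambda>u. c)"
  by (simp add: smooth_on_def Ck_on_const)

lemma smooth_on_linear: "bounded_linear L \<Longrightarrow> smooth_on S L"
  by (simp add: smooth_on_def Ck_on_bounded_linear)

lemma smooth_on_comp_linear: "bounded_linear L \<Longrightarrow> open S \<Longrightarrow> smooth_on S f \<Longrightarrow> smooth_on S (\<lambda>u. L (f u))"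
  by (simp add: smooth_on_def Ck_on_comp_linear)

lemma smooth_on_add: "open S \<Longrightarrow> smooth_on S f \<Longrightarrow> smooth_on S g \<Longrightarrow> smooth_on S (\<lambda>u. f u + g u)"
  by (simp add: smooth_on_def Ck_on_add)

lemma smooth_on_uminus: "open S \<Longrightarrow> smooth_on S f \<Longrightarrow> smooth_on S (\<lambda>u. - f u)"
  by (rule smooth_on_comp_linear) (auto intro: bounded_linear_minus bounded_linear_ident)

lemma smooth_on_diff: "open S \<Longrightarrow> smooth_on S f \<Longrightarrow> smooth_on S g \<Longrightarrow> smooth_on S (\<lambda>u. f u - g u)"
  using smooth_on_add[of S f "\<lambda>u. - g u"] smooth_on_uminus by fastforce

lemma smooth_on_bilinear:
  "bounded_bilinear L \<Longrightarrow> open S \<Longrightarrow> smooth_on S f \<Longrightarrow> smooth_on S g \<Longrightarrow> smooth_on S (\<lambda>u. L (f u) (g u))"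
  by (simp add: smooth_on_def Ck_on_bilinear)

lemmas smooth_on_scaleR = smooth_on_bilinear[OF bounded_bilinear_scaleR]
lemmas smooth_on_mult = smooth_on_bilinear[OF bounded_bilinear_mult]

lemma smooth_on_compose:
  fixes g :: "'a::real_normed_vector \<Rightarrow> 'b::euclidean_space"
  shows "open S \<Longrightarrow> open T \<Longrightarrow> smooth_on S g \<Longrightarrow> smooth_on T f \<Longrightarrow> g ` S \<subseteq> T \<Longrightarrow> smooth_on S (\<lambda>u. f (g u))"
  unfolding smooth_on_def using Ck_on_compose by blast

lemma smooth_on_inverse:
  fixes f :: "'a::real_normed_vector \<Rightarrow> real"
  shows "open S \<Longrightarrow> smooth_on S f \<Longrightarrow> (\<And>u. u \<in> S \<Longrightarrow> f u \<noteq> 0) \<Longrightarrow> smooth_on S (\<lambda>u. inverse (f u))"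
  by (rule smooth_on_compose[where T = "- {0}"]) (auto simp: smooth_on_def Ck_on_inverse)

lemma smooth_on_divide:
  fixes f :: "'a::real_normed_vector \<Rightarrow> real"
  shows "open S \<Longrightarrow> smooth_on S f \<Longrightarrow> smooth_on S g \<Longrightarrow> (\<And>u. u \<in> S \<Longrightarrow> g u \<noteq> 0) \<Longrightarrow> smooth_on S (\<lambda>u. f u / g u)"
  unfolding divide_inverse by (intro smooth_on_mult smooth_on_inverse) auto

lemma smooth_on_sqrt:
  "open S \<Longrightarrow> smooth_on S f \<Longrightarrow> (\<And>u. u \<in> S \<Longrightarrow> f u > 0) \<Longrightarrow> smooth_on S (\<lambda>u. sqrt (f u))"
  by (rule smooth_on_compose[where T = "{0<..}"]) (auto simp: smooth_on_def Ck_on_sqrt)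

lemma smooth_on_Pair:
  assumes "open S" "smooth_on S f" "smooth_on S g"
  shows "smooth_on S (\<lambda>u. (f u, g u))"
proof -
  have "bounded_linear (\<lambda>a. (a, 0))" "bounded_linear (\<lambda>b. (0, b))"
    by (auto intro!: bounded_linear_Pair bounded_linear_ident bounded_linear_zero)
  then have "smooth_on S (\<lambda>u. (f u, 0) + (0, g u))"
    using assms by (intro smooth_on_add) (auto intro: smooth_on_comp_linear)
  then show ?thesis by simp
qed

lemmas smooth_on_ident = smooth_on_linear[OF bounded_linear_ident]
lemmas smooth_on_fst = smooth_on_comp_linear[OF bounded_linear_fst]
lemmas smooth_on_snd = smooth_on_comp_linear[OF bounded_linear_snd]
lemmas smooth_on_nth = smooth_on_comp_linear[OF bounded_linear_vec_nth]

lemma frechet_derivative_compose':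
  assumes "(f has_derivative f') (at (g u))" "(g has_derivative g') (at u)"
  shows "frechet_derivative (f \<circ> g) (at u) = f' \<circ> g'"
  by (rule frechet_derivative_eqI) (use diff_chain_at[OF assms(2,1)] in simp)

section \<open>The inverse function theorem, Schwarz' theorem and the Poincare lemma\<close>

text \<open>The inverse function theorem supplies a differentiable inverse \<open>h\<close>. Its
  smoothness is bootstrapped: by Cramer's rule the derivative of \<open>h\<close> at y is a smooth
  expression in \<open>h y\<close>.\<close>

lemma smooth_inverse_function:
  fixes g :: "real \<times> real \<Rightarrow> real \<times> real"
  assumes "open U" "smooth_on U g" "u0 \<in> U" and inj: "inj (frechet_derivative g (at u0))"
  obtains W V h where "open W" "W \<subseteq> U" "u0 \<in> W" "open V" "homeomorphism W V g h" "smooth_on V h"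
proof -
  define f' where "f' u = Blinfun (frechet_derivative g (at u))" for u
  have bl: "bounded_linear (frechet_derivative g (at u))" if "u \<in> U" for u
    using smooth_on_has_derivative[OF assms(2) that] by (rule has_derivative_bounded_linear)
  have f': "blinfun_apply (f' u) = frechet_derivative g (at u)" if "u \<in> U" for u
    unfolding f'_def using bl[OF that] by (rule bounded_linear_Blinfun_apply)
  have "continuous_on U (\<lambda>u. frechet_derivative g (at u) w)" for w
    using smooth_on_continuous[OF smooth_on_frechet[OF assms(2)]] .
  then have cont: "continuous_on U f'"
    by (intro continuous_on_blinfun_componentwise) (use f' in \<open>simp cong: continuous_on_cong\<close>)
  obtain l where l: "linear l" "l \<circ> frechet_derivative g (at u0) = id"
    using linear_injective_left_inverse[OF bounded_linear.linear[OF bl[OF assms(3)]] inj] by blast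
  have inv: "Blinfun l o\<^sub>L f' u0 = id_blinfun"
    using l f'[OF assms(3)] unfolding fun_eq_iff
    by (intro blinfun_eqI) (simp del: split_paired_All add: bounded_linear_Blinfun_apply linear_conv_bounded_linear[symmetric])
  obtain W V h g' where W: "open W" "W \<subseteq> U" "u0 \<in> W" "open V" "homeomorphism W V g h"
    and h: "\<And>y. y \<in> V \<Longrightarrow> (h has_derivative g' y) (at y)"
      "\<And>y. y \<in> V \<Longrightarrow> g' y = Hilbert_Choice.inv (blinfun_apply (f' (h y)))"
      "\<And>y. y \<in> V \<Longrightarrow> bij (blinfun_apply (f' (h y)))"
    using inverse_function_theorem[OF assms(1) _ cont assms(3) inv, of g]
      smooth_on_has_derivative[OF assms(2)] f' by metis
  define p where "p u = frechet_derivative g (at u) (1,0)" for u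
  define q where "q u = frechet_derivative g (at u) (0,1)" for u
  define D where "D u = fst (p u) * snd (q u) - fst (q u) * snd (p u)" for u
  have hU: "h y \<in> U" if "y \<in> V" for y
    using W that by (metis homeomorphism_def imageI subsetD)
  have lin: "frechet_derivative g (at u) (a, b) = a *\<^sub>R p u + b *\<^sub>R q u" if "u \<in> U" for u a b
  proof -
    have "linear (frechet_derivative g (at u))" using bl[OF that] bounded_linear.linear by blast
    then have "frechet_derivative g (at u) (a *\<^sub>R (1,0) + b *\<^sub>R (0,1)) = a *\<^sub>R p u + b *\<^sub>R q u"
      unfolding p_def q_def by (simp only: linear_add linear_cmul)
    then show ?thesis by simp
  qed
  have D: "D (h y) \<noteq> 0" if "y \<in> V" for y
  proof
    assume D0: "D (h y) = 0"
    have b: "inj (frechet_derivative g (at (h y)))"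
      using h(3)[OF that] f'[OF hU[OF that]] by (simp add: bij_def)
    \<comment> \<open>The two vectors are formed from the entries of the adjugate matrix. With zero
      determinant both lie in the kernel, so by injectivity all entries of the Jacobian matrix
      vanish, which contradicts injectivity again.\<close>
    have "frechet_derivative g (at (h y)) (snd (q (h y)), - snd (p (h y))) = frechet_derivative g (at (h y)) (0,0)"
      "frechet_derivative g (at (h y)) (fst (q (h y)), - fst (p (h y))) = frechet_derivative g (at (h y)) (0,0)"
      using D0 unfolding lin[OF hU[OF that]] D_def by (auto simp: prod_eq_iff algebra_simps)
    then have z: "p (h y) = 0" "q (h y) = 0"
      unfolding inj_eq[OF b] by (simp_all add: prod_eq_iff)
    then have "frechet_derivative g (at (h y)) (1,0) = frechet_derivative g (at (h y)) (0,0)"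
      using lin[OF hU[OF that]] by simp
    then show False by (simp add: inj_eq[OF b])
  qed
  \<comment> \<open>Cramer's rule for the 2 by 2 Jacobian matrix with columns \<open>p\<close> and
    \<open>q\<close>.\<close>
  have dh: "g' y w = ((fst w * snd (q (h y)) - snd w * fst (q (h y))) / D (h y),
      (fst (p (h y)) * snd w - snd (p (h y)) * fst w) / D (h y))" (is "_ = ?r") if "y \<in> V" for y w
  proof -
    have "frechet_derivative g (at (h y)) ?r = w"
      using D[OF that] unfolding lin[OF hU[OF that]]
      by (simp add: prod_eq_iff add_divide_distrib[symmetric] nonzero_divide_eq_eq eq_divide_eq)
         (simp add: D_def algebra_simps)
    then show ?thesis
      using h(2,3)[OF that] f'[OF hU[OF that]] by (metis bij_inv_eq_iff)
  qed
  have sp: "smooth_on U p" "smooth_on U q" "smooth_on U D"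
    unfolding p_def q_def D_def
    by (intro smooth_on_frechet assms smooth_on_diff smooth_on_mult smooth_on_fst smooth_on_snd)+
  \<comment> \<open>If \<open>h\<close> has order k, then so has every smooth function of
    \<open>h y\<close>, in particular the derivative of \<open>h\<close>; hence \<open>h\<close> has
    order k + 1.\<close>
  have "Ck_on k V h" for k
  proof (induction k)
    case 0
    then show ?case using W(5) by (simp add: homeomorphism_def)
  next
    case (Suc k)
    have c: "Ck_on k V (\<lambda>y. f (h y))" if "smooth_on U f" for f :: "real \<times> real \<Rightarrow> 'c::real_normed_vector"
      using that hU unfolding smooth_on_def by (intro Ck_on_compose[OF W(4) assms(1) Suc]) auto
    have inv: "Ck_on k V (\<lambda>y. inverse (D (h y)))"
      by (rule Ck_on_compose[OF W(4) _ c[OF sp(3)] Ck_on_inverse]) (use D in auto)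
    have pair: "bounded_linear (\<lambda>a::real. (a, 0::real))" "bounded_linear (\<lambda>b::real. (0::real, b))"
      by (auto intro!: bounded_linear_Pair bounded_linear_ident bounded_linear_zero)
    have "Ck_on k V (\<lambda>y. ((snd (q (h y)) * fst w + fst (q (h y)) * (- snd w)) * inverse (D (h y)), 0) +
        (0, (fst (p (h y)) * snd w + snd (p (h y)) * (- fst w)) * inverse (D (h y))))" for w
      by (intro Ck_on_add W Ck_on_comp_linear[OF pair(1)] Ck_on_comp_linear[OF pair(2)] inv
          Ck_on_bilinear[OF bounded_bilinear_mult] Ck_on_const c smooth_on_fst smooth_on_snd sp assms)
    then have "Ck_on k V (\<lambda>y. frechet_derivative h (at y) w)" for w
      by (rule Ck_on_cong[OF W(4), rotated])
         (use frechet_derivative_eqI[OF h(1)] dh in \<open>auto simp: divide_inverse algebra_simps\<close>)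
    with h(1) show ?case by (auto simp: differentiable_def)
  qed
  then show ?thesis using that[OF W] by (simp add: smooth_on_def)
qed

text \<open>Two applications of the mean value theorem, one in each direction. The left side is
  symmetric in \<open>v\<close> and \<open>w\<close> while the right side is a mixed derivative in a
  fixed order; this asymmetry yields Schwarz' theorem.\<close>

lemma second_difference:
  fixes f :: "'a::real_normed_vector \<Rightarrow> real"
  assumes "smooth_on S f" "h > 0"
    and S: "\<And>a b. 0 \<le> a \<Longrightarrow> a \<le> h \<Longrightarrow> 0 \<le> b \<Longrightarrow> b \<le> h \<Longrightarrow> u + a *\<^sub>R v + b *\<^sub>R w \<in> S"
  shows "\<exists>a b. 0 < a \<and> a < h \<and> 0 < b \<and> b < h \<and>
    f (u + h *\<^sub>R v + h *\<^sub>R w) - f (u + h *\<^sub>R v) - f (u + h *\<^sub>R w) + f u =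
    h * h * frechet_derivative (\<lambda>z. frechet_derivative f (at z) v) (at (u + a *\<^sub>R v + b *\<^sub>R w)) w"
proof -
  have line: "((\<lambda>t. g (c + t *\<^sub>R d)) has_real_derivative frechet_derivative g (at (c + t *\<^sub>R d)) d) (at t)"
    if "smooth_on S g" "c + t *\<^sub>R d \<in> S" for g :: "'a \<Rightarrow> real" and c d t
  proof -
    have g: "(g has_derivative frechet_derivative g (at (c + t *\<^sub>R d))) (at (c + t *\<^sub>R d))"
      by (rule smooth_on_has_derivative[OF that])
    have "((\<lambda>t. g (c + t *\<^sub>R d)) has_derivative (\<lambda>r. frechet_derivative g (at (c + t *\<^sub>R d)) (r *\<^sub>R d))) (at t)"
      by (rule has_derivative_compose[of "\<lambda>t. c + t *\<^sub>R d", OF _ g]) (auto intro!: derivative_eq_intros)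
    moreover have "linear (frechet_derivative g (at (c + t *\<^sub>R d)))"
      using g has_derivative_linear by blast
    ultimately show ?thesis
      unfolding has_field_derivative_def
      by (elim has_derivative_eq_rhs) (auto simp: fun_eq_iff linear_cmul)
  qed
  \<comment> \<open>The increment of \<open>f\<close> in direction \<open>w\<close>, regarded as a
    function of the coordinate along \<open>v\<close>.\<close>
  let ?k = "\<lambda>a. f ((u + h *\<^sub>R w) + a *\<^sub>R v) - f (u + a *\<^sub>R v)"
  let ?fv = "\<lambda>z. frechet_derivative f (at z) v"
  have "\<exists>a. 0 < a \<and> a < h \<and> ?k h - ?k 0 = (h - 0) * (?fv ((u + h *\<^sub>R w) + a *\<^sub>R v) - ?fv (u + a *\<^sub>R v))"
    by (rule MVT2[OF assms(2)], rule DERIV_diff; rule line[OF assms(1)])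
       (use S[of _ h] S[of _ 0] assms(2) in \<open>auto simp: algebra_simps\<close>)
  then obtain a where a: "0 < a" "a < h"
    "?k h - ?k 0 = h * (?fv ((u + h *\<^sub>R w) + a *\<^sub>R v) - ?fv (u + a *\<^sub>R v))" by auto
  have "\<exists>b. 0 < b \<and> b < h \<and> ?fv ((u + a *\<^sub>R v) + h *\<^sub>R w) - ?fv ((u + a *\<^sub>R v) + 0 *\<^sub>R w) =
      (h - 0) * frechet_derivative ?fv (at ((u + a *\<^sub>R v) + b *\<^sub>R w)) w"
    by (rule MVT2[OF assms(2)], rule line[OF smooth_on_frechet[OF assms(1)]])
       (use S[of a] a in auto)
  then obtain b where b: "0 < b" "b < h" "?fv ((u + a *\<^sub>R v) + h *\<^sub>R w) - ?fv (u + a *\<^sub>R v) =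
      h * frechet_derivative ?fv (at ((u + a *\<^sub>R v) + b *\<^sub>R w)) w" by auto
  show ?thesis
    using a b by (intro exI[of _ a] exI[of _ b]) (simp add: algebra_simps)
qed

text \<open>The same second difference equals \<open>h * h\<close> times either mixed derivative at
  some point of a small parallelogram. If the two derivatives differed at \<open>u\<close>,
  continuity would keep each within half the gap of its value at \<open>u\<close>, so that they
  could not agree.\<close>

lemma second_derivative_symmetric_real:
  fixes f :: "'a::real_normed_vector \<Rightarrow> real"
  assumes "open S" "smooth_on S f" "u \<in> S"
  shows "frechet_derivative (\<lambda>z. frechet_derivative f (at z) w) (at u) v =
         frechet_derivative (\<lambda>z. frechet_derivative f (at z) v) (at u) w"
proof (rule ccontr)
  define p where "p z = frechet_derivative (\<lambda>z. frechet_derivative f (at z) w) (at z) v" for z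
  define q where "q z = frechet_derivative (\<lambda>z. frechet_derivative f (at z) v) (at z) w" for z
  assume "\<not> ?thesis"
  then have e: "\<bar>p u - q u\<bar> / 2 > 0" (is "?e > 0") by (simp add: p_def q_def)
  have "continuous_on S p" "continuous_on S q"
    unfolding p_def q_def by (intro smooth_on_continuous smooth_on_frechet assms)+
  then have "isCont p u" "isCont q u"
    using assms continuous_on_eq_continuous_at by blast+
  then obtain d1 d2 where d: "d1 > 0" "\<And>z. dist z u < d1 \<Longrightarrow> dist (p z) (p u) < ?e"
      "d2 > 0" "\<And>z. dist z u < d2 \<Longrightarrow> dist (q z) (q u) < ?e"
    using e unfolding continuous_at_eps_delta by metis
  obtain d3 where d3: "d3 > 0" "ball u d3 \<subseteq> S"
    using assms open_contains_ball by blast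
  define d where "d = min d1 (min d2 d3)"
  \<comment> \<open>Small enough for the whole parallelogram to lie within distance \<open>d\<close>
    of \<open>u\<close>; the summand 1 keeps the denominator positive when both vectors are
    zero.\<close>
  define h where "h = d / (2 * (norm v + norm w + 1))"
  have dpos: "d > 0" using d d3 by (auto simp: d_def)
  have N: "norm v + norm w + 1 > 0" by (smt (verit) norm_ge_zero)
  then have hpos: "h > 0" using dpos by (simp add: h_def)
  have near: "dist (u + a *\<^sub>R v + b *\<^sub>R w) u < d" "dist (u + a *\<^sub>R w + b *\<^sub>R v) u < d"
    if ab: "0 \<le> a" "a \<le> h" "0 \<le> b" "b \<le> h" for a b
  proof -
    have le: "norm (a *\<^sub>R v' + b *\<^sub>R w') \<le> h * (norm v' + norm w')" for v' w' :: 'a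
    proof -
      have "norm (a *\<^sub>R v' + b *\<^sub>R w') \<le> norm (a *\<^sub>R v') + norm (b *\<^sub>R w')" by (rule norm_triangle_ineq)
      also have "\<dots> \<le> h * norm v' + h * norm w'"
        using ab by (intro add_mono) (auto intro: mult_right_mono)
      finally show ?thesis by (simp add: distrib_left)
    qed
    have "h * (norm v + norm w) < h * (2 * (norm v + norm w + 1))"
      using hpos by (intro mult_strict_left_mono) (auto, smt (verit) norm_ge_zero)
    also have "\<dots> = d" using N by (simp add: h_def)
    finally show "dist (u + a *\<^sub>R v + b *\<^sub>R w) u < d" "dist (u + a *\<^sub>R w + b *\<^sub>R v) u < d"
      using le[of v w] le[of w v] by (auto simp: dist_norm add.assoc add.commute)
  qed
  obtain a b where 1: "0 < a" "a < h" "0 < b" "b < h"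
    "f (u + h *\<^sub>R v + h *\<^sub>R w) - f (u + h *\<^sub>R v) - f (u + h *\<^sub>R w) + f u = h * h * q (u + a *\<^sub>R v + b *\<^sub>R w)"
    using second_difference[OF smooth_on_subset[OF assms(2) order_refl] hpos, of u v w] near d3
    unfolding q_def d_def by (smt (verit) dist_commute mem_ball subsetD)
  obtain a' b' where 2: "0 < a'" "a' < h" "0 < b'" "b' < h"
    "f (u + h *\<^sub>R w + h *\<^sub>R v) - f (u + h *\<^sub>R w) - f (u + h *\<^sub>R v) + f u = h * h * p (u + a' *\<^sub>R w + b' *\<^sub>R v)"
    using second_difference[OF smooth_on_subset[OF assms(2) order_refl] hpos, of u w v] near d3
    unfolding p_def d_def by (smt (verit) dist_commute mem_ball subsetD)
  have "h * h * q (u + a *\<^sub>R v + b *\<^sub>R w) = h * h * p (u + a' *\<^sub>R w + b' *\<^sub>R v)"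
    using 1(5) 2(5) by (simp add: algebra_simps)
  then have eq: "q (u + a *\<^sub>R v + b *\<^sub>R w) = p (u + a' *\<^sub>R w + b' *\<^sub>R v)" using hpos by simp
  have "dist (q (u + a *\<^sub>R v + b *\<^sub>R w)) (q u) < ?e" "dist (p (u + a' *\<^sub>R w + b' *\<^sub>R v)) (p u) < ?e"
    using near(1)[of a b] near(2)[of a' b'] 1 2 d(2)[of "u + a' *\<^sub>R w + b' *\<^sub>R v"] d(4)[of "u + a *\<^sub>R v + b *\<^sub>R w"]
    by (simp_all add: d_def)
  then show False unfolding eq dist_real_def by (smt (verit) field_sum_of_halves)
qed

lemma second_derivative_symmetric:
  fixes f :: "'a::real_normed_vector \<Rightarrow> 'b::euclidean_space"
  assumes "open S" "smooth_on S f" "u \<in> S"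
  shows "frechet_derivative (\<lambda>z. frechet_derivative f (at z) w) (at u) v =
         frechet_derivative (\<lambda>z. frechet_derivative f (at z) v) (at u) w"
proof (rule euclidean_eqI)
  fix b :: 'b assume "b \<in> Basis"
  have comp: "frechet_derivative (\<lambda>z. g z \<bullet> b) (at z) w = frechet_derivative g (at z) w \<bullet> b"
    if "smooth_on S g" "z \<in> S" for g :: "'a \<Rightarrow> 'b" and z w
    using frechet_derivative_eqI[OF has_derivative_inner_left[OF smooth_on_has_derivative[OF that]]] by metis
  have two: "frechet_derivative (\<lambda>z. frechet_derivative (\<lambda>z. f z \<bullet> b) (at z) w) (at u) v =
      frechet_derivative (\<lambda>z. frechet_derivative f (at z) w) (at u) v \<bullet> b" for v w
  proof -
    have s: "smooth_on S (\<lambda>z. frechet_derivative f (at z) w \<bullet> b)"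
      by (intro smooth_on_comp_linear[OF bounded_linear_inner_left] smooth_on_frechet assms)
    have "frechet_derivative (\<lambda>z. frechet_derivative f (at z) w \<bullet> b) (at u) =
        frechet_derivative (\<lambda>z. frechet_derivative (\<lambda>z. f z \<bullet> b) (at z) w) (at u)"
      by (rule frechet_derivative_transform_within_open[OF smooth_on_differentiable[OF s assms(3)] assms(1,3)])
         (simp add: comp[OF assms(2)])
    then show ?thesis using comp[OF smooth_on_frechet[OF assms(2)] assms(3)] by metis
  qed
  have "smooth_on S (\<lambda>z. f z \<bullet> b)"
    by (intro smooth_on_comp_linear[OF bounded_linear_inner_left] assms)
  from second_derivative_symmetric_real[OF assms(1) this assms(3), of w v]
  show "frechet_derivative (\<lambda>z. frechet_derivative f (at z) w) (at u) v \<bullet> b =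
        frechet_derivative (\<lambda>z. frechet_derivative f (at z) v) (at u) w \<bullet> b"
    unfolding two .
qed

text \<open>The primitive is the integral of the form along the segment from \<open>z0\<close> to
  \<open>z\<close>, differentiated under the integral sign. Closedness makes the differentiated
  integrand the t-derivative of t times the form at the point with parameter t, so the integral is
  the value of the form at the endpoint.\<close>

lemma poincare_plane:
  fixes P Q :: "real \<times> real \<Rightarrow> real"
  assumes U: "open U" "convex U" "z0 \<in> U" and s: "smooth_on U P" "smooth_on U Q"
    and closed: "\<And>z. z \<in> U \<Longrightarrow> frechet_derivative P (at z) (0,1) = frechet_derivative Q (at z) (1,0)"
  obtains g where "\<And>z. z \<in> U \<Longrightarrow> (g has_derivative (\<lambda>w. P z * fst w + Q z * snd w)) (at z)" "smooth_on U g"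
proof -
  define \<sigma> where "\<sigma> z t = z0 + t *\<^sub>R (z - z0)" for z and t :: real
  have \<sigma>U: "\<sigma> z t \<in> U" if "z \<in> U" "t \<in> {0..1}" for z t
  proof -
    have "\<sigma> z t = (1 - t) *\<^sub>R z0 + t *\<^sub>R z" by (simp add: \<sigma>_def algebra_simps)
    then show ?thesis using that U convexD_alt[OF U(2,3), of z t] by auto
  qed
  let ?DP = "\<lambda>z. frechet_derivative P (at z)" and ?DQ = "\<lambda>z. frechet_derivative Q (at z)"
  define f where "f z t = P (\<sigma> z t) * fst (z - z0) + Q (\<sigma> z t) * snd (z - z0)" for z t
  define F where "F z t w = P (\<sigma> z t) * fst w + t * ?DP (\<sigma> z t) w * fst (z - z0) +
      (Q (\<sigma> z t) * snd w + t * ?DQ (\<sigma> z t) w * snd (z - z0))" for z t w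
  have dP: "(P has_derivative ?DP z) (at z)" and dQ: "(Q has_derivative ?DQ z) (at z)" if "z \<in> U" for z
    using that s by (auto intro: smooth_on_has_derivative)
  have f: "((\<lambda>z. f z t) has_derivative F z t) (at z)" if "z \<in> U" "t \<in> {0..1}" for z t
  proof -
    have \<sigma>': "((\<lambda>z. \<sigma> z t) has_derivative (\<lambda>w. t *\<^sub>R w)) (at z)"
      unfolding \<sigma>_def by (auto intro!: derivative_eq_intros)
    have l: "?DP (\<sigma> z t) (t *\<^sub>R w) = t * ?DP (\<sigma> z t) w" "?DQ (\<sigma> z t) (t *\<^sub>R w) = t * ?DQ (\<sigma> z t) w" for w
      using has_derivative_linear[OF dP[OF \<sigma>U[OF that]]] has_derivative_linear[OF dQ[OF \<sigma>U[OF that]]]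
      by (simp_all add: linear_cmul)
    show ?thesis
      unfolding f_def F_def
      by (rule derivative_eq_intros has_derivative_compose[OF \<sigma>' dP[OF \<sigma>U[OF that]]]
          has_derivative_compose[OF \<sigma>' dQ[OF \<sigma>U[OF that]]] refl)+
         (simp add: fun_eq_iff l algebra_simps)
  qed
  have bl: "bounded_linear (F z t)" if "z \<in> U" "t \<in> {0..1}" for z t
    using f[OF that] has_derivative_bounded_linear by blast
  define \<Phi> where "\<Phi> z t = Blinfun (F z t)" for z t
  have \<Phi>: "blinfun_apply (\<Phi> z t) = F z t" if "z \<in> U" "t \<in> {0..1}" for z t
    unfolding \<Phi>_def using bl[OF that] by (rule bounded_linear_Blinfun_apply)
  have c\<sigma>: "continuous_on (U \<times> {0..1}) (\<lambda>x. h (\<sigma> (fst x) (snd x)))" if "continuous_on U h"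
    for h :: "real \<times> real \<Rightarrow> real"
    by (rule continuous_on_compose2[OF that]) (auto simp: \<sigma>_def intro!: continuous_intros \<sigma>U[unfolded \<sigma>_def])
  have cF: "continuous_on (U \<times> {0..1}) (\<lambda>x. F (fst x) (snd x) w)" for w
    unfolding F_def
    by (intro continuous_intros c\<sigma>[OF smooth_on_continuous] smooth_on_frechet s)
  have contf: "continuous_on (U \<times> {0..1}) (\<lambda>x. f (fst x) (snd x))"
    unfolding f_def by (intro continuous_intros c\<sigma>[OF smooth_on_continuous] s)
  have "continuous_on (U \<times> cbox 0 1) (\<lambda>x. \<Phi> (fst x) (snd x))"
  proof (rule continuous_on_blinfun_componentwise)
    fix w
    show "continuous_on (U \<times> cbox 0 1) (\<lambda>x. blinfun_apply (\<Phi> (fst x) (snd x)) w)"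
      unfolding cbox_interval
    proof (rule continuous_on_eq[OF cF[of w]])
      fix x assume "x \<in> U \<times> {0..1::real}"
      then have "fst x \<in> U" "snd x \<in> {0..1}" by auto
      then show "F (fst x) (snd x) w = blinfun_apply (\<Phi> (fst x) (snd x)) w" by (simp only: \<Phi>)
    qed
  qed
  then have cont\<Phi>: "continuous_on (U \<times> cbox 0 1) (\<lambda>(z, t). \<Phi> z t)"
    by (simp add: case_prod_unfold)
  define g where "g z = integral (cbox 0 1) (f z)" for z
  have dg: "(g has_derivative (\<lambda>w. P z * fst w + Q z * snd w)) (at z)" if z: "z \<in> U" for z
  proof -
    have "(g has_derivative blinfun_apply (integral (cbox 0 1) (\<Phi> z))) (at z within U)"
      unfolding g_def
    proof (rule leibniz_rule[OF _ _ cont\<Phi> z U(2)])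
      fix z t assume z: "z \<in> U" "t \<in> cbox 0 (1::real)"
      then have "t \<in> {0..1}" by (simp add: cbox_interval)
      then show "((\<lambda>z. f z t) has_derivative blinfun_apply (\<Phi> z t)) (at z within U)"
        using f[OF z(1)] \<Phi>[OF z(1)] by (simp add: has_derivative_at_withinI)
    next
      fix z assume "z \<in> U"
      then have "continuous_on {0..1} (\<lambda>t. f (fst (z, t)) (snd (z, t)))"
        by (intro continuous_on_compose2[OF contf]) (auto intro!: continuous_intros)
      then have "continuous_on {0..1} (f z)" by simp
      then show "f z integrable_on cbox 0 1"
        unfolding cbox_interval by (rule integrable_continuous_interval)
    qed
    then have "(g has_derivative blinfun_apply (integral (cbox 0 1) (\<Phi> z))) (at z)"
      unfolding at_within_open[OF z U(1)] .
    moreover have "blinfun_apply (integral (cbox 0 1) (\<Phi> z)) w = P z * fst w + Q z * snd w" for w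
    proof -
      have int: "\<Phi> z integrable_on cbox 0 1"
      proof -
        have "continuous_on (cbox 0 1) (\<lambda>t. (\<lambda>(z, t). \<Phi> z t) (z, t))"
          by (rule continuous_on_compose2[OF cont\<Phi>]) (use z in \<open>auto intro!: continuous_intros\<close>)
        then have "continuous_on {0..1} (\<Phi> z)" by simp
        then show ?thesis unfolding cbox_interval by (rule integrable_continuous_interval)
      qed
      have "blinfun_apply (integral (cbox 0 1) (\<Phi> z)) w = integral (cbox 0 1) (\<lambda>t. blinfun_apply (\<Phi> z t) w)"
        by (rule blinfun_apply_integral[OF int])
      also have "\<dots> = integral {0..1} (\<lambda>t. F z t w)"
        unfolding cbox_interval by (rule integral_cong) (simp only: \<Phi>[OF z])
      also have "\<dots> = P z * fst w + Q z * snd w"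
      proof (rule integral_unique)
        have "((\<lambda>t. t * (P (\<sigma> z t) * fst w + Q (\<sigma> z t) * snd w)) has_vector_derivative F z t w) (at t within {0..1})"
          if t: "t \<in> {0..1}" for t
        proof -
          have \<sigma>': "((\<lambda>t. \<sigma> z t) has_derivative (\<lambda>r. r *\<^sub>R (z - z0))) (at t)"
            unfolding \<sigma>_def by (auto intro!: derivative_eq_intros)
          note lin = has_derivative_linear[OF dP[OF \<sigma>U[OF z t]]] has_derivative_linear[OF dQ[OF \<sigma>U[OF z t]]]
          have l: "L w = fst w * L (1,0) + snd w * L (0,1)" if "linear L" for L :: "real \<times> real \<Rightarrow> real" and w
          proof -
            have "L (fst w *\<^sub>R (1,0) + snd w *\<^sub>R (0,1)) = fst w * L (1,0) + snd w * L (0,1)"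
              using that by (simp only: linear_add linear_cmul real_scaleR_def)
            then show ?thesis by simp
          qed
          \<comment> \<open>Closedness exchanges the cross derivatives: the derivative of the form
            in direction \<open>w\<close>, evaluated on \<open>z - z0\<close>, becomes its
            derivative along the segment, evaluated on \<open>w\<close>.\<close>
          have key: "F z t w = P (\<sigma> z t) * fst w + Q (\<sigma> z t) * snd w +
              t * (?DP (\<sigma> z t) (z - z0) * fst w + ?DQ (\<sigma> z t) (z - z0) * snd w)"
            unfolding F_def l[OF lin(1), of w] l[OF lin(2), of w] l[OF lin(1), of "z - z0"] l[OF lin(2), of "z - z0"]
            using closed[OF \<sigma>U[OF z t]] by (simp add: algebra_simps)
          have l2: "?DP (\<sigma> z t) (r *\<^sub>R (z - z0)) = r * ?DP (\<sigma> z t) (z - z0)"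
            "?DQ (\<sigma> z t) (r *\<^sub>R (z - z0)) = r * ?DQ (\<sigma> z t) (z - z0)" for r
            using lin by (simp_all only: linear_cmul real_scaleR_def)
          have p: "((\<lambda>t. P (\<sigma> z t)) has_real_derivative ?DP (\<sigma> z t) (z - z0)) (at t)"
            using has_derivative_compose[OF \<sigma>' dP[OF \<sigma>U[OF z t]]]
            unfolding l2 has_field_derivative_def by (rule has_derivative_eq_rhs) (simp add: fun_eq_iff)
          have q: "((\<lambda>t. Q (\<sigma> z t)) has_real_derivative ?DQ (\<sigma> z t) (z - z0)) (at t)"
            using has_derivative_compose[OF \<sigma>' dQ[OF \<sigma>U[OF z t]]]
            unfolding l2 has_field_derivative_def by (rule has_derivative_eq_rhs) (simp add: fun_eq_iff)
          have "((\<lambda>t. t * (P (\<sigma> z t) * fst w + Q (\<sigma> z t) * snd w)) has_real_derivative F z t w) (at t)"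
            by (rule derivative_eq_intros p q refl)+ (simp add: key)
          then show ?thesis
            by (simp add: has_real_derivative_iff_has_vector_derivative has_vector_derivative_at_within)
        qed
        from fundamental_theorem_of_calculus[OF _ this]
        have "((\<lambda>t. F z t w) has_integral 1 * (P (\<sigma> z 1) * fst w + Q (\<sigma> z 1) * snd w) -
            0 * (P (\<sigma> z 0) * fst w + Q (\<sigma> z 0) * snd w)) {0..1}"
          by (simp only: zero_le_one)
        then show "((\<lambda>t. F z t w) has_integral P z * fst w + Q z * snd w) {0..1}"
          by (simp add: \<sigma>_def)
      qed
      finally show ?thesis .
    qed
    ultimately show ?thesis by (rule has_derivative_eq_rhs[OF _ ext])
  qed
  have "smooth_on U g"
  proof (rule smooth_onI)
    fix w
    have "smooth_on U (\<lambda>u. P u * fst w + Q u * snd w)"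
      by (intro smooth_on_add smooth_on_mult smooth_on_const s U)
    then show "smooth_on U (\<lambda>u. frechet_derivative g (at u) w)"
      by (rule smooth_on_cong[OF _ U(1)]) (use frechet_derivative_eqI[OF dg] in auto)
  qed (use dg differentiableI in blast)
  with dg show ?thesis using that by blast
qed

section \<open>Minkowski geometry\<close>

lemma bounded_bilinear_mink: "bounded_bilinear mink"
proof -
  have "bilinear mink"
    unfolding bilinear_def by (auto intro!: linearI simp: mink_def algebra_simps)
  then show ?thesis by (simp add: bilinear_conv_bounded_bilinear)
qed

interpretation mink: bounded_bilinear mink
  by (rule bounded_bilinear_mink)

lemmas smooth_on_mink = smooth_on_bilinear[OF bounded_bilinear_mink]

lemma mink_commute: "mink v w = mink w v"
  by (simp add: mink_def mult.commute)

lemma mink_eq_inner: "mink v w = (\<chi> i. if i = 1 then - v$i else v$i) \<bullet> w"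
  by (simp add: mink_def inner_vec_def sum_4)

text \<open>If \<open>w\<close> were not space-like, both time components would dominate the spatial
  norms, strictly for \<open>v\<close>. Orthogonality equates the product of the time components
  with the spatial inner product, so Cauchy-Schwarz forces the time component of \<open>w\<close>,
  and then \<open>w\<close>, to be zero.\<close>

lemma mink_orthogonal_timelike:
  assumes "mink v v < 0" "mink v w = 0" "w \<noteq> 0"
  shows "mink w w > 0"
proof (rule ccontr)
  assume "\<not> mink w w > 0"
  define p where "p = (v$2)\<^sup>2 + (v$3)\<^sup>2 + (v$4)\<^sup>2"
  define q where "q = (w$2)\<^sup>2 + (w$3)\<^sup>2 + (w$4)\<^sup>2"
  have v: "p < (v$1)\<^sup>2" and w: "q \<le> (w$1)\<^sup>2" and vw: "v$1 * w$1 = v$2 * w$2 + v$3 * w$3 + v$4 * w$4"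
    using assms(1,2) \<open>\<not> mink w w > 0\<close> by (auto simp: mink_def power2_eq_square p_def q_def)
  \<comment> \<open>Lagrange's identity; its right side is a sum of squares, which is Cauchy-Schwarz
    for the spatial parts.\<close>
  have "p * q - (v$2 * w$2 + v$3 * w$3 + v$4 * w$4)\<^sup>2 =
      (v$2 * w$3 - v$3 * w$2)\<^sup>2 + (v$2 * w$4 - v$4 * w$2)\<^sup>2 + (v$3 * w$4 - v$4 * w$3)\<^sup>2"
    by (simp add: p_def q_def power2_eq_square algebra_simps)
  then have cs: "(v$1)\<^sup>2 * (w$1)\<^sup>2 \<le> p * q"
    unfolding power_mult_distrib[symmetric] vw by (smt (verit) zero_le_power2)
  have "p \<ge> 0" "q \<ge> 0" by (auto simp: p_def q_def)
  have "w$1 = 0"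
  proof (rule ccontr)
    assume "w$1 \<noteq> 0"
    then have "p * (w$1)\<^sup>2 < (v$1)\<^sup>2 * (w$1)\<^sup>2" using v by (intro mult_strict_right_mono) auto
    moreover have "p * q \<le> p * (w$1)\<^sup>2" using w \<open>p \<ge> 0\<close> by (rule mult_left_mono)
    ultimately show False using cs by linarith
  qed
  with w have "q \<le> 0" by simp
  then have "w$2 = 0" "w$3 = 0" "w$4 = 0"
    unfolding q_def by (smt (verit) power2_less_eq_zero_iff zero_le_power2)+
  with \<open>w$1 = 0\<close> assms(3) show False by (simp add: vec_eq_iff forall_4)
qed

lemma mink_pos_if_time_zero:
  assumes "v$1 = 0" "v \<noteq> 0"
  shows "mink v v > 0"
proof -
  have "mink v v = v \<bullet> v" using assms(1) by (simp add: mink_def inner_vec_def sum_4)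
  then show ?thesis using assms(2) by simp
qed

text \<open>Null directions are normalised to have time component 1. The derivative of a normalised null
  field then has time component 0, which fixes its tangent part.\<close>

definition null_pair :: "real^4 \<Rightarrow> real^4 \<Rightarrow> bool" where
  "null_pair n m \<longleftrightarrow> n$1 = 1 \<and> m$1 = 1 \<and> mink n n = 0 \<and> mink m m = 0 \<and> n \<noteq> m"

lemma null_pairD:
  assumes "null_pair n m"
  shows "n$1 = 1" "m$1 = 1" "mink n n = 0" "mink m m = 0" "n \<noteq> m" "mink m n = mink n m" "mink n m < 0"
proof -
  show *: "n$1 = 1" "m$1 = 1" "mink n n = 0" "mink m m = 0" "n \<noteq> m" "mink m n = mink n m"
    using assms mink_commute by (auto simp: null_pair_def)
  \<comment> \<open>The difference has time component 0 and is therefore space-like, and its square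
    is -2 times \<open>mink n m\<close>.\<close>
  have "mink (n - m) (n - m) > 0" using * by (intro mink_pos_if_time_zero) auto
  then show "mink n m < 0" using * by (simp add: mink.diff_left mink.diff_right)
qed

lemma null_pair_swap: "null_pair n m \<Longrightarrow> null_pair m n"
  by (auto simp: null_pair_def)

lemma null_pair_coords:
  assumes "null_pair n m"
  shows "a *\<^sub>R n + b *\<^sub>R m = c *\<^sub>R n + d *\<^sub>R m \<longleftrightarrow> a = c \<and> b = d"
proof
  assume eq: "a *\<^sub>R n + b *\<^sub>R m = c *\<^sub>R n + d *\<^sub>R m"
  from arg_cong[OF this, of "\<lambda>v. mink v n"] arg_cong[OF this, of "\<lambda>v. mink v m"]
  show "a = c \<and> b = d"
    using null_pairD[OF assms] by (simp add: mink.add_left mink.scaleR_left)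
qed auto

text \<open>The vector \<open>n + m\<close> is time-like, so the orthogonal complement of the pair
  is positive definite.\<close>

lemma mink_normal_pos:
  assumes "null_pair n m" "mink n \<xi> = 0" "mink m \<xi> = 0" "\<xi> \<noteq> 0"
  shows "mink \<xi> \<xi> > 0"
  by (rule mink_orthogonal_timelike[of "n + m"])
     (use assms null_pairD[OF assms(1)] in \<open>auto simp: mink.add_left mink.add_right\<close>)

text \<open>A Lorentzian plane has exactly two null lines; the two cases are the two ways of
  distributing the vectors over them.\<close>

lemma pseudo_orthonormal_null_pair:
  assumes "null_pair n m"
  shows "pseudo_orthonormal (a *\<^sub>R n + b *\<^sub>R m) (c *\<^sub>R n + d *\<^sub>R m) \<longleftrightarrow>
    b = 0 \<and> c = 0 \<and> a * d = - 1 / mink n m \<or> a = 0 \<and> d = 0 \<and> b * c = - 1 / mink n m"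
proof -
  note n = null_pairD[OF assms]
  have "mink (a *\<^sub>R n + b *\<^sub>R m) (a *\<^sub>R n + b *\<^sub>R m) = 2 * a * b * mink n m"
    "mink (c *\<^sub>R n + d *\<^sub>R m) (c *\<^sub>R n + d *\<^sub>R m) = 2 * c * d * mink n m"
    "mink (a *\<^sub>R n + b *\<^sub>R m) (c *\<^sub>R n + d *\<^sub>R m) = (a * d + b * c) * mink n m"
    using n by (simp_all add: mink.add_left mink.add_right mink.scaleR_left mink.scaleR_right algebra_simps)
  then show ?thesis
    using n(7) unfolding pseudo_orthonormal_def by (auto simp: field_simps)
qed

text \<open>Three linear conditions in dimension four. The map \<open>?fl\<close> converts Minkowski
  products into Euclidean ones.\<close>

lemma common_normal_vector:
  obtains n :: "real^4" where "n \<noteq> 0" "mink n a = 0" "mink n b = 0" "mink n c = 0"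
proof -
  let ?fl = "\<lambda>v::real^4. (\<chi> i. if i = 1 then - v$i else v$i) :: real^4"
  have "dim {?fl a, ?fl b, ?fl c} \<le> card {?fl a, ?fl b, ?fl c}" by (rule dim_le_card') simp
  also have "\<dots> \<le> 3" by (simp add: card_insert_if)
  finally have "dim {?fl a, ?fl b, ?fl c} < DIM(real^4)" by simp
  then obtain n where n: "n \<noteq> 0" "\<And>y. y \<in> span {?fl a, ?fl b, ?fl c} \<Longrightarrow> orthogonal n y"
    using orthogonal_to_subspace_exists by blast
  have "mink v n = 0" if "v \<in> {a, b, c}" for v
    using n(2)[of "?fl v"] that
    by (auto simp: mink_eq_inner orthogonal_def inner_commute span_base)
  then show ?thesis using that n(1) by (simp add: mink_commute)
qed

section \<open>Local parametrisations\<close>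

lemma local_paramD:
  assumes "local_param M x U \<phi>"
  shows "open U" "openin (top_of_set M) (\<phi> ` U)" "smooth_on U (x \<circ> \<phi>)" "inj_on \<phi> U" "continuous_on U \<phi>"
    "\<phi> ` U \<subseteq> M" "\<And>u. u \<in> U \<Longrightarrow> inj (frechet_derivative (x \<circ> \<phi>) (at u))"
proof -
  show "open U" "openin (top_of_set M) (\<phi> ` U)" "smooth_on U (x \<circ> \<phi>)"
    "\<And>u. u \<in> U \<Longrightarrow> inj (frechet_derivative (x \<circ> \<phi>) (at u))"
    using assms by (auto simp: local_param_def)
  obtain \<psi> where "homeomorphism U (\<phi> ` U) \<phi> \<psi>" using assms by (auto simp: local_param_def)
  then show "inj_on \<phi> U" "continuous_on U \<phi>"
    by (auto simp: homeomorphism_def intro: inj_on_inverseI[of U \<psi>])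
  show "\<phi> ` U \<subseteq> M" using \<open>openin (top_of_set M) (\<phi> ` U)\<close> openin_imp_subset by blast
qed

lemma local_param_has_derivative:
  assumes "local_param M x U \<phi>" "u \<in> U"
  shows "((x \<circ> \<phi>) has_derivative frechet_derivative (x \<circ> \<phi>) (at u)) (at u)"
    "linear (frechet_derivative (x \<circ> \<phi>) (at u))"
  using smooth_on_has_derivative[OF local_paramD(3)[OF assms(1)] assms(2)] has_derivative_linear by blast+

lemma chart_image_open:
  assumes "local_param M x U \<phi>" "open T" "T \<subseteq> U"
  shows "openin (top_of_set M) (\<phi> ` T)"
proof -
  obtain \<psi> where "homeomorphism U (\<phi> ` U) \<phi> \<psi>" using assms by (auto simp: local_param_def)
  moreover have "openin (top_of_set U) T"
    using assms by (simp add: open_subset)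
  ultimately have "openin (top_of_set (\<phi> ` U)) (\<phi> ` T)"
    by (rule homeomorphism_imp_open_map)
  then show ?thesis using local_paramD(2)[OF assms(1)] openin_trans by blast
qed

lemma chart_preimage_open:
  assumes "local_param M x U \<phi>" "openin (top_of_set M) V"
  shows "open {u \<in> U. \<phi> u \<in> V}"
proof -
  have "openin (top_of_set U) (U \<inter> \<phi> -` V)"
    by (rule continuous_openin_preimage[OF local_paramD(5)[OF assms(1)] _ assms(2)])
       (use local_paramD(6)[OF assms(1)] in blast)
  moreover have "U \<inter> \<phi> -` V = {u \<in> U. \<phi> u \<in> V}" by auto
  ultimately show ?thesis using local_paramD(1)[OF assms(1)] by (metis openin_open_eq)
qed

lemma local_param_subset:
  assumes "local_param M x U \<phi>" "open T" "T \<subseteq> U"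
  shows "local_param M x T \<phi>"
proof -
  obtain \<psi> where "homeomorphism U (\<phi> ` U) \<phi> \<psi>" using assms by (auto simp: local_param_def)
  then have "homeomorphism T (\<phi> ` T) \<phi> \<psi>"
    using assms(3) by (meson homeomorphism_of_subsets image_mono order_refl)
  then show ?thesis
    using assms chart_image_open[OF assms] unfolding local_param_def
    by (auto intro: smooth_on_subset)
qed

text \<open>The chain rule for \<open>g \<circ> h\<close> being the identity gives the third claim,
  which makes the differential of \<open>h\<close>, and hence that of the new parametrisation,
  injective.\<close>

lemma local_param_reparam:
  assumes par: "local_param M x U \<phi>"
    and T: "open T" "open T'" "T' \<subseteq> U" and hom: "homeomorphism T T' h g"
    and s: "smooth_on T h" "smooth_on T' g"
  shows "local_param M x T (\<phi> \<circ> h)"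
    and "u \<in> T \<Longrightarrow> frechet_derivative (x \<circ> (\<phi> \<circ> h)) (at u) =
      frechet_derivative (x \<circ> \<phi>) (at (h u)) \<circ> frechet_derivative h (at u)"
    and "u \<in> T \<Longrightarrow> frechet_derivative g (at (h u)) (frechet_derivative h (at u) w) = w"
proof -
  have hT: "h ` T = T'" and gh: "\<And>u. u \<in> T \<Longrightarrow> g (h u) = u" using hom by (auto simp: homeomorphism_def)
  have hU: "h u \<in> U" if "u \<in> T" for u using that hT T by blast
  show d: "frechet_derivative (x \<circ> (\<phi> \<circ> h)) (at u) =
      frechet_derivative (x \<circ> \<phi>) (at (h u)) \<circ> frechet_derivative h (at u)" if "u \<in> T" for u
    using frechet_derivative_compose'[OF local_param_has_derivative(1)[OF par hU[OF that]]
        smooth_on_has_derivative[OF s(1) that]] by (simp add: o_assoc)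
  show gd: "frechet_derivative g (at (h u)) (frechet_derivative h (at u) w) = w" if "u \<in> T" for u w
  proof -
    have "frechet_derivative (g \<circ> h) (at u) = frechet_derivative g (at (h u)) \<circ> frechet_derivative h (at u)"
      using that hT
      by (intro frechet_derivative_compose' smooth_on_has_derivative[OF s(1)] smooth_on_has_derivative[OF s(2)]) auto
    moreover have "((g \<circ> h) has_derivative id) (at u)"
      by (rule has_derivative_transform_within_open[OF has_derivative_id T(1) that]) (simp add: gh)
    ultimately show ?thesis using frechet_derivative_eqI by (metis comp_apply id_apply)
  qed
  obtain \<psi> where \<psi>: "homeomorphism U (\<phi> ` U) \<phi> \<psi>" using par by (auto simp: local_param_def)
  have "homeomorphism T' (\<phi> ` T') \<phi> \<psi>"
    using homeomorphism_of_subsets[OF \<psi>] T(3) by blast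
  then have "homeomorphism T (\<phi> ` T') (\<phi> \<circ> h) (g \<circ> \<psi>)"
    by (rule homeomorphism_compose[OF hom])
  moreover have im: "(\<phi> \<circ> h) ` T = \<phi> ` T'" using hT by auto
  moreover have "smooth_on T (x \<circ> (\<phi> \<circ> h))"
    using smooth_on_compose[OF T(1) local_paramD(1)[OF par] s(1) local_paramD(3)[OF par]] hU
    by (auto simp: o_def image_subset_iff)
  moreover have "inj (frechet_derivative (x \<circ> (\<phi> \<circ> h)) (at u))" if "u \<in> T" for u
    unfolding d[OF that]
    by (rule inj_compose[OF local_paramD(7)[OF par hU[OF that]]]) (metis gd[OF that] injI)
  ultimately show "local_param M x T (\<phi> \<circ> h)"
    using chart_image_open[OF par T(2,3)] T(1) unfolding local_param_def im by blast
qed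

text \<open>The inverse of a parametrisation is only known to be continuous. Composing
  \<open>x \<circ> \<kappa>\<close> with a linear left inverse of its differential at
  \<open>w\<close> gives a local diffeomorphism of the plane with smooth inverse \<open>h\<close>;
  then \<open>h\<close> after \<open>l \<circ> x \<circ> \<phi>\<close> is the transition map, and
  it is smooth because \<open>x \<circ> \<phi>\<close> is.\<close>

lemma chart_transition:
  assumes par: "local_param M x U \<phi>" "local_param M x W \<kappa>" and p: "u \<in> U" "w \<in> W" "\<phi> u = \<kappa> w"
  obtains T \<tau> where "open T" "u \<in> T" "T \<subseteq> U" "smooth_on T \<tau>" "\<tau> ` T \<subseteq> W" "\<tau> u = w"
    "\<And>z. z \<in> T \<Longrightarrow> \<kappa> (\<tau> z) = \<phi> z"
proof -
  let ?y = "x \<circ> \<kappa>"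
  obtain l where l: "linear l" "l \<circ> frechet_derivative ?y (at w) = id"
    using linear_injective_left_inverse local_param_has_derivative(2)[OF par(2) p(2)]
      local_paramD(7)[OF par(2) p(2)] by blast
  have bl: "bounded_linear l" using l(1) by (simp add: linear_conv_bounded_linear)
  define g where "g = l \<circ> ?y"
  have sg: "smooth_on W g"
    unfolding g_def o_def using smooth_on_comp_linear[OF bl local_paramD(1)[OF par(2)] local_paramD(3)[OF par(2)]]
    by (simp add: o_def)
  have "frechet_derivative g (at w) = l \<circ> frechet_derivative ?y (at w)"
    unfolding g_def
    by (rule frechet_derivative_compose'[OF bounded_linear_imp_has_derivative[OF bl]
          local_param_has_derivative(1)[OF par(2) p(2)]])
  then have "inj (frechet_derivative g (at w))" using l by simp
  then obtain W0 V h where W0: "open W0" "W0 \<subseteq> W" "w \<in> W0" "open V" "homeomorphism W0 V g h" "smooth_on V h"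
    using smooth_inverse_function[OF local_paramD(1)[OF par(2)] sg p(2)] by blast
  define T where "T = {z \<in> U. \<phi> z \<in> \<kappa> ` W0}"
  define \<tau> where "\<tau> z = h (l (x (\<phi> z)))" for z
  have T: "open T" "u \<in> T" "T \<subseteq> U"
    unfolding T_def using chart_preimage_open[OF par(1) chart_image_open[OF par(2) W0(1,2)]] p W0 by auto
  have \<tau>: "\<tau> z \<in> W0 \<and> \<kappa> (\<tau> z) = \<phi> z \<and> l (x (\<phi> z)) \<in> V" if z: "z \<in> T" for z
  proof -
    obtain w' where w': "w' \<in> W0" "\<phi> z = \<kappa> w'" using z unfolding T_def by blast
    then have "l (x (\<phi> z)) = g w'" by (simp add: g_def)
    then show ?thesis using w' W0(5) by (auto simp: \<tau>_def homeomorphism_def)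
  qed
  have "smooth_on T \<tau>"
    unfolding \<tau>_def
  proof (rule smooth_on_compose[OF T(1) W0(4) _ W0(6)])
    show "smooth_on T (\<lambda>z. l (x (\<phi> z)))"
      using smooth_on_comp_linear[OF bl T(1) smooth_on_subset[OF local_paramD(3)[OF par(1)] T(3)]] by simp
  qed (use \<tau> in auto)
  moreover have "\<tau> u = w"
    using \<tau>[OF T(2)] p W0(2) local_paramD(4)[OF par(2)] by (auto simp: inj_on_def)
  ultimately show ?thesis using that T \<tau> W0(2) by blast
qed

text \<open>The point is that one and the same \<open>\<tau>'\<close> serves \<open>x\<close> and
  every \<open>g\<close>: this is why the derivative of \<open>g\<close> depends only on the tangent
  vector and not on the chart representing it.\<close>

lemma chart_change_derivative:
  assumes par: "local_param M x U \<phi>" "local_param M x W \<kappa>" and p: "u \<in> U" "w \<in> W" "\<phi> u = \<kappa> w"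
  obtains \<tau>' where "frechet_derivative (x \<circ> \<phi>) (at u) = frechet_derivative (x \<circ> \<kappa>) (at w) \<circ> \<tau>'"
    "\<And>g::'a::topological_space \<Rightarrow> 'b::real_normed_vector. (g \<circ> \<kappa>) differentiable (at w) \<Longrightarrow>
      frechet_derivative (g \<circ> \<phi>) (at u) = frechet_derivative (g \<circ> \<kappa>) (at w) \<circ> \<tau>'"
proof -
  obtain T \<tau> where T: "open T" "u \<in> T" "T \<subseteq> U" "smooth_on T \<tau>" "\<tau> ` T \<subseteq> W" "\<tau> u = w"
    "\<And>z. z \<in> T \<Longrightarrow> \<kappa> (\<tau> z) = \<phi> z"
    using chart_transition[OF par p] by blast
  have d: "frechet_derivative (g \<circ> \<phi>) (at u) = frechet_derivative (g \<circ> \<kappa>) (at w) \<circ> frechet_derivative \<tau> (at u)"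
    if "(g \<circ> \<kappa>) differentiable (at w)" for g :: "'a \<Rightarrow> 'c::real_normed_vector"
  proof (rule frechet_derivative_eqI, rule has_derivative_transform_within_open[OF _ T(1,2)])
    show "(g \<circ> \<kappa> \<circ> \<tau> has_derivative frechet_derivative (g \<circ> \<kappa>) (at w) \<circ> frechet_derivative \<tau> (at u)) (at u)"
      using that T(6) smooth_on_has_derivative[OF T(4,2)] by (intro diff_chain_at) (auto simp: frechet_derivative_works)
  qed (use T(7) in simp)
  show ?thesis
    by (rule that[of "frechet_derivative \<tau> (at u)"])
       (rule d[OF smooth_on_differentiable[OF local_paramD(3)[OF par(2)] p(2)]], erule d)
qed

text \<open>Any other representation of the tangent vector differs by the transition derivative, and
  injectivity of the differential of \<open>x \<circ> \<phi>\<close> recovers the coordinate vector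
  \<open>w\<close> from it. So the description in \<open>deriv_along\<close> has a unique
  value.\<close>

lemma deriv_along_eq:
  fixes g :: "'a::topological_space \<Rightarrow> 'b::real_normed_vector"
  assumes par: "local_param M x U \<phi>" "u \<in> U" and g: "(g \<circ> \<phi>) differentiable (at u)"
  shows "deriv_along M x g (\<phi> u) (frechet_derivative (x \<circ> \<phi>) (at u) w) = frechet_derivative (g \<circ> \<phi>) (at u) w"
  unfolding deriv_along_def
proof (rule the_equality)
  fix z
  assume "\<exists>U' \<phi>' u' w'. local_param M x U' \<phi>' \<and> u' \<in> U' \<and> \<phi>' u' = \<phi> u \<and>
        frechet_derivative (x \<circ> \<phi>) (at u) w = frechet_derivative (x \<circ> \<phi>') (at u') w' \<and>
        z = frechet_derivative (g \<circ> \<phi>') (at u') w'"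
  then obtain U' \<phi>' u' w' where *: "local_param M x U' \<phi>'" "u' \<in> U'" "\<phi>' u' = \<phi> u"
    "frechet_derivative (x \<circ> \<phi>) (at u) w = frechet_derivative (x \<circ> \<phi>') (at u') w'"
    "z = frechet_derivative (g \<circ> \<phi>') (at u') w'" by blast
  obtain \<tau>' where \<tau>': "frechet_derivative (x \<circ> \<phi>') (at u') = frechet_derivative (x \<circ> \<phi>) (at u) \<circ> \<tau>'"
    "frechet_derivative (g \<circ> \<phi>') (at u') = frechet_derivative (g \<circ> \<phi>) (at u) \<circ> \<tau>'"
    using chart_change_derivative[OF *(1) par(1) *(2) par(2) *(3)] g by metis
  have "w = \<tau>' w'"
    using *(4) \<tau>'(1) local_paramD(7)[OF par] by (auto simp: inj_eq)
  then show "z = frechet_derivative (g \<circ> \<phi>) (at u) w" using *(5) \<tau>'(2) by simp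
qed (use par in blast)

lemma tangent_space_eq:
  assumes "local_param M x U \<phi>" "u \<in> U"
  shows "tangent_space M x (\<phi> u) = range (frechet_derivative (x \<circ> \<phi>) (at u))"
proof
  show "tangent_space M x (\<phi> u) \<subseteq> range (frechet_derivative (x \<circ> \<phi>) (at u))"
  proof
    fix v assume "v \<in> tangent_space M x (\<phi> u)"
    then obtain U' \<phi>' u' w' where *: "local_param M x U' \<phi>'" "u' \<in> U'" "\<phi>' u' = \<phi> u"
      "v = frechet_derivative (x \<circ> \<phi>') (at u') w'" unfolding tangent_space_def by blast
    obtain \<tau>' where "frechet_derivative (x \<circ> \<phi>') (at u') = frechet_derivative (x \<circ> \<phi>) (at u) \<circ> \<tau>'"
      using chart_change_derivative[OF *(1) assms(1) *(2) assms(2) *(3)] by metis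
    then show "v \<in> range (frechet_derivative (x \<circ> \<phi>) (at u))" using *(4) by auto
  qed
qed (use assms in \<open>unfold tangent_space_def, blast\<close>)

text \<open>The definition ranges over all charts; smoothness of the transition maps reduces it to
  one chart around each point.\<close>

lemma smooth_map_onI:
  assumes "\<And>p. p \<in> V \<Longrightarrow> \<exists>U \<phi>. local_param M x U \<phi> \<and> p \<in> \<phi> ` U \<and> smooth_on U (g \<circ> \<phi>)"
  shows "smooth_map_on M x V g"
  unfolding smooth_map_on_def
proof (intro allI impI, elim conjE)
  fix U \<phi> assume U: "local_param M x U \<phi>" "\<phi> ` U \<subseteq> V"
  show "smooth_on U (g \<circ> \<phi>)"
  proof (rule smooth_on_local)
    fix u assume u: "u \<in> U"
    then obtain W \<kappa> where W: "local_param M x W \<kappa>" "\<phi> u \<in> \<kappa> ` W" "smooth_on W (g \<circ> \<kappa>)"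
      using assms U by blast
    then obtain w where w: "w \<in> W" "\<phi> u = \<kappa> w" by auto
    obtain T \<tau> where T: "open T" "u \<in> T" "T \<subseteq> U" "smooth_on T \<tau>" "\<tau> ` T \<subseteq> W"
      "\<tau> u = w" "\<And>z. z \<in> T \<Longrightarrow> \<kappa> (\<tau> z) = \<phi> z"
      using chart_transition[OF U(1) W(1) u w] by metis
    have "smooth_on T (\<lambda>z. (g \<circ> \<kappa>) (\<tau> z))"
      by (rule smooth_on_compose[OF T(1) local_paramD(1)[OF W(1)] T(4) W(3) T(5)])
    then have "smooth_on T (g \<circ> \<phi>)"
      by (rule smooth_on_cong[OF _ T(1)]) (simp add: T(7))
    with T show "\<exists>T. open T \<and> u \<in> T \<and> smooth_on T (g \<circ> \<phi>)" by blast
  qed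
qed

lemma smooth_map_onD:
  assumes "smooth_map_on M x V g" "openin (top_of_set M) V" "local_param M x U \<phi>"
  shows "smooth_on {u \<in> U. \<phi> u \<in> V} (g \<circ> \<phi>)"
proof -
  have "local_param M x {u \<in> U. \<phi> u \<in> V} \<phi>"
    by (rule local_param_subset[OF assms(3) chart_preimage_open[OF assms(3,2)]]) auto
  then show ?thesis using assms(1) unfolding smooth_map_on_def by blast
qed

section \<open>Null frames and the second fundamental form\<close>

lemma span_pair: "v \<in> span {n, m} \<longleftrightarrow> (\<exists>a b. v = a *\<^sub>R n + b *\<^sub>R m)" for n m v :: "'a::real_vector"
proof -
  have "v \<in> span {n, m} \<longleftrightarrow> (\<exists>a b. v - a *\<^sub>R n = b *\<^sub>R m)"
    by (simp add: span_breakdown_eq span_singleton image_iff)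
  then show ?thesis by (simp add: diff_eq_eq add.commute)
qed

lemma span_pair_subset: "n \<in> span S \<Longrightarrow> m \<in> span S \<Longrightarrow> span {n, m} \<subseteq> span S"
  by (rule span_minimal) (auto simp: subspace_span)

text \<open>Both basis vectors are null, so the coefficient of each is read off by pairing with the
  other.\<close>

lemma span_null_pair:
  assumes "null_pair n m" "v \<in> span {n, m}"
  shows "v = (mink v m / mink n m) *\<^sub>R n + (mink v n / mink n m) *\<^sub>R m"
proof -
  obtain a b where v: "v = a *\<^sub>R n + b *\<^sub>R m" using assms(2) span_pair by blast
  have "mink v m = a * mink n m" "mink v n = b * mink n m"
    using null_pairD[OF assms(1)] by (simp_all add: v mink.add_left mink.scaleR_left)
  then show ?thesis using v null_pairD(7)[OF assms(1)] by simp
qed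

text \<open>The root with sign \<open>\<epsilon>\<close> of the quadratic equation in r that makes
  \<open>T + r *\<^sub>R S\<close> null.\<close>

definition null_coeff :: "real \<Rightarrow> real^4 \<Rightarrow> real^4 \<Rightarrow> real" where
  "null_coeff \<epsilon> T S = (\<epsilon> * sqrt ((mink T S)\<^sup>2 - mink T T * mink S S) - mink T S) / mink S S"

text \<open>In the plane of \<open>v\<close> and \<open>w\<close>, the vector \<open>T\<close> has
  time component 1 and \<open>S\<close> spans the direction of time component 0. The normalised null
  vectors are therefore the \<open>T + r *\<^sub>R S\<close> with r a root of a quadratic, whose
  discriminant is positive because the plane contains a time-like vector. All formulas are explicit
  in \<open>v\<close> and \<open>w\<close>, so that they depend smoothly on the basis.\<close>

lemma null_frame_of_basis:
  fixes v w :: "real^4"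
  assumes indep: "\<And>a b. a *\<^sub>R v + b *\<^sub>R w = 0 \<Longrightarrow> a = 0 \<and> b = 0"
    and timelike: "z \<in> span {v, w}" "mink z z < 0"
  defines "r \<equiv> (v$1)\<^sup>2 + (w$1)\<^sup>2"
  defines "T \<equiv> (v$1 / r) *\<^sub>R v + (w$1 / r) *\<^sub>R w"
  defines "S \<equiv> w$1 *\<^sub>R v - v$1 *\<^sub>R w"
  shows "r > 0" "mink S S > 0" "(mink T S)\<^sup>2 - mink T T * mink S S > 0"
    "null_pair (T + null_coeff 1 T S *\<^sub>R S) (T + null_coeff (- 1) T S *\<^sub>R S)"
    "span {T + null_coeff 1 T S *\<^sub>R S, T + null_coeff (- 1) T S *\<^sub>R S} = span {v, w}"
proof -
  let ?N = "\<lambda>\<epsilon>. T + null_coeff \<epsilon> T S *\<^sub>R S" and ?d = "(mink T S)\<^sup>2 - mink T T * mink S S"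
  obtain a b where z: "z = a *\<^sub>R v + b *\<^sub>R w" using timelike(1) span_pair by blast
  have z1: "z$1 \<noteq> 0" using mink_pos_if_time_zero[of z] timelike(2) by (metis less_asym mink.zero_left less_irrefl)
  then have nz: "v$1 \<noteq> 0 \<or> w$1 \<noteq> 0" by (auto simp: z)
  then show r: "r > 0" unfolding r_def sum_power2_gt_zero_iff .
  have rr: "v$1 * v$1 / r + w$1 * w$1 / r = 1"
  proof -
    have "v$1 * v$1 / r + w$1 * w$1 / r = r / r"
      unfolding add_divide_distrib[symmetric] by (simp add: r_def power2_eq_square)
    then show ?thesis using r by simp
  qed
  have S1: "S$1 = 0" and T1: "T$1 = 1" using rr by (simp_all add: S_def T_def)
  have S0: "S \<noteq> 0" using indep[of "w$1" "- v$1"] nz by (auto simp: S_def)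
  then show SS: "mink S S > 0" using S1 mink_pos_if_time_zero by blast
  \<comment> \<open>The inverse change of basis, from \<open>v\<close>, \<open>w\<close> back to
    \<open>T\<close>, \<open>S\<close>.\<close>
  have comb: "c *\<^sub>R v + d *\<^sub>R w = (c * v$1 + d * w$1) *\<^sub>R T + ((c * w$1 - d * v$1) / r) *\<^sub>R S" for c d
  proof -
    have *: "(c * v$1 + d * w$1) * (v$1 / r) + ((c * w$1 - d * v$1) / r) * w$1 = c * (v$1 * v$1 / r + w$1 * w$1 / r)"
      "(c * v$1 + d * w$1) * (w$1 / r) - ((c * w$1 - d * v$1) / r) * v$1 = d * (v$1 * v$1 / r + w$1 * w$1 / r)"
      by (simp_all add: add_divide_distrib diff_divide_distrib algebra_simps)
    have "(c * v$1 + d * w$1) *\<^sub>R T + ((c * w$1 - d * v$1) / r) *\<^sub>R S =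
      ((c * v$1 + d * w$1) * (v$1 / r) + ((c * w$1 - d * v$1) / r) * w$1) *\<^sub>R v +
      ((c * v$1 + d * w$1) * (w$1 / r) - ((c * w$1 - d * v$1) / r) * v$1) *\<^sub>R w"
      unfolding T_def S_def by (simp add: scaleR_add_right scaleR_diff_right scaleR_add_left scaleR_diff_left)
    then show ?thesis unfolding * rr by simp
  qed
  define t s where "t = a * v$1 + b * w$1" and "s = (a * w$1 - b * v$1) / r"
  have zts: "z = t *\<^sub>R T + s *\<^sub>R S" unfolding z t_def s_def by (rule comb)
  have t0: "t \<noteq> 0" using z1 by (simp add: zts S1 T1)
  have "mink z z = t\<^sup>2 * mink T T + 2 * t * s * mink T S + s\<^sup>2 * mink S S"
    by (simp add: zts mink.add_left mink.add_right mink.scaleR_left mink.scaleR_right mink_commute[of S T]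
        power2_eq_square algebra_simps)
  \<comment> \<open>Completing the square: a negative left side forces the discriminant to be
    positive.\<close>
  then have "mink S S * mink z z = (s * mink S S + t * mink T S)\<^sup>2 - t\<^sup>2 * ?d"
    by (simp add: power2_eq_square algebra_simps)
  moreover have "mink S S * mink z z < 0" using SS timelike(2) by (simp add: mult_pos_neg)
  ultimately have "t\<^sup>2 * ?d > 0" by (smt (verit) zero_le_power2)
  then show d: "?d > 0" using t0 by (simp add: zero_less_mult_iff)
  have null: "mink (?N \<epsilon>) (?N \<epsilon>) = 0" if "\<epsilon> * \<epsilon> = 1" for \<epsilon>
  proof -
    let ?l = "null_coeff \<epsilon> T S"
    have l: "mink S S * ?l + mink T S = \<epsilon> * sqrt ?d" using SS by (simp add: null_coeff_def)
    have "mink S S * mink (?N \<epsilon>) (?N \<epsilon>) = (mink S S * ?l + mink T S)\<^sup>2 - ?d"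
      by (simp add: mink.add_left mink.add_right mink.scaleR_left mink.scaleR_right mink_commute[of S T]
        power2_eq_square algebra_simps)
    also have "\<dots> = 0" unfolding l using d that by (simp add: power_mult_distrib) (simp add: power2_eq_square)
    finally show ?thesis using SS by simp
  qed
  have ldiff: "null_coeff 1 T S - null_coeff (- 1) T S \<noteq> 0"
    using SS d by (simp add: null_coeff_def diff_divide_distrib[symmetric])
  have eqS: "S = (1 / (null_coeff 1 T S - null_coeff (- 1) T S)) *\<^sub>R (?N 1 - ?N (- 1))"
    using ldiff by (simp add: scaleR_diff_left[symmetric])
  then have ne: "?N 1 \<noteq> ?N (- 1)" using S0 by (metis scaleR_zero_right cancel_comm_monoid_add_class.diff_cancel)
  then show "null_pair (?N 1) (?N (- 1))"
    using null[of 1] null[of "- 1"] by (simp add: null_pair_def S1 T1)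
  have TS: "T \<in> span {v, w}" "S \<in> span {v, w}"
    unfolding T_def S_def by (intro span_add span_diff span_scale span_base; simp)+
  have Sm: "S \<in> span {?N 1, ?N (- 1)}"
    by (subst eqS) (intro span_diff span_scale span_base; simp)
  have "T = ?N 1 - null_coeff 1 T S *\<^sub>R S" by simp
  also have "\<dots> \<in> span {?N 1, ?N (- 1)}" by (intro span_diff span_scale Sm) (simp add: span_base)
  finally have Tm: "T \<in> span {?N 1, ?N (- 1)}" .
  have "v \<in> span {?N 1, ?N (- 1)}" "w \<in> span {?N 1, ?N (- 1)}"
    using comb[of 1 0] comb[of 0 1] span_add[OF span_scale[OF Tm] span_scale[OF Sm]]
    by (metis add_0 add.right_neutral scaleR_one scaleR_zero_left)+
  then show "span {?N 1, ?N (- 1)} = span {v, w}"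
    by (intro equalityI span_pair_subset span_add span_scale TS)
qed

lemma range_linear_plane:
  fixes L :: "real \<times> real \<Rightarrow> 'b::real_vector"
  assumes "linear L"
  shows "L (a, b) = a *\<^sub>R L (1,0) + b *\<^sub>R L (0,1)" "range L = span {L (1,0), L (0,1)}"
proof -
  have *: "L (a, b) = a *\<^sub>R L (1,0) + b *\<^sub>R L (0,1)" for a b
  proof -
    have "L (a *\<^sub>R (1,0) + b *\<^sub>R (0,1)) = a *\<^sub>R L (1,0) + b *\<^sub>R L (0,1)"
      using assms by (simp only: linear_add linear_cmul)
    then show ?thesis by simp
  qed
  then show "L (a, b) = a *\<^sub>R L (1,0) + b *\<^sub>R L (0,1)" .
  show "range L = span {L (1,0), L (0,1)}"
  proof (intro equalityI subsetI)
    fix v assume "v \<in> range L"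
    then obtain z where "v = L z" by blast
    then have "v = fst z *\<^sub>R L (1,0) + snd z *\<^sub>R L (0,1)" using *[of "fst z" "snd z"] by simp
    then show "v \<in> span {L (1,0), L (0,1)}" unfolding span_pair by blast
  next
    fix v assume "v \<in> span {L (1,0), L (0,1)}"
    then obtain a b where "v = a *\<^sub>R L (1,0) + b *\<^sub>R L (0,1)" unfolding span_pair by blast
    then show "v \<in> range L" using *[of a b] by (metis rangeI)
  qed
qed

text \<open>Dimensions are bounded, so the maximum is attained, here by a negative definite line;
  each of its nonzero vectors will do.\<close>

lemma index_one_timelike:
  assumes "0 \<in> W" "index_of W = 1"
  shows "\<exists>v\<in>W. mink v v < 0"
proof -
  let ?A = "{N. subspace N \<and> N \<subseteq> W \<and> (\<forall>v\<in>N. v \<noteq> 0 \<longrightarrow> mink v v < 0)}"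
  have "dim ` ?A \<subseteq> {..DIM(real^4)}" using dim_subset_UNIV[where 'a = "real^4"] by blast
  then have "finite (dim ` ?A)" using finite_subset by blast
  moreover have "dim ` ?A \<noteq> {}"
    using assms(1) by (auto simp: subspace_0 intro!: exI[of _ "{0}"])
  ultimately have "Max (dim ` ?A) \<in> dim ` ?A" by (rule Max_in)
  then have "1 \<in> dim ` ?A" using assms(2) unfolding index_of_def by metis
  then obtain N where N: "subspace N" "N \<subseteq> W" "\<forall>v\<in>N. v \<noteq> 0 \<longrightarrow> mink v v < 0" "dim N = 1" by auto
  then have "\<not> N \<subseteq> {0}" by (metis dim_eq_0 zero_neq_one)
  then show ?thesis using N by blast
qed

text \<open>The explicit roots are smooth in the coordinate vectors, and their signs distinguish the
  two null directions consistently, so the frame exists on the whole chart and not only near a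
  point.\<close>

lemma null_frame:
  assumes par: "local_param M x U \<phi>" and lor: "lorentzian M x"
  obtains N1 N2 where "smooth_on U N1" "smooth_on U N2" "\<And>z. z \<in> U \<Longrightarrow> null_pair (N1 z) (N2 z)"
    "\<And>z. z \<in> U \<Longrightarrow> tangent_space M x (\<phi> z) = span {N1 z, N2 z}"
proof -
  define v where "v z = frechet_derivative (x \<circ> \<phi>) (at z) (1,0)" for z
  define w where "w z = frechet_derivative (x \<circ> \<phi>) (at z) (0,1)" for z
  define r where "r z = (v z$1)\<^sup>2 + (w z$1)\<^sup>2" for z
  define T where "T z = (v z$1 / r z) *\<^sub>R v z + (w z$1 / r z) *\<^sub>R w z" for z
  define S where "S z = w z$1 *\<^sub>R v z - v z$1 *\<^sub>R w z" for z
  have tang: "tangent_space M x (\<phi> z) = span {v z, w z}" if "z \<in> U" for z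
    unfolding tangent_space_eq[OF par that] v_def w_def
    by (rule range_linear_plane(2)[OF local_param_has_derivative(2)[OF par that]])
  have indep: "a = 0 \<and> b = 0" if z: "z \<in> U" and "a *\<^sub>R v z + b *\<^sub>R w z = 0" for z a b
  proof -
    note lin = local_param_has_derivative(2)[OF par z]
    have "frechet_derivative (x \<circ> \<phi>) (at z) (a, b) = frechet_derivative (x \<circ> \<phi>) (at z) 0"
      using that(2) range_linear_plane(1)[OF lin, of a b] linear_0[OF lin] by (simp add: v_def w_def)
    then have "(a, b) = 0" using local_paramD(7)[OF par z] by (simp only: inj_eq)
    then show ?thesis by (simp add: zero_prod_def)
  qed
  have tl: "\<exists>y. y \<in> span {v z, w z} \<and> mink y y < 0" if "z \<in> U" for z
  proof -
    have "\<phi> z \<in> M" using local_paramD(6)[OF par] that by blast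
    then have "index_of (tangent_space M x (\<phi> z)) = 1" using lor by (simp add: lorentzian_def)
    then show ?thesis
      using index_one_timelike[of "span {v z, w z}"] by (auto simp: tang[OF that] span_zero)
  qed
  have facts: "r z > 0" "mink (S z) (S z) > 0" "(mink (T z) (S z))\<^sup>2 - mink (T z) (T z) * mink (S z) (S z) > 0"
    "null_pair (T z + null_coeff 1 (T z) (S z) *\<^sub>R S z) (T z + null_coeff (- 1) (T z) (S z) *\<^sub>R S z)"
    "span {T z + null_coeff 1 (T z) (S z) *\<^sub>R S z, T z + null_coeff (- 1) (T z) (S z) *\<^sub>R S z} = span {v z, w z}"
    if z: "z \<in> U" for z
  proof -
    obtain y where y: "y \<in> span {v z, w z}" "mink y y < 0" using tl[OF z] by blast
    note N = null_frame_of_basis[OF indep[OF z] y, folded r_def, folded S_def, folded T_def]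
    show "r z > 0" "mink (S z) (S z) > 0" "(mink (T z) (S z))\<^sup>2 - mink (T z) (T z) * mink (S z) (S z) > 0"
      "null_pair (T z + null_coeff 1 (T z) (S z) *\<^sub>R S z) (T z + null_coeff (- 1) (T z) (S z) *\<^sub>R S z)"
      "span {T z + null_coeff 1 (T z) (S z) *\<^sub>R S z, T z + null_coeff (- 1) (T z) (S z) *\<^sub>R S z} = span {v z, w z}"
      by (rule N; assumption)+
  qed
  note U = local_paramD(1)[OF par]
  have sv: "smooth_on U v" "smooth_on U w"
    unfolding v_def w_def by (intro smooth_on_frechet local_paramD(3)[OF par])+
  have sr: "smooth_on U r"
    unfolding r_def power2_eq_square by (intro smooth_on_add smooth_on_mult smooth_on_nth sv U)
  have sT: "smooth_on U T" "smooth_on U S"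
    unfolding T_def S_def using facts(1)
    by (intro smooth_on_add smooth_on_diff smooth_on_scaleR smooth_on_divide smooth_on_nth sv sr U; force)+
  have sN: "smooth_on U (\<lambda>z. T z + null_coeff \<epsilon> (T z) (S z) *\<^sub>R S z)" for \<epsilon>
    unfolding null_coeff_def power2_eq_square using facts(2,3)
    by (intro smooth_on_add smooth_on_diff smooth_on_scaleR smooth_on_divide smooth_on_mult smooth_on_const
        smooth_on_sqrt smooth_on_mink sT U; force simp: power2_eq_square)
  show ?thesis
    by (rule that[OF sN[of 1] sN[of "- 1"]]) (simp_all only: facts tang)
qed

lemma tangent_part_null_pair:
  assumes "null_pair n m" "tangent_space M x p = span {n, m}"
  shows "tangent_part M x p z = (mink z m / mink n m) *\<^sub>R n + (mink z n / mink n m) *\<^sub>R m"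
    "\<xi> \<in> normal_space M x p \<longleftrightarrow> mink n \<xi> = 0 \<and> mink m \<xi> = 0"
proof -
  note n = null_pairD[OF assms(1)]
  show nor: "\<xi> \<in> normal_space M x p \<longleftrightarrow> mink n \<xi> = 0 \<and> mink m \<xi> = 0" for \<xi>
  proof
    assume "\<xi> \<in> normal_space M x p"
    then show "mink n \<xi> = 0 \<and> mink m \<xi> = 0"
      unfolding normal_space_def assms(2) by (simp add: span_base)
  next
    assume "mink n \<xi> = 0 \<and> mink m \<xi> = 0"
    then have "mink (a *\<^sub>R n + b *\<^sub>R m) \<xi> = 0" for a b
      by (simp add: mink.add_left mink.scaleR_left)
    then show "\<xi> \<in> normal_space M x p"
      unfolding normal_space_def assms(2) by (auto simp: span_pair)
  qed
  show "tangent_part M x p z = (mink z m / mink n m) *\<^sub>R n + (mink z n / mink n m) *\<^sub>R m"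
    unfolding tangent_part_def
  proof (rule the_equality)
    show "(mink z m / mink n m) *\<^sub>R n + (mink z n / mink n m) *\<^sub>R m \<in> tangent_space M x p \<and>
        z - ((mink z m / mink n m) *\<^sub>R n + (mink z n / mink n m) *\<^sub>R m) \<in> normal_space M x p"
      unfolding nor assms(2) span_pair using n
      by (auto simp: mink.add_right mink.diff_right mink.scaleR_right mink_commute[of _ z])
  next
    fix v assume v: "v \<in> tangent_space M x p \<and> z - v \<in> normal_space M x p"
    then have "mink z n = mink v n" "mink z m = mink v m"
      unfolding nor by (auto simp: mink.diff_right mink_commute[of _ n] mink_commute[of _ m])
    then show "v = (mink z m / mink n m) *\<^sub>R n + (mink z n / mink n m) *\<^sub>R m"
      using span_null_pair[OF assms(1), of v] v assms(2) by simp
  qed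
qed

lemma normal_part_null_pair:
  assumes "null_pair n m" "tangent_space M x p = span {n, m}"
  shows "linear (normal_part M x p)"
    "normal_part M x p v = 0 \<longleftrightarrow> v \<in> tangent_space M x p"
    "mink n (normal_part M x p v) = 0" "mink m (normal_part M x p v) = 0"
    "mink n v = 0 \<Longrightarrow> mink m v = 0 \<Longrightarrow> normal_part M x p v = v"
proof -
  note n = null_pairD[OF assms(1)]
  note eq = tangent_part_null_pair(1)[OF assms]
  show "linear (normal_part M x p)"
    by (rule linearI)
       (simp_all add: normal_part_def eq mink.add_left mink.scaleR_left add_divide_distrib algebra_simps)
  show "normal_part M x p v = 0 \<longleftrightarrow> v \<in> tangent_space M x p"
  proof
    assume "normal_part M x p v = 0"
    then show "v \<in> tangent_space M x p" unfolding normal_part_def eq assms(2) span_pair by auto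
  next
    assume "v \<in> tangent_space M x p"
    then show "normal_part M x p v = 0"
      using span_null_pair[OF assms(1)] unfolding normal_part_def eq assms(2) by simp
  qed
  show "mink n (normal_part M x p v) = 0" "mink m (normal_part M x p v) = 0"
    using n by (simp_all add: normal_part_def eq mink.add_right mink.diff_right mink.scaleR_right mink_commute[of _ v])
  show "mink n v = 0 \<Longrightarrow> mink m v = 0 \<Longrightarrow> normal_part M x p v = v"
    by (simp add: normal_part_def eq mink_commute[of v])
qed

text \<open>A tangent field vanishing at \<open>u\<close> has tangent derivatives at \<open>u\<close>, so the normal part of the
  derivative depends only on the value of the field at \<open>u\<close>.\<close>

lemma tangent_derivative_at_zero:
  assumes par: "local_param M x U \<phi>" and lor: "lorentzian M x" and T: "open T" "T \<subseteq> U" "u \<in> T"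
    and E: "smooth_on T E" "\<And>z. z \<in> T \<Longrightarrow> E z \<in> tangent_space M x (\<phi> z)" "E u = 0"
  shows "frechet_derivative E (at u) w \<in> tangent_space M x (\<phi> u)"
proof -
  obtain N1 N2 where N: "smooth_on U N1" "smooth_on U N2" "\<And>z. z \<in> U \<Longrightarrow> null_pair (N1 z) (N2 z)"
    "\<And>z. z \<in> U \<Longrightarrow> tangent_space M x (\<phi> z) = span {N1 z, N2 z}"
    using null_frame[OF par lor] by metis
  define a where "a z = mink (E z) (N2 z) / mink (N1 z) (N2 z)" for z
  define b where "b z = mink (E z) (N1 z) / mink (N1 z) (N2 z)" for z
  have sN: "smooth_on T N1" "smooth_on T N2" using N T smooth_on_subset by blast+
  have nz: "mink (N1 z) (N2 z) \<noteq> 0" if "z \<in> T" for z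
    using null_pairD(7)[OF N(3)] T that by (metis less_irrefl subsetD)
  have s: "smooth_on T a" "smooth_on T b"
    unfolding a_def b_def by (intro smooth_on_divide smooth_on_mink E sN T nz; assumption)+
  have Eq: "a z *\<^sub>R N1 z + b z *\<^sub>R N2 z = E z" if "z \<in> T" for z
  proof -
    have z: "z \<in> U" using that T(2) by blast
    show ?thesis
      using span_null_pair[OF N(3)[OF z]] E(2)[OF that] unfolding a_def b_def N(4)[OF z] by metis
  qed
  have 0: "a u = 0" "b u = 0" by (simp_all add: a_def b_def E(3) mink.zero_left)
  have "((\<lambda>z. a z *\<^sub>R N1 z + b z *\<^sub>R N2 z) has_derivative
      (\<lambda>w. (a u *\<^sub>R frechet_derivative N1 (at u) w + frechet_derivative a (at u) w *\<^sub>R N1 u) +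
        (b u *\<^sub>R frechet_derivative N2 (at u) w + frechet_derivative b (at u) w *\<^sub>R N2 u))) (at u)"
    by (intro has_derivative_add has_derivative_scaleR smooth_on_has_derivative[OF s(1) T(3)]
        smooth_on_has_derivative[OF s(2) T(3)] smooth_on_has_derivative[OF sN(1) T(3)]
        smooth_on_has_derivative[OF sN(2) T(3)])
  then have "(E has_derivative
      (\<lambda>w. (a u *\<^sub>R frechet_derivative N1 (at u) w + frechet_derivative a (at u) w *\<^sub>R N1 u) +
        (b u *\<^sub>R frechet_derivative N2 (at u) w + frechet_derivative b (at u) w *\<^sub>R N2 u))) (at u)"
    by (rule has_derivative_transform_within_open[OF _ T(1,3)]) (rule Eq)
  from frechet_derivative_eqI[OF this]
  have "frechet_derivative E (at u) w = frechet_derivative a (at u) w *\<^sub>R N1 u + frechet_derivative b (at u) w *\<^sub>R N2 u"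
    by (simp add: 0)
  moreover have "u \<in> U" using T by blast
  ultimately show ?thesis unfolding N(4)[OF \<open>u \<in> U\<close>] span_pair by blast
qed

text \<open>Two tangent extensions of the same vector differ by a tangent field that vanishes at
  \<open>u\<close>, whose derivative there is tangent. This justifies the definite description and
  reduces the form to a derivative in one chart.\<close>

lemma second_ff_eq:
  assumes par: "local_param M x U \<phi>" and lor: "lorentzian M x" and u: "u \<in> U"
    and E: "smooth_on U E" "\<And>z. z \<in> U \<Longrightarrow> E z \<in> tangent_space M x (\<phi> z)"
  shows "second_ff M x (\<phi> u) (frechet_derivative (x \<circ> \<phi>) (at u) w) (E u) =
    normal_part M x (\<phi> u) (frechet_derivative E (at u) w)"
  unfolding second_ff_def
proof (rule the_equality)
  note U = local_paramD[OF par]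
  \<comment> \<open>The chart field \<open>E\<close> carried over to the surface, to serve as the
    extension that the definition asks for.\<close>
  define Y where "Y = E \<circ> the_inv_into U \<phi>"
  have Y: "(Y \<circ> \<phi>) z = E z" if "z \<in> U" for z
    using that by (simp add: Y_def the_inv_into_f_f[OF U(4)])
  have sY: "smooth_on U (Y \<circ> \<phi>)" by (rule smooth_on_cong[OF E(1) U(1)]) (simp only: Y)
  have "tangent_field M x (\<phi> ` U) Y"
    unfolding tangent_field_def
  proof
    show "smooth_map_on M x (\<phi> ` U) Y" by (rule smooth_map_onI) (use par sY in blast)
    show "\<forall>p\<in>\<phi> ` U. Y p \<in> tangent_space M x p" using Y E(2) by simp
  qed
  moreover have "deriv_along M x Y (\<phi> u) (frechet_derivative (x \<circ> \<phi>) (at u) w) = frechet_derivative E (at u) w"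
  proof -
    have "frechet_derivative (Y \<circ> \<phi>) (at u) = frechet_derivative E (at u)"
      by (rule frechet_derivative_transform_within_open[OF smooth_on_differentiable[OF sY u] U(1) u Y])
    then show ?thesis using deriv_along_eq[OF par u smooth_on_differentiable[OF sY u]] by simp
  qed
  moreover have "Y (\<phi> u) = E u" using Y[OF u] by simp
  ultimately show "\<exists>V Y. openin (top_of_set M) V \<and> \<phi> u \<in> V \<and> tangent_field M x V Y \<and> Y (\<phi> u) = E u \<and>
      normal_part M x (\<phi> u) (frechet_derivative E (at u) w) =
      normal_part M x (\<phi> u) (deriv_along M x Y (\<phi> u) (frechet_derivative (x \<circ> \<phi>) (at u) w))"
    using U(2) u by (intro exI[of _ "\<phi> ` U"] exI[of _ Y]) simp
next
  fix z
  assume "\<exists>V Y. openin (top_of_set M) V \<and> \<phi> u \<in> V \<and> tangent_field M x V Y \<and> Y (\<phi> u) = E u \<and>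
      z = normal_part M x (\<phi> u) (deriv_along M x Y (\<phi> u) (frechet_derivative (x \<circ> \<phi>) (at u) w))"
  then obtain V Y where V: "openin (top_of_set M) V" "\<phi> u \<in> V" and Y: "tangent_field M x V Y" "Y (\<phi> u) = E u"
    and z: "z = normal_part M x (\<phi> u) (deriv_along M x Y (\<phi> u) (frechet_derivative (x \<circ> \<phi>) (at u) w))"
    by metis
  define T where "T = {z \<in> U. \<phi> z \<in> V}"
  have T: "open T" "T \<subseteq> U" "u \<in> T" unfolding T_def using chart_preimage_open[OF par V(1)] V(2) u by auto
  have sY: "smooth_on T (Y \<circ> \<phi>)"
    unfolding T_def using Y(1) V(1) par by (intro smooth_map_onD) (auto simp: tangent_field_def)
  have sE: "smooth_on T E" using E(1) T(2) smooth_on_subset by blast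
  obtain N1 N2 where N: "\<And>z. z \<in> U \<Longrightarrow> null_pair (N1 z) (N2 z)"
    "\<And>z. z \<in> U \<Longrightarrow> tangent_space M x (\<phi> z) = span {N1 z, N2 z}"
    using null_frame[OF par lor] by metis
  let ?D = "\<lambda>z. (Y \<circ> \<phi>) z - E z"
  have "frechet_derivative ?D (at u) w \<in> tangent_space M x (\<phi> u)"
  proof (rule tangent_derivative_at_zero[OF par lor T])
    show "smooth_on T ?D" by (intro smooth_on_diff sY sE T)
    fix z assume z: "z \<in> T"
    then have zU: "z \<in> U" and "\<phi> z \<in> V" unfolding T_def by blast+
    then have "Y (\<phi> z) \<in> span {N1 z, N2 z}" "E z \<in> span {N1 z, N2 z}"
      using Y(1) E(2)[OF zU] unfolding N(2)[OF zU, symmetric] tangent_field_def by blast+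
    then show "?D z \<in> tangent_space M x (\<phi> z)"
      unfolding N(2)[OF zU] comp_apply by (rule span_diff)
  qed (simp add: Y(2))
  then have "normal_part M x (\<phi> u) (frechet_derivative ?D (at u) w) = 0"
    by (simp only: normal_part_null_pair(2)[OF N(1)[OF u] N(2)[OF u]])
  moreover have "frechet_derivative ?D (at u) w = frechet_derivative (Y \<circ> \<phi>) (at u) w - frechet_derivative E (at u) w"
    by (subst frechet_derivative_eqI[OF has_derivative_diff[OF smooth_on_has_derivative[OF sY T(3)]
          smooth_on_has_derivative[OF sE T(3)]]]) simp
  moreover have "deriv_along M x Y (\<phi> u) (frechet_derivative (x \<circ> \<phi>) (at u) w) = frechet_derivative (Y \<circ> \<phi>) (at u) w"
    by (rule deriv_along_eq[OF par u smooth_on_differentiable[OF sY T(3)]])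
  ultimately show "z = normal_part M x (\<phi> u) (frechet_derivative E (at u) w)"
    unfolding z by (simp add: linear_diff[OF normal_part_null_pair(1)[OF N(1)[OF u] N(2)[OF u]]])
qed

text \<open>With coordinate fields as extensions, the form becomes the normal part of the second
  derivative of \<open>x \<circ> \<phi>\<close>, which is symmetric by Schwarz' theorem and linear
  in the direction.\<close>

lemma second_ff_bilinear:
  assumes par: "local_param M x U \<phi>" and lor: "lorentzian M x" and u: "u \<in> U"
    and vw: "v \<in> tangent_space M x (\<phi> u)" "w \<in> tangent_space M x (\<phi> u)"
  shows "second_ff M x (\<phi> u) v w = second_ff M x (\<phi> u) w v"
    "second_ff M x (\<phi> u) (a *\<^sub>R v) w = a *\<^sub>R second_ff M x (\<phi> u) v w"
    "v' \<in> tangent_space M x (\<phi> u) \<Longrightarrow>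
      second_ff M x (\<phi> u) (v + v') w = second_ff M x (\<phi> u) v w + second_ff M x (\<phi> u) v' w"
proof -
  let ?y = "x \<circ> \<phi>"
  let ?d = "\<lambda>z. frechet_derivative ?y (at z)"
  obtain n m where N: "null_pair n m" "tangent_space M x (\<phi> u) = span {n, m}"
    using null_frame[OF par lor] u by metis
  note nl = normal_part_null_pair(1)[OF N]
  obtain v0 w0 where v: "v = ?d u v0" and w: "w = ?d u w0" using vw tangent_space_eq[OF par u] by blast
  have sd: "smooth_on U (\<lambda>z. ?d z c)" for c by (intro smooth_on_frechet local_paramD(3)[OF par])
  have h: "second_ff M x (\<phi> u) (?d u b) (?d u c) =
      normal_part M x (\<phi> u) (frechet_derivative (\<lambda>z. ?d z c) (at u) b)" for b c
    by (rule second_ff_eq[OF par lor u sd]) (simp add: tangent_space_eq[OF par])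
  note lin = has_derivative_linear[OF smooth_on_has_derivative[OF sd u]] local_param_has_derivative(2)[OF par u]
  show "second_ff M x (\<phi> u) v w = second_ff M x (\<phi> u) w v"
    unfolding v w h using second_derivative_symmetric[OF local_paramD(1,3)[OF par] u] by metis
  have "second_ff M x (\<phi> u) (?d u (a *\<^sub>R v0)) (?d u w0) = a *\<^sub>R second_ff M x (\<phi> u) (?d u v0) (?d u w0)"
    unfolding h linear_cmul[OF lin(1)] linear_cmul[OF nl] ..
  then show "second_ff M x (\<phi> u) (a *\<^sub>R v) w = a *\<^sub>R second_ff M x (\<phi> u) v w"
    unfolding v w linear_cmul[OF lin(2)] .
  assume "v' \<in> tangent_space M x (\<phi> u)"
  then obtain v0' where v': "v' = ?d u v0'" using tangent_space_eq[OF par u] by blast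
  have "second_ff M x (\<phi> u) (?d u (v0 + v0')) (?d u w0) =
      second_ff M x (\<phi> u) (?d u v0) (?d u w0) + second_ff M x (\<phi> u) (?d u v0') (?d u w0)"
    unfolding h linear_add[OF lin(1)] linear_add[OF nl] ..
  then show "second_ff M x (\<phi> u) (v + v') w = second_ff M x (\<phi> u) v w + second_ff M x (\<phi> u) v' w"
    unfolding v v' w linear_add[OF lin(2)] .
qed

section \<open>Null coordinates on minimal surfaces\<close>

text \<open>Every pseudo-orthonormal basis of the plane consists of multiples of \<open>n\<close>
  and \<open>m\<close> whose factors have product \<open>- 1 / mink n m\<close>, so by bilinearity
  all of them give the same vector; this sign cancels the one in the definition.\<close>

lemma mean_curvature_null_pair:
  assumes par: "local_param M x U \<phi>" and lor: "lorentzian M x" and u: "u \<in> U"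
    and N: "null_pair n m" "tangent_space M x (\<phi> u) = span {n, m}"
  shows "mean_curvature M x (\<phi> u) = (1 / mink n m) *\<^sub>R second_ff M x (\<phi> u) n m"
  unfolding mean_curvature_def
proof (rule the_equality)
  note h = second_ff_bilinear[OF par lor u]
  have nm: "n \<in> tangent_space M x (\<phi> u)" "m \<in> tangent_space M x (\<phi> u)"
    unfolding N(2) by (simp_all add: span_base)
  have sc: "c *\<^sub>R v \<in> tangent_space M x (\<phi> u)" if "v \<in> tangent_space M x (\<phi> u)" for c v
    using that unfolding N(2) by (rule span_scale)
  have hh: "second_ff M x (\<phi> u) (a *\<^sub>R n) (b *\<^sub>R m) = (a * b) *\<^sub>R second_ff M x (\<phi> u) n m"
    "second_ff M x (\<phi> u) (b *\<^sub>R m) (a *\<^sub>R n) = (a * b) *\<^sub>R second_ff M x (\<phi> u) n m" for a b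
  proof -
    have "second_ff M x (\<phi> u) (b *\<^sub>R m) n = b *\<^sub>R second_ff M x (\<phi> u) n m"
      unfolding h(2)[OF nm(2) nm(1)] h(1)[OF nm(2) nm(1)] ..
    then show *: "second_ff M x (\<phi> u) (a *\<^sub>R n) (b *\<^sub>R m) = (a * b) *\<^sub>R second_ff M x (\<phi> u) n m"
      using h(2)[OF nm(1) sc[OF nm(2)]] h(1)[OF nm(1) sc[OF nm(2)]] by simp
    then show "second_ff M x (\<phi> u) (b *\<^sub>R m) (a *\<^sub>R n) = (a * b) *\<^sub>R second_ff M x (\<phi> u) n m"
      using h(1)[OF sc[OF nm(1)] sc[OF nm(2)]] by simp
  qed
  have po: "pseudo_orthonormal n ((- 1 / mink n m) *\<^sub>R m)"
    using pseudo_orthonormal_null_pair[OF N(1), of 1 0 0 "- 1 / mink n m"] by simp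
  show "\<exists>f1\<in>tangent_space M x (\<phi> u). \<exists>f2\<in>tangent_space M x (\<phi> u).
      pseudo_orthonormal f1 f2 \<and> (1 / mink n m) *\<^sub>R second_ff M x (\<phi> u) n m = - second_ff M x (\<phi> u) f1 f2"
    using po hh(1)[of 1 "- 1 / mink n m"]
    by (intro bexI[OF _ nm(1)] bexI[OF _ sc[OF nm(2), of "- 1 / mink n m"]]) simp
  fix H
  assume "\<exists>f1\<in>tangent_space M x (\<phi> u). \<exists>f2\<in>tangent_space M x (\<phi> u).
      pseudo_orthonormal f1 f2 \<and> H = - second_ff M x (\<phi> u) f1 f2"
  then obtain f1 f2 where f: "f1 \<in> span {n, m}" "f2 \<in> span {n, m}" "pseudo_orthonormal f1 f2"
    "H = - second_ff M x (\<phi> u) f1 f2" unfolding N(2) by blast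
  obtain a b c d where ab: "f1 = a *\<^sub>R n + b *\<^sub>R m" "f2 = c *\<^sub>R n + d *\<^sub>R m"
    using f(1,2) span_pair by metis
  consider "b = 0" "c = 0" "a * d = - 1 / mink n m" | "a = 0" "d = 0" "b * c = - 1 / mink n m"
    using f(3) pseudo_orthonormal_null_pair[OF N(1)] unfolding ab by blast
  then show "H = (1 / mink n m) *\<^sub>R second_ff M x (\<phi> u) n m"
  proof cases
    case 1
    then show ?thesis using hh(1)[of a d] f(4) by (simp add: ab)
  next
    case 2
    then show ?thesis using hh(2)[of b c] f(4) by (simp add: ab mult.commute)
  qed
qed

lemma null_field_derivative:
  assumes U: "open U" "u \<in> U" and s: "smooth_on U N" and N: "\<And>z. z \<in> U \<Longrightarrow> N z $ 1 = 1 \<and> mink (N z) (N z) = 0"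
  shows "frechet_derivative N (at u) w $ 1 = 0" "mink (frechet_derivative N (at u) w) (N u) = 0"
proof -
  note d = smooth_on_has_derivative[OF s U(2)]
  have "((\<lambda>z. N z $ 1) has_derivative (\<lambda>w. frechet_derivative N (at u) w $ 1)) (at u)"
    by (rule bounded_linear.has_derivative[OF bounded_linear_vec_nth d])
  moreover have "((\<lambda>z. N z $ 1) has_derivative (\<lambda>w. 0)) (at u)"
    by (rule has_derivative_transform_within_open[OF has_derivative_const U]) (simp add: N)
  ultimately have "(\<lambda>w. frechet_derivative N (at u) w $ 1) = (\<lambda>w. 0)" by (rule has_derivative_unique)
  then show "frechet_derivative N (at u) w $ 1 = 0" by meson
  have "((\<lambda>z. mink (N z) (N z)) has_derivative
      (\<lambda>w. mink (N u) (frechet_derivative N (at u) w) + mink (frechet_derivative N (at u) w) (N u))) (at u)"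
    by (rule mink.FDERIV[OF d d])
  moreover have "((\<lambda>z. mink (N z) (N z)) has_derivative (\<lambda>w. 0)) (at u)"
    by (rule has_derivative_transform_within_open[OF has_derivative_const U]) (simp add: N)
  ultimately have "(\<lambda>w. mink (N u) (frechet_derivative N (at u) w) + mink (frechet_derivative N (at u) w) (N u)) = (\<lambda>w. 0)"
    by (rule has_derivative_unique)
  then have "mink (N u) (frechet_derivative N (at u) w) + mink (frechet_derivative N (at u) w) (N u) = 0" by meson
  then show "mink (frechet_derivative N (at u) w) (N u) = 0" by (simp add: mink_commute)
qed

text \<open>Minimality makes the derivative of one normalised null field along the other one tangent; being
  orthogonal to a null field and of time component 0, it vanishes.\<close>

lemma minimal_null_frame:
  assumes par: "local_param M x U \<phi>" and lor: "lorentzian M x" and min: "minimal_surface M x" and u: "u \<in> U"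
    and s: "smooth_on U N1" "smooth_on U N2" and N: "\<And>z. z \<in> U \<Longrightarrow> null_pair (N1 z) (N2 z)"
      "\<And>z. z \<in> U \<Longrightarrow> tangent_space M x (\<phi> z) = span {N1 z, N2 z}"
    and w: "frechet_derivative (x \<circ> \<phi>) (at u) w = N1 u"
  shows "frechet_derivative N2 (at u) w = 0"
proof -
  note n = null_pairD[OF N(1)[OF u]]
  have "\<phi> u \<in> M" using local_paramD(6)[OF par] u by blast
  then have "mean_curvature M x (\<phi> u) = 0" using min unfolding minimal_surface_def by blast
  then have "second_ff M x (\<phi> u) (N1 u) (N2 u) = 0"
    using mean_curvature_null_pair[OF par lor u N(1)[OF u] N(2)[OF u]] n(7) by simp
  moreover have "second_ff M x (\<phi> u) (N1 u) (N2 u) = normal_part M x (\<phi> u) (frechet_derivative N2 (at u) w)"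
    unfolding w[symmetric] by (rule second_ff_eq[OF par lor u s(2)]) (simp add: N(2) span_base)
  ultimately have "frechet_derivative N2 (at u) w \<in> span {N1 u, N2 u}"
    using normal_part_null_pair(2)[OF N(1)[OF u] N(2)[OF u]] N(2)[OF u] by simp
  then obtain a b where ab: "frechet_derivative N2 (at u) w = a *\<^sub>R N1 u + b *\<^sub>R N2 u"
    using span_pair by blast
  have N2: "N2 z $ 1 = 1 \<and> mink (N2 z) (N2 z) = 0" if "z \<in> U" for z
    using null_pairD[OF N(1)[OF that]] by simp
  note d = null_field_derivative[OF local_paramD(1)[OF par] u s(2) N2, of w, unfolded ab]
  have "a + b = 0" "a * mink (N1 u) (N2 u) = 0"
    using d n by (simp_all add: mink.add_left mink.scaleR_left)
  then have "a = 0" "b = 0" using n(7) by auto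
  then show ?thesis using ab by simp
qed

section \<open>Orientation of null pairs, and derivatives along coordinate lines\<close>

definition oriented_bases :: "real^4 \<Rightarrow> real^4 \<Rightarrow> ((real^4) \<times> (real^4)) set" where
  "oriented_bases n m = {(a *\<^sub>R n + b *\<^sub>R m, a' *\<^sub>R n + b' *\<^sub>R m) | a b a' b'. a * b' - a' * b > 0}"

text \<open>Determinants multiply, so exchanging the standard basis of the plane for
  \<open>w1\<close>, \<open>w2\<close> with positive determinant does not change the class of
  positively oriented bases.\<close>

lemma oriented_bases_linear:
  fixes L :: "real \<times> real \<Rightarrow> real^4"
  assumes L: "linear L" "inj L" and w: "L w1 = n" "L w2 = m" and span: "range L = span {n, m}"
    and det: "fst w1 * snd w2 - fst w2 * snd w1 > 0"
  shows "{(L (a, b), L (a', b')) | a b a' b'. a * b' - a' * b > 0} = oriented_bases n m"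
proof -
  have Lw: "L (c *\<^sub>R w1 + d *\<^sub>R w2) = c *\<^sub>R n + d *\<^sub>R m" for c d
    using L(1) w by (simp only: linear_add linear_cmul)
  have det2: "fst (c *\<^sub>R w1 + d *\<^sub>R w2) * snd (c' *\<^sub>R w1 + d' *\<^sub>R w2) -
      fst (c' *\<^sub>R w1 + d' *\<^sub>R w2) * snd (c *\<^sub>R w1 + d *\<^sub>R w2) =
      (c * d' - c' * d) * (fst w1 * snd w2 - fst w2 * snd w1)" for c d c' d'
    by (simp add: algebra_simps)
  have coord: "\<exists>c d. z = c *\<^sub>R w1 + d *\<^sub>R w2" for z
  proof -
    have "L z \<in> span {n, m}" using span by blast
    then obtain c d where "L z = L (c *\<^sub>R w1 + d *\<^sub>R w2)" unfolding span_pair Lw by blast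
    then have "z = c *\<^sub>R w1 + d *\<^sub>R w2" using L(2) by (simp only: inj_eq)
    then show ?thesis by blast
  qed
  show ?thesis
  proof (intro equalityI subsetI)
    fix p assume "p \<in> {(L (a, b), L (a', b')) | a b a' b'. a * b' - a' * b > 0}"
    then obtain z z' where z: "p = (L z, L z')" "fst z * snd z' - fst z' * snd z > 0" by force
    obtain c d c' d' where c: "z = c *\<^sub>R w1 + d *\<^sub>R w2" "z' = c' *\<^sub>R w1 + d' *\<^sub>R w2"
      using coord by metis
    have "c * d' - c' * d > 0" using z(2) det unfolding c det2 by (simp add: zero_less_mult_iff)
    then show "p \<in> oriented_bases n m" unfolding oriented_bases_def z(1) c Lw by blast
  next
    fix p assume "p \<in> oriented_bases n m"
    then obtain c d c' d' where p: "p = (L (c *\<^sub>R w1 + d *\<^sub>R w2), L (c' *\<^sub>R w1 + d' *\<^sub>R w2))"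
      "c * d' - c' * d > 0" unfolding oriented_bases_def Lw by blast
    define z z' where "z = c *\<^sub>R w1 + d *\<^sub>R w2" and "z' = c' *\<^sub>R w1 + d' *\<^sub>R w2"
    have "fst z * snd z' - fst z' * snd z > 0" unfolding z_def z'_def det2 using p(2) det by (rule mult_pos_pos)
    then show "p \<in> {(L (a, b), L (a', b')) | a b a' b'. a * b' - a' * b > 0}"
      unfolding p(1) z_def[symmetric] z'_def[symmetric]
      by (intro CollectI exI[of _ "fst z"] exI[of _ "snd z"] exI[of _ "fst z'"] exI[of _ "snd z'"]) simp
  qed
qed

lemma has_vector_derivative_slice:
  assumes "(G has_derivative G') (at (s, t))"
  shows "((\<lambda>s. G (s, t)) has_vector_derivative G' (1, 0)) (at s)"
    "((\<lambda>t. G (s, t)) has_vector_derivative G' (0, 1)) (at t)"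
proof -
  note lin = has_derivative_linear[OF assms]
  have l: "G' (r, 0) = r *\<^sub>R G' (1, 0)" "G' (0, r) = r *\<^sub>R G' (0, 1)" for r
    using linear_cmul[OF lin, of r "(1, 0)"] linear_cmul[OF lin, of r "(0, 1)"] by simp_all
  have "((\<lambda>s. (s, t)) has_derivative (\<lambda>r. (r, 0))) (at s)" "((\<lambda>t. (s, t)) has_derivative (\<lambda>r. (0, r))) (at t)"
    by (auto intro!: derivative_eq_intros)
  note c = has_derivative_compose[OF this(1) assms] has_derivative_compose[OF this(2) assms]
  show "((\<lambda>s. G (s, t)) has_vector_derivative G' (1, 0)) (at s)"
    unfolding has_vector_derivative_def by (rule has_derivative_eq_rhs[OF c(1)]) (rule ext, rule l)
  show "((\<lambda>t. G (s, t)) has_vector_derivative G' (0, 1)) (at t)"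
    unfolding has_vector_derivative_def by (rule has_derivative_eq_rhs[OF c(2)]) (rule ext, rule l)
qed

lemma smooth_on_slice:
  fixes G :: "real \<times> real \<Rightarrow> 'b::real_normed_vector"
  assumes "open I" "open J" "smooth_on (I \<times> J) G"
  shows "t \<in> J \<Longrightarrow> smooth_on I (\<lambda>s. G (s, t))" "s \<in> I \<Longrightarrow> smooth_on J (\<lambda>t. G (s, t))"
  by (rule smooth_on_compose[OF _ open_Times[OF assms(1,2)] _ assms(3)];
      use assms in \<open>auto intro!: smooth_on_Pair smooth_on_ident smooth_on_const\<close>)+

lemma vector_derivative_zero_constant:
  assumes "is_interval I" "\<And>s. s \<in> I \<Longrightarrow> (f has_vector_derivative 0) (at s)" "a \<in> I" "b \<in> I"
  shows "f a = f b"
proof -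
  have "convex I" using assms(1) by (simp add: is_interval_convex_1)
  moreover have "(f has_derivative (\<lambda>h. 0)) (at s within I)" if "s \<in> I" for s
    using assms(2)[OF that] by (simp add: has_vector_derivative_def has_derivative_at_withinI)
  ultimately show ?thesis using has_derivative_zero_constant[of I f] assms(3,4) by metis
qed

lemma open_box_around:
  fixes V :: "(real \<times> real) set"
  assumes "open V" "z \<in> V"
  obtains I J where "open I" "open J" "is_interval I" "is_interval J" "z \<in> I \<times> J" "I \<times> J \<subseteq> V"
proof -
  obtain A B where AB: "open A" "open B" "z \<in> A \<times> B" "A \<times> B \<subseteq> V"
    using open_prod_elim[OF assms] by metis
  then have "fst z \<in> A" "snd z \<in> B" by auto
  obtain d where d: "d > 0" "ball (fst z) d \<subseteq> A"
    using open_contains_ball AB(1) \<open>fst z \<in> A\<close> by metis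
  obtain e where e: "e > 0" "ball (snd z) e \<subseteq> B"
    using open_contains_ball AB(2) \<open>snd z \<in> B\<close> by metis
  have "ball (fst z) d \<times> ball (snd z) e \<subseteq> V"
    using d(2) e(2) AB(4) by blast
  moreover have "z \<in> ball (fst z) d \<times> ball (snd z) e" using d e by (simp add: mem_Times_iff)
  ultimately show ?thesis
    by (intro that[of "ball (fst z) d" "ball (snd z) e"]) (simp_all add: is_interval_convex_1)
qed

text \<open>Because \<open>null_pair\<close> demands time component 1, both curves are parametrised
  by time up to a shift, and their velocities do not depend on the chart. The condition on
  \<open>Or\<close> decides which null direction comes first, so that charts can be compared with
  each other.\<close>

definition null_chart ::
    "'a::topological_space set \<Rightarrow> ('a \<Rightarrow> real^4) \<Rightarrow> ('a \<Rightarrow> ((real^4) \<times> (real^4)) set) \<Rightarrow>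
     real set \<Rightarrow> real set \<Rightarrow> (real \<times> real \<Rightarrow> 'a) \<Rightarrow> (real \<Rightarrow> real^4) \<Rightarrow> (real \<Rightarrow> real^4) \<Rightarrow> bool" where
  "null_chart M x Or I J \<phi> \<alpha> \<beta> \<longleftrightarrow>
     open I \<and> open J \<and> is_interval I \<and> is_interval J \<and> local_param M x (I \<times> J) \<phi> \<and>
     smooth_on I \<alpha> \<and> smooth_on J \<beta> \<and>
     (\<forall>s\<in>I. \<forall>t\<in>J. x (\<phi> (s, t)) = \<alpha> s + \<beta> t \<and>
        null_pair (vector_derivative \<alpha> (at s)) (vector_derivative \<beta> (at t)) \<and>
        Or (\<phi> (s, t)) = oriented_bases (vector_derivative \<alpha> (at s)) (vector_derivative \<beta> (at t)))"

text \<open>Write \<open>dx = \<theta>\<^sub>1 N\<^sub>1 + \<theta>\<^sub>2 N\<^sub>2\<close>. Both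
  \<open>\<theta>\<^sub>i\<close> are closed, and \<open>\<theta>\<^sub>1 + \<theta>\<^sub>2\<close> is the differential of the time component of \<open>x\<close>. Local
  primitives of \<open>\<theta>\<^sub>1\<close> and \<open>\<theta>\<^sub>2\<close> are the null coordinates.\<close>

lemma null_forms_closed:
  assumes par: "local_param M x U \<phi>" and lor: "lorentzian M x" and min: "minimal_surface M x" and u: "u \<in> U"
    and s: "smooth_on U N1" "smooth_on U N2" and N: "\<And>z. z \<in> U \<Longrightarrow> null_pair (N1 z) (N2 z)"
      "\<And>z. z \<in> U \<Longrightarrow> tangent_space M x (\<phi> z) = span {N1 z, N2 z}"
  defines "\<theta> \<equiv> \<lambda>w z. mink (frechet_derivative (x \<circ> \<phi>) (at z) w) (N1 z) / mink (N1 z) (N2 z)"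
  shows "frechet_derivative (\<theta> (1,0)) (at u) (0,1) = frechet_derivative (\<theta> (0,1)) (at u) (1,0)"
proof -
  let ?d = "\<lambda>z. frechet_derivative (x \<circ> \<phi>) (at z)"
  define \<eta> where "\<eta> w z = mink (?d z w) (N2 z) / mink (N1 z) (N2 z)" for w z
  note U = local_paramD(1)[OF par]
  have nz: "mink (N1 z) (N2 z) \<noteq> 0" if "z \<in> U" for z using null_pairD(7)[OF N(1)[OF that]] by simp
  have sd: "smooth_on U (\<lambda>z. ?d z c)" for c by (intro smooth_on_frechet local_paramD(3)[OF par])
  have st: "smooth_on U (\<theta> c)" "smooth_on U (\<eta> c)" for c
    unfolding \<theta>_def \<eta>_def by (intro smooth_on_divide smooth_on_mink sd s U nz; assumption)+
  have dec: "\<eta> c z *\<^sub>R N1 z + \<theta> c z *\<^sub>R N2 z = ?d z c" if "z \<in> U" for c z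
    unfolding \<theta>_def \<eta>_def
    by (rule span_null_pair[OF N(1)[OF that], symmetric])
       (simp add: N(2)[OF that, symmetric] tangent_space_eq[OF par that])
  have range: "\<exists>w. ?d u w = v" if "v \<in> {N1 u, N2 u}" for v
  proof -
    have "v \<in> range (?d u)"
      unfolding tangent_space_eq[OF par u, symmetric] N(2)[OF u] using that by (rule span_base)
    then show ?thesis by auto
  qed
  \<comment> \<open>The coordinate vectors of the two null fields at \<open>u\<close>.\<close>
  obtain w1 w2 where w: "?d u w1 = N1 u" "?d u w2 = N2 u" using range by blast
  have z1: "frechet_derivative N2 (at u) w1 = 0"
    by (rule minimal_null_frame[OF par lor min u s N w(1)])
  have z2: "frechet_derivative N1 (at u) w2 = 0"
    by (rule minimal_null_frame[OF par lor min u s(2,1) null_pair_swap[OF N(1)] _ w(2)])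
       (simp_all add: N(2) insert_commute)
  have wdec: "w = \<eta> w u *\<^sub>R w1 + \<theta> w u *\<^sub>R w2" for w
  proof -
    have "?d u w = ?d u (\<eta> w u *\<^sub>R w1 + \<theta> w u *\<^sub>R w2)"
      using dec[OF u, of w] local_param_has_derivative(2)[OF par u] w by (simp add: linear_add linear_cmul)
    then show ?thesis using local_paramD(7)[OF par u] by (simp only: inj_eq)
  qed
  note dN = smooth_on_has_derivative[OF s(1) u] smooth_on_has_derivative[OF s(2) u]
  \<comment> \<open>By minimality each null field varies only in its own direction.\<close>
  have DN: "frechet_derivative N1 (at u) w = \<eta> w u *\<^sub>R frechet_derivative N1 (at u) w1"
    "frechet_derivative N2 (at u) w = \<theta> w u *\<^sub>R frechet_derivative N2 (at u) w2" for w
    by (subst wdec, use has_derivative_linear[OF dN(1)] has_derivative_linear[OF dN(2)] z1 z2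
        in \<open>simp add: linear_add linear_cmul\<close>)+
  have D: "frechet_derivative (\<lambda>z. ?d z c) (at u) b =
      (\<eta> c u *\<^sub>R frechet_derivative N1 (at u) b + frechet_derivative (\<eta> c) (at u) b *\<^sub>R N1 u) +
      (\<theta> c u *\<^sub>R frechet_derivative N2 (at u) b + frechet_derivative (\<theta> c) (at u) b *\<^sub>R N2 u)" for b c
  proof -
    have "((\<lambda>z. \<eta> c z *\<^sub>R N1 z + \<theta> c z *\<^sub>R N2 z) has_derivative
      (\<lambda>b. (\<eta> c u *\<^sub>R frechet_derivative N1 (at u) b + frechet_derivative (\<eta> c) (at u) b *\<^sub>R N1 u) +
        (\<theta> c u *\<^sub>R frechet_derivative N2 (at u) b + frechet_derivative (\<theta> c) (at u) b *\<^sub>R N2 u))) (at u)"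
      by (intro has_derivative_add has_derivative_scaleR dN smooth_on_has_derivative[OF st(1) u]
          smooth_on_has_derivative[OF st(2) u])
    then have "((\<lambda>z. ?d z c) has_derivative
      (\<lambda>b. (\<eta> c u *\<^sub>R frechet_derivative N1 (at u) b + frechet_derivative (\<eta> c) (at u) b *\<^sub>R N1 u) +
        (\<theta> c u *\<^sub>R frechet_derivative N2 (at u) b + frechet_derivative (\<theta> c) (at u) b *\<^sub>R N2 u))) (at u)"
      by (rule has_derivative_transform_within_open[OF _ U u]) (rule dec)
    from frechet_derivative_eqI[OF this] show ?thesis by simp
  qed
  \<comment> \<open>In the equality of the mixed second derivatives, the terms containing
    derivatives of \<open>N1\<close> and \<open>N2\<close> are symmetric in the two directions and
    cancel. Comparing the coefficients of \<open>N2\<close> gives the claim.\<close>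
  have "frechet_derivative (\<lambda>z. ?d z (1,0)) (at u) (0,1) = frechet_derivative (\<lambda>z. ?d z (0,1)) (at u) (1,0)"
    by (rule second_derivative_symmetric[OF U local_paramD(3)[OF par] u])
  then have "frechet_derivative (\<eta> (1,0)) (at u) (0,1) *\<^sub>R N1 u + frechet_derivative (\<theta> (1,0)) (at u) (0,1) *\<^sub>R N2 u =
      frechet_derivative (\<eta> (0,1)) (at u) (1,0) *\<^sub>R N1 u + frechet_derivative (\<theta> (0,1)) (at u) (1,0) *\<^sub>R N2 u"
    unfolding D DN(1)[of "(0,1)"] DN(1)[of "(1,0)"] DN(2)[of "(0,1)"] DN(2)[of "(1,0)"]
    by (simp add: mult.commute algebra_simps)
  then show ?thesis using null_pair_coords[OF N(1)[OF u]] by blast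
qed

text \<open>A vanishing determinant would make \<open>w1\<close> and \<open>w2\<close> dependent,
  and with them the two independent vectors of the null pair.\<close>

lemma null_pair_det_nonzero:
  fixes L :: "real \<times> real \<Rightarrow> real^4"
  assumes L: "linear L" and N: "null_pair (L w1) (L w2)"
  shows "fst w1 * snd w2 - fst w2 * snd w1 \<noteq> 0"
proof
  assume det: "fst w1 * snd w2 - fst w2 * snd w1 = 0"
  have Lw: "c = 0 \<and> d = 0" if "c *\<^sub>R w1 + d *\<^sub>R w2 = 0" for c d
  proof -
    have "L (c *\<^sub>R w1 + d *\<^sub>R w2) = 0" using that linear_0[OF L] by simp
    then have "c *\<^sub>R L w1 + d *\<^sub>R L w2 = 0 *\<^sub>R L w1 + 0 *\<^sub>R L w2"
      using L by (simp add: linear_add linear_cmul)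
    then show ?thesis using null_pair_coords[OF N] by blast
  qed
  have "snd w2 *\<^sub>R w1 + (- snd w1) *\<^sub>R w2 = 0" "fst w2 *\<^sub>R w1 + (- fst w1) *\<^sub>R w2 = 0"
    using det by (simp_all add: prod_eq_iff algebra_simps)
  from Lw[OF this(1)] Lw[OF this(2)] have "w1 = 0" by (simp add: prod_eq_iff)
  then show False using null_pairD(1)[OF N] linear_0[OF L] by simp
qed

text \<open>The orientation is arranged at the single point \<open>u\<close>, by exchanging the two
  fields if necessary. Connectedness of a coordinate box extends it to the neighbouring points
  later.\<close>

lemma oriented_null_frame:
  assumes par: "local_param M x U \<phi>" and lor: "lorentzian M x" and u: "u \<in> U"
  obtains N1 N2 w1 w2 where "smooth_on U N1" "smooth_on U N2" "\<And>z. z \<in> U \<Longrightarrow> null_pair (N1 z) (N2 z)"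
    "\<And>z. z \<in> U \<Longrightarrow> tangent_space M x (\<phi> z) = span {N1 z, N2 z}"
    "frechet_derivative (x \<circ> \<phi>) (at u) w1 = N1 u" "frechet_derivative (x \<circ> \<phi>) (at u) w2 = N2 u"
    "fst w1 * snd w2 - fst w2 * snd w1 > 0"
proof -
  obtain N1 N2 where N: "smooth_on U N1" "smooth_on U N2" "\<And>z. z \<in> U \<Longrightarrow> null_pair (N1 z) (N2 z)"
    "\<And>z. z \<in> U \<Longrightarrow> tangent_space M x (\<phi> z) = span {N1 z, N2 z}"
    using null_frame[OF par lor] by metis
  have "N1 u \<in> range (frechet_derivative (x \<circ> \<phi>) (at u))" "N2 u \<in> range (frechet_derivative (x \<circ> \<phi>) (at u))"
    unfolding tangent_space_eq[OF par u, symmetric] N(4)[OF u] by (simp_all add: span_base)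
  then obtain w1 w2 where w: "frechet_derivative (x \<circ> \<phi>) (at u) w1 = N1 u"
    "frechet_derivative (x \<circ> \<phi>) (at u) w2 = N2 u" by (metis imageE)
  have "fst w1 * snd w2 - fst w2 * snd w1 \<noteq> 0"
    by (rule null_pair_det_nonzero[OF local_param_has_derivative(2)[OF par u]]) (simp only: w N(3)[OF u])
  then consider "fst w1 * snd w2 - fst w2 * snd w1 > 0" | "fst w2 * snd w1 - fst w1 * snd w2 > 0" by linarith
  then show ?thesis
  proof cases
    case 1
    show ?thesis by (rule that[OF N w 1])
  next
    case 2
    show ?thesis
      by (rule that[OF N(2,1) null_pair_swap[OF N(3)] _ w(2,1) 2]) (simp_all add: N(4) insert_commute)
  qed
qed

lemma positive_on_connected:
  fixes f :: "'a::topological_space \<Rightarrow> real"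
  assumes "connected S" "continuous_on S f" "\<And>z. z \<in> S \<Longrightarrow> f z \<noteq> 0" "a \<in> S" "f a > 0" "z \<in> S"
  shows "f z > 0"
proof (rule ccontr)
  assume "\<not> f z > 0"
  have "connected (f ` S)" by (rule connected_continuous_image[OF assms(2,1)])
  then have "0 \<in> f ` S"
    by (rule connectedD_interval[of _ "f z" "f a"]) (use \<open>\<not> f z > 0\<close> assms(4-6) in auto)
  then show False using assms(3) by auto
qed

text \<open>A map \<open>g\<close> of the parameter domain whose differential has the coefficients
  of \<open>dx\<close> as components is a local diffeomorphism; reparametrising by its inverse turns
  the null fields into the coordinate fields.\<close>

theorem null_chart_exists:
  assumes orient: "surface_orientation M x Or" and lor: "lorentzian M x" and min: "minimal_surface M x"
    and V: "openin (top_of_set M) V" "p \<in> V"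
  obtains I J \<phi> \<alpha> \<beta> where "null_chart M x Or I J \<phi> \<alpha> \<beta>" "p \<in> \<phi> ` (I \<times> J)" "\<phi> ` (I \<times> J) \<subseteq> V"
proof -
  have "p \<in> M" using V openin_imp_subset by blast
  define R where "R U \<phi> \<longleftrightarrow> (\<forall>u\<in>U. Or (\<phi> u) =
      {(frechet_derivative (x \<circ> \<phi>) (at u) (a, b), frechet_derivative (x \<circ> \<phi>) (at u) (a', b')) | a b a' b'.
        a * b' - a' * b > 0})" for U :: "(real \<times> real) set" and \<phi>
  have "\<forall>p\<in>M. \<exists>U \<phi>. local_param M x U \<phi> \<and> p \<in> \<phi> ` U \<and> R U \<phi>"
    using orient unfolding surface_orientation_def Let_def R_def .
  then obtain U0 \<kappa> where par0: "local_param M x U0 \<kappa>" "p \<in> \<kappa> ` U0" and "R U0 \<kappa>"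
    using \<open>p \<in> M\<close> by metis
  then have Or0: "Or (\<kappa> u) =
      {(frechet_derivative (x \<circ> \<kappa>) (at u) (a, b), frechet_derivative (x \<circ> \<kappa>) (at u) (a', b')) | a b a' b'.
        a * b' - a' * b > 0}" if "u \<in> U0" for u
    using that unfolding R_def by (elim bspec)
  obtain u0 where u0: "u0 \<in> U0" "p = \<kappa> u0" using par0(2) by blast
  have U1: "open {u \<in> U0. \<kappa> u \<in> V}" "u0 \<in> {u \<in> U0. \<kappa> u \<in> V}"
    using chart_preimage_open[OF par0(1) V(1)] u0 V(2) by auto
  obtain r where r: "r > 0" "ball u0 r \<subseteq> {u \<in> U0. \<kappa> u \<in> V}" using U1 open_contains_ball by metis
  define U where "U = ball u0 r"
  have U: "open U" "convex U" "u0 \<in> U" "U \<subseteq> U0" "\<kappa> ` U \<subseteq> V" using r by (auto simp: U_def)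
  have par: "local_param M x U \<kappa>" by (rule local_param_subset[OF par0(1) U(1,4)])
  obtain N1 N2 w1 w2 where s: "smooth_on U N1" "smooth_on U N2" and N: "\<And>z. z \<in> U \<Longrightarrow> null_pair (N1 z) (N2 z)"
      "\<And>z. z \<in> U \<Longrightarrow> tangent_space M x (\<kappa> z) = span {N1 z, N2 z}"
    and w: "frechet_derivative (x \<circ> \<kappa>) (at u0) w1 = N1 u0" "frechet_derivative (x \<circ> \<kappa>) (at u0) w2 = N2 u0"
      "fst w1 * snd w2 - fst w2 * snd w1 > 0"
    using oriented_null_frame[OF par lor U(3)] by metis
  let ?d = "\<lambda>z. frechet_derivative (x \<circ> \<kappa>) (at z)"
  define \<theta>1 where "\<theta>1 c z = mink (?d z c) (N2 z) / mink (N1 z) (N2 z)" for c z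
  define \<theta>2 where "\<theta>2 c z = mink (?d z c) (N1 z) / mink (N1 z) (N2 z)" for c z
  have nz: "mink (N1 z) (N2 z) \<noteq> 0" if "z \<in> U" for z using null_pairD(7)[OF N(1)[OF that]] by simp
  have sd: "smooth_on U (\<lambda>z. ?d z c)" for c by (intro smooth_on_frechet local_paramD(3)[OF par])
  have st: "smooth_on U (\<theta>1 c)" "smooth_on U (\<theta>2 c)" for c
    unfolding \<theta>1_def \<theta>2_def by (intro smooth_on_divide smooth_on_mink sd s U nz; assumption)+
  have dec: "?d z c = \<theta>1 c z *\<^sub>R N1 z + \<theta>2 c z *\<^sub>R N2 z" if "z \<in> U" for c z
    unfolding \<theta>1_def \<theta>2_def
    by (rule span_null_pair[OF N(1)[OF that]])
       (simp add: N(2)[OF that, symmetric] tangent_space_eq[OF par that])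
  have t2: "\<theta>2 (1,0) z * fst c + \<theta>2 (0,1) z * snd c = \<theta>2 c z" if "z \<in> U" for c z
    using range_linear_plane(1)[OF local_param_has_derivative(2)[OF par that], of "fst c" "snd c"]
    by (simp add: \<theta>2_def mink.add_left mink.scaleR_left add_divide_distrib mult.commute)
  have closed: "frechet_derivative (\<theta>2 (1,0)) (at z) (0,1) = frechet_derivative (\<theta>2 (0,1)) (at z) (1,0)" if "z \<in> U" for z
    unfolding \<theta>2_def by (rule null_forms_closed[OF par lor min that s N])
  have "\<exists>T. smooth_on U T \<and> (\<forall>z\<in>U. (T has_derivative (\<lambda>c. \<theta>2 (1,0) z * fst c + \<theta>2 (0,1) z * snd c)) (at z))"
  proof (rule poincare_plane[OF U(1-3) st(2)[of "(1,0)"] st(2)[of "(0,1)"] closed])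
    fix T assume "\<And>z. z \<in> U \<Longrightarrow> (T has_derivative (\<lambda>c. \<theta>2 (1,0) z * fst c + \<theta>2 (0,1) z * snd c)) (at z)"
      and "smooth_on U T"
    then show ?thesis by (intro exI[of _ T] conjI ballI)
  qed
  then obtain T where "smooth_on U T \<and> (\<forall>z\<in>U. (T has_derivative (\<lambda>c. \<theta>2 (1,0) z * fst c + \<theta>2 (0,1) z * snd c)) (at z))" ..
  then have sT: "smooth_on U T"
    and T: "\<forall>z\<in>U. (T has_derivative (\<lambda>c. \<theta>2 (1,0) z * fst c + \<theta>2 (0,1) z * snd c)) (at z)"
    by (rule conjunct1, rule conjunct2)
  have dT: "(T has_derivative (\<lambda>c. \<theta>2 c z)) (at z)" if "z \<in> U" for z
    using bspec[OF T that] unfolding t2[OF that] .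
  \<comment> \<open>Both null fields have time component 1, so the two forms add up to the
    differential of the time component of \<open>x\<close>. The first coordinate is therefore this
    component minus \<open>T\<close>, and one primitive is enough.\<close>
  define g where "g z = ((x \<circ> \<kappa>) z $ 1 - T z, T z)" for z
  have sg: "smooth_on U g"
    unfolding g_def by (intro smooth_on_Pair smooth_on_diff smooth_on_nth local_paramD(3)[OF par] sT U)
  have dg: "frechet_derivative g (at z) = (\<lambda>c. (\<theta>1 c z, \<theta>2 c z))" if z: "z \<in> U" for z
  proof -
    have "(g has_derivative (\<lambda>c. (?d z c $ 1 - \<theta>2 c z, \<theta>2 c z))) (at z)"
      unfolding g_def
      by (intro has_derivative_Pair has_derivative_diff dT[OF z]
          bounded_linear.has_derivative[OF bounded_linear_vec_nth local_param_has_derivative(1)[OF par z]])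
    note D = frechet_derivative_eqI[OF this]
    have "?d z c $ 1 - \<theta>2 c z = \<theta>1 c z" for c
      using null_pairD[OF N(1)[OF z]] by (simp add: dec[OF z])
    then show ?thesis unfolding D by (simp only:)
  qed
  have "inj (frechet_derivative g (at u0))"
  proof (rule injI)
    fix c c' assume "frechet_derivative g (at u0) c = frechet_derivative g (at u0) c'"
    then have "?d u0 c = ?d u0 c'" unfolding dg[OF U(3)] by (simp add: dec[OF U(3)])
    then show "c = c'" using local_paramD(7)[OF par U(3)] by (simp only: inj_eq)
  qed
  then obtain W Vg h where W: "open W" "W \<subseteq> U" "u0 \<in> W" "open Vg" "homeomorphism W Vg g h" "smooth_on Vg h"
    using smooth_inverse_function[OF U(1) sg U(3)] by metis
  have "g u0 \<in> Vg" using W(3,5) by (auto simp: homeomorphism_def)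
  then obtain I J where IJ: "open I" "open J" "is_interval I" "is_interval J" "g u0 \<in> I \<times> J" "I \<times> J \<subseteq> Vg"
    using open_box_around[OF W(4)] by metis
  have hom0: "homeomorphism Vg W h g" using W(5) by (rule homeomorphism_symD)
  have "openin (top_of_set W) (h ` (I \<times> J))"
    by (rule homeomorphism_imp_open_map[OF hom0]) (simp add: IJ open_Times open_subset)
  then have oT: "open (h ` (I \<times> J))" using W(1) openin_open_eq by blast
  have hW: "h ` (I \<times> J) \<subseteq> W" using hom0 IJ(6) unfolding homeomorphism_def by blast
  then have hU: "h ` (I \<times> J) \<subseteq> U" using W(2) by blast
  have hom: "homeomorphism (I \<times> J) (h ` (I \<times> J)) h g"
    by (rule homeomorphism_of_subsets[OF hom0 IJ(6)]) (use hW in auto)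
  have sh: "smooth_on (I \<times> J) h" using W(6) IJ(6) by (rule smooth_on_subset)
  define \<phi> where "\<phi> = \<kappa> \<circ> h"
  note rep = local_param_reparam[OF par open_Times[OF IJ(1,2)] oT hU hom sh smooth_on_subset[OF sg hU], folded \<phi>_def]
  have hin: "h z \<in> U" if "z \<in> I \<times> J" for z using hU that by blast
  let ?e = "\<lambda>z. frechet_derivative h (at z)"
  have th: "\<theta>1 (?e z c) (h z) = fst c" "\<theta>2 (?e z c) (h z) = snd c" if z: "z \<in> I \<times> J" for z c
    using rep(3)[OF z, of c] unfolding dg[OF hin[OF z]] by (simp_all add: prod_eq_iff)
  have dh: "?d (h z) (?e z c) = fst c *\<^sub>R N1 (h z) + snd c *\<^sub>R N2 (h z)" if z: "z \<in> I \<times> J" for z c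
    unfolding dec[OF hin[OF z]] th[OF z] ..
  have dy: "((x \<circ> \<phi>) has_derivative (\<lambda>c. fst c *\<^sub>R N1 (h z) + snd c *\<^sub>R N2 (h z))) (at z)" if z: "z \<in> I \<times> J" for z
  proof -
    have "frechet_derivative (x \<circ> \<phi>) (at z) = (\<lambda>c. fst c *\<^sub>R N1 (h z) + snd c *\<^sub>R N2 (h z))"
      unfolding rep(2)[OF z] by (rule ext) (simp only: comp_apply dh[OF z])
    then show ?thesis using local_param_has_derivative(1)[OF rep(1) z] by (simp only:)
  qed
  have chain: "((\<lambda>z. N (h z)) has_derivative (\<lambda>c. frechet_derivative N (at (h z)) (?e z c))) (at z)"
    if "smooth_on U N" and z: "z \<in> I \<times> J" for N :: "real \<times> real \<Rightarrow> real^4" and z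
    by (rule has_derivative_compose[OF smooth_on_has_derivative[OF sh z] smooth_on_has_derivative[OF that(1) hin[OF z]]])
  have d1: "frechet_derivative N1 (at (h z)) (?e z (0,1)) = 0" if z: "z \<in> I \<times> J" for z
    by (rule minimal_null_frame[OF par lor min hin[OF z] s(2,1) null_pair_swap[OF N(1)]])
       (simp_all add: N(2) insert_commute dh[OF z])
  have d2: "frechet_derivative N2 (at (h z)) (?e z (1,0)) = 0" if z: "z \<in> I \<times> J" for z
    by (rule minimal_null_frame[OF par lor min hin[OF z] s N]) (simp_all add: dh[OF z])
  \<comment> \<open>After the reparametrisation \<open>N1\<close> depends on the first coordinate
    only, and \<open>N2\<close> on the second only.\<close>
  have c1: "N1 (h (s, t)) = N1 (h (s, t'))" if "s \<in> I" "t \<in> J" "t' \<in> J" for s t t'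
  proof (rule vector_derivative_zero_constant[OF IJ(4) _ that(2,3)])
    fix t assume "t \<in> J"
    then show "((\<lambda>t. N1 (h (s, t))) has_vector_derivative 0) (at t)"
      using has_vector_derivative_slice(2)[OF chain[OF s(1)]] d1 that(1) by (metis SigmaI)
  qed
  have c2: "N2 (h (s, t)) = N2 (h (s', t))" if "s \<in> I" "s' \<in> I" "t \<in> J" for s s' t
  proof (rule vector_derivative_zero_constant[OF IJ(3) _ that(1,2)])
    fix s assume "s \<in> I"
    then show "((\<lambda>s. N2 (h (s, t))) has_vector_derivative 0) (at s)"
      using has_vector_derivative_slice(1)[OF chain[OF s(2)]] d2 that(3) by (metis SigmaI)
  qed
  obtain s0 t0 where st0: "g u0 = (s0, t0)" "s0 \<in> I" "t0 \<in> J" using IJ(5) by (metis mem_Sigma_iff surj_pair)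
  \<comment> \<open>The two curves are the coordinate lines through \<open>(s0, t0)\<close>; the
    common point is subtracted from the second so that the sum reproduces \<open>x\<close>.\<close>
  define \<alpha> where "\<alpha> s = (x \<circ> \<phi>) (s, t0)" for s
  define \<beta> where "\<beta> t = (x \<circ> \<phi>) (s0, t) - (x \<circ> \<phi>) (s0, t0)" for t
  have ys: "((\<lambda>s. (x \<circ> \<phi>) (s, t)) has_vector_derivative N1 (h (s, t))) (at s)"
    "((\<lambda>t. (x \<circ> \<phi>) (s, t)) has_vector_derivative N2 (h (s, t))) (at t)" if "s \<in> I" "t \<in> J" for s t
    using has_vector_derivative_slice[OF dy[of "(s, t)"]] that by simp_all
  have dab: "vector_derivative \<alpha> (at s) = N1 (h (s, t))" "vector_derivative \<beta> (at t) = N2 (h (s, t))"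
    if "s \<in> I" "t \<in> J" for s t
  proof -
    have "(\<alpha> has_vector_derivative N1 (h (s, t0))) (at s)"
      unfolding \<alpha>_def by (rule ys(1)[OF that(1) st0(3)])
    moreover have "(\<beta> has_vector_derivative N2 (h (s0, t)) - 0) (at t)"
      unfolding \<beta>_def by (rule has_vector_derivative_diff[OF ys(2)[OF st0(2) that(2)] has_vector_derivative_const])
    ultimately show "vector_derivative \<alpha> (at s) = N1 (h (s, t))" "vector_derivative \<beta> (at t) = N2 (h (s, t))"
      using c1[OF that(1) st0(3) that(2)] c2[OF st0(2) that] by (simp_all add: vector_derivative_at)
  qed
  have sum: "x (\<phi> (s, t)) = \<alpha> s + \<beta> t" if st: "s \<in> I" "t \<in> J" for s t
  proof -
    \<comment> \<open>The difference of two parallel coordinate lines; its velocity is zero because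
      \<open>N1\<close> does not depend on the second coordinate.\<close>
    let ?k = "\<lambda>s. (x \<circ> \<phi>) (s, t) - (x \<circ> \<phi>) (s, t0)"
    have "?k s = ?k s0"
    proof (rule vector_derivative_zero_constant[OF IJ(3) _ st(1) st0(2)])
      fix s assume s: "s \<in> I"
      show "(?k has_vector_derivative 0) (at s)"
        using has_vector_derivative_diff[OF ys(1)[OF s st(2)] ys(1)[OF s st0(3)]] c1[OF s st(2) st0(3)] by simp
    qed
    then show ?thesis by (simp add: \<alpha>_def \<beta>_def algebra_simps)
  qed
  have gh0: "h (g u0) = u0" using W(3,5) unfolding homeomorphism_def by blast
  \<comment> \<open>The coordinate directions are mapped to a null pair, so the determinant never
    vanishes on the connected box; it is positive at \<open>g u0\<close>, where these directions
    become \<open>w1\<close> and \<open>w2\<close>.\<close>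
  have posdet: "fst (?e z (1,0)) * snd (?e z (0,1)) - fst (?e z (0,1)) * snd (?e z (1,0)) > 0" (is "?D z > 0")
    if z: "z \<in> I \<times> J" for z
  proof (rule positive_on_connected[where S = "I \<times> J" and f = ?D, OF _ _ _ IJ(5) _ z])
    show "connected (I \<times> J)" using IJ by (simp add: connected_Times is_interval_connected)
    have "continuous_on (I \<times> J) (\<lambda>z. ?e z c)" for c by (intro smooth_on_continuous smooth_on_frechet sh)
    then show "continuous_on (I \<times> J) ?D" by (intro continuous_intros)
    show "?D z \<noteq> 0" if z: "z \<in> I \<times> J" for z
      by (rule null_pair_det_nonzero[OF local_param_has_derivative(2)[OF par hin[OF z]]])
         (simp add: dh[OF z] N(1)[OF hin[OF z]])
    have "?d u0 (?e (g u0) (1,0)) = ?d u0 w1" "?d u0 (?e (g u0) (0,1)) = ?d u0 w2"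
      using dh[OF IJ(5), of "(1,0)"] dh[OF IJ(5), of "(0,1)"] w by (simp_all add: gh0)
    then have "?e (g u0) (1,0) = w1" "?e (g u0) (0,1) = w2"
      using local_paramD(7)[OF par U(3)] by (simp_all only: inj_eq)
    then show "?D (g u0) > 0" using w(3) by simp
  qed
  have ori: "Or (\<phi> z) = oriented_bases (N1 (h z)) (N2 (h z))" if z: "z \<in> I \<times> J" for z
  proof -
    have "h z \<in> U0" using hin[OF z] U(4) by blast
    note O = Or0[OF this]
    have "{(?d (h z) (a, b), ?d (h z) (a', b')) | a b a' b'. a * b' - a' * b > 0} = oriented_bases (N1 (h z)) (N2 (h z))"
      by (rule oriented_bases_linear[OF local_param_has_derivative(2)[OF par hin[OF z]]
          local_paramD(7)[OF par hin[OF z]] _ _ _ posdet[OF z]])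
         (simp_all add: dh[OF z] tangent_space_eq[OF par hin[OF z], symmetric] N(2)[OF hin[OF z]] del: comp_apply)
    with O show ?thesis unfolding \<phi>_def comp_apply[of \<kappa> h] by (rule trans)
  qed
  have "null_chart M x Or I J \<phi> \<alpha> \<beta>"
    unfolding null_chart_def
  proof (intro conjI ballI IJ(1-4) rep(1))
    show "smooth_on I \<alpha>" "smooth_on J \<beta>"
      unfolding \<alpha>_def \<beta>_def
      using smooth_on_slice[OF IJ(1,2) local_paramD(3)[OF rep(1)]] st0 IJ
      by (auto intro!: smooth_on_diff)
    fix s t assume st: "s \<in> I" "t \<in> J"
    show "x (\<phi> (s, t)) = \<alpha> s + \<beta> t" by (rule sum[OF st])
    show "null_pair (vector_derivative \<alpha> (at s)) (vector_derivative \<beta> (at t))"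
      unfolding dab[OF st] using N(1)[OF hin] st by simp
    show "Or (\<phi> (s, t)) = oriented_bases (vector_derivative \<alpha> (at s)) (vector_derivative \<beta> (at t))"
      unfolding dab[OF st] using ori st by simp
  qed
  moreover have "p \<in> \<phi> ` (I \<times> J)"
    unfolding \<phi>_def using IJ(5) gh0 u0(2) by (intro image_eqI[where x = "g u0"]) simp_all
  moreover have "\<phi> ` (I \<times> J) \<subseteq> V" unfolding \<phi>_def using hU U(5) by auto
  ultimately show ?thesis by (rule that)
qed

section \<open>The geometry in null coordinates\<close>

lemma smooth_curve:
  fixes \<gamma> :: "real \<Rightarrow> 'b::real_normed_vector"
  assumes "open I" "smooth_on I \<gamma>"
  shows "s \<in> I \<Longrightarrow> (\<gamma> has_vector_derivative vector_derivative \<gamma> (at s)) (at s)"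
    "smooth_on I (\<lambda>s. vector_derivative \<gamma> (at s))"
proof -
  have *: "(\<gamma> has_vector_derivative frechet_derivative \<gamma> (at s) 1) (at s)" if "s \<in> I" for s
  proof -
    note d = smooth_on_has_derivative[OF assms(2) that]
    show ?thesis
      unfolding has_vector_derivative_def
    proof (rule has_derivative_eq_rhs[OF d], rule ext)
      fix r :: real
      show "frechet_derivative \<gamma> (at s) r = r *\<^sub>R frechet_derivative \<gamma> (at s) 1"
        using linear_cmul[OF has_derivative_linear[OF d], of r 1] by (simp only: real_scaleR_def mult_1_right)
    qed
  qed
  show "(\<gamma> has_vector_derivative vector_derivative \<gamma> (at s)) (at s)" if "s \<in> I"
    using *[OF that] vector_derivative_at by metis
  show "smooth_on I (\<lambda>s. vector_derivative \<gamma> (at s))"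
    by (rule smooth_on_cong[OF smooth_on_frechet[OF assms(2), of 1] assms(1)])
       (simp add: vector_derivative_at[OF *])
qed

lemma smooth_on_curve:
  fixes I J :: "real set"
  assumes "open I" "open J"
  shows "smooth_on I \<gamma> \<Longrightarrow> smooth_on (I \<times> J) (\<lambda>z. \<gamma> (fst z))"
    and "smooth_on J \<gamma>' \<Longrightarrow> smooth_on (I \<times> J) (\<lambda>z. \<gamma>' (snd z))"
proof -
  show "smooth_on (I \<times> J) (\<lambda>z. \<gamma> (fst z))" if "smooth_on I \<gamma>"
    by (rule smooth_on_compose[OF open_Times[OF assms] assms(1) smooth_on_linear[OF bounded_linear_fst] that]) auto
  show "smooth_on (I \<times> J) (\<lambda>z. \<gamma>' (snd z))" if "smooth_on J \<gamma>'"
    by (rule smooth_on_compose[OF open_Times[OF assms] assms(2) smooth_on_linear[OF bounded_linear_snd] that]) auto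
qed

lemma curve_has_derivative:
  "(\<gamma> has_vector_derivative v) (at (fst z)) \<Longrightarrow> ((\<lambda>z. \<gamma> (fst z)) has_derivative (\<lambda>c. fst c *\<^sub>R v)) (at z)"
  "(\<gamma> has_vector_derivative v) (at (snd z)) \<Longrightarrow> ((\<lambda>z. \<gamma> (snd z)) has_derivative (\<lambda>c. snd c *\<^sub>R v)) (at z)"
  unfolding has_vector_derivative_def
  by (rule has_derivative_compose[OF has_derivative_fst[OF has_derivative_ident]], assumption)
     (rule has_derivative_compose[OF has_derivative_snd[OF has_derivative_ident]], assumption)

lemma frechet_derivative_slice:
  fixes G :: "real \<times> real \<Rightarrow> 'b::real_normed_vector"
  assumes "G differentiable (at (s, t))"
  shows "((\<lambda>s. G (s, t)) has_vector_derivative v) (at s) \<Longrightarrow> frechet_derivative G (at (s, t)) (1,0) = v"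
    "((\<lambda>t. G (s, t)) has_vector_derivative v) (at t) \<Longrightarrow> frechet_derivative G (at (s, t)) (0,1) = v"
  by (rule vector_derivative_unique_at[OF has_vector_derivative_slice(1)[OF assms[unfolded frechet_derivative_works]]],
      assumption)
     (rule vector_derivative_unique_at[OF has_vector_derivative_slice(2)[OF assms[unfolded frechet_derivative_works]]],
      assumption)

lemma frechet_derivative_bilinear:
  assumes "bounded_bilinear L" "f differentiable (at z)" "g differentiable (at z)"
  shows "frechet_derivative (\<lambda>w. L (f w) (g w)) (at z) e =
    L (f z) (frechet_derivative g (at z) e) + L (frechet_derivative f (at z) e) (g z)"
  using frechet_derivative_eqI[OF bounded_bilinear.FDERIV[OF assms(1) assms(2,3)[unfolded frechet_derivative_works]]]
  by simp

lemma frechet_derivative_plus: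
  assumes "f differentiable (at z)" "g differentiable (at z)"
  shows "frechet_derivative (\<lambda>w. f w + g w) (at z) e = frechet_derivative f (at z) e + frechet_derivative g (at z) e"
  using frechet_derivative_eqI[OF has_derivative_add[OF assms[unfolded frechet_derivative_works]]] by simp

lemma bounded_bilinear_wedge: "bounded_bilinear wedge"
proof -
  have "bilinear wedge"
    unfolding bilinear_def by (auto intro!: linearI simp: wedge_def vec_eq_iff algebra_simps)
  then show ?thesis by (simp add: bilinear_conv_bounded_bilinear)
qed

interpretation wedge: bounded_bilinear wedge
  by (rule bounded_bilinear_wedge)

lemma wedge_self [simp]: "wedge v v = 0"
  by (simp add: wedge_def vec_eq_iff)

locale null_coordinates =
  fixes M :: "'a::topological_space set" and x :: "'a \<Rightarrow> real^4" and Or :: "'a \<Rightarrow> ((real^4) \<times> (real^4)) set"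
    and I J :: "real set" and \<phi> :: "real \<times> real \<Rightarrow> 'a" and \<alpha> \<beta> :: "real \<Rightarrow> real^4"
  assumes lor: "lorentzian M x" and chart: "null_chart M x Or I J \<phi> \<alpha> \<beta>"
begin

definition a where "a s = vector_derivative \<alpha> (at s)"
definition b where "b t = vector_derivative \<beta> (at t)"
definition a' where "a' s = vector_derivative a (at s)"
definition b' where "b' t = vector_derivative b (at t)"
definition \<mu> where "\<mu> s t = mink (a s) (b t)"

text \<open>\<open>A = h(a, a)\<close> and \<open>B = h(b, b)\<close>, the normal parts of the accelerations of the two null curves.\<close>

definition A where "A s t = a' s - (mink (a' s) (b t) / \<mu> s t) *\<^sub>R a s"
definition B where "B s t = b' t - (mink (a s) (b' t) / \<mu> s t) *\<^sub>R b t"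

lemma open_IJ: "open I" "open J" "open (I \<times> J)" and interval_IJ: "is_interval I" "is_interval J"
  and par: "local_param M x (I \<times> J) \<phi>"
  using chart unfolding null_chart_def by (auto intro: open_Times)

lemma smooth_\<alpha>: "smooth_on I \<alpha>" and smooth_\<beta>: "smooth_on J \<beta>"
  using chart unfolding null_chart_def by blast+

lemma pointwise:
  assumes "s \<in> I" "t \<in> J"
  shows "x (\<phi> (s, t)) = \<alpha> s + \<beta> t" "null_pair (a s) (b t)" "Or (\<phi> (s, t)) = oriented_bases (a s) (b t)"
  using chart assms unfolding null_chart_def a_def b_def by blast+

lemma smooth_curves: "smooth_on I a" "smooth_on J b" "smooth_on I a'" "smooth_on J b'"
  and curve_derivatives:
    "s \<in> I \<Longrightarrow> (\<alpha> has_vector_derivative a s) (at s)" "t \<in> J \<Longrightarrow> (\<beta> has_vector_derivative b t) (at t)"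
    "s \<in> I \<Longrightarrow> (a has_vector_derivative a' s) (at s)" "t \<in> J \<Longrightarrow> (b has_vector_derivative b' t) (at t)"
proof -
  show 1: "smooth_on I a" unfolding a_def[abs_def] by (rule smooth_curve(2)[OF open_IJ(1) smooth_\<alpha>])
  show 2: "smooth_on J b" unfolding b_def[abs_def] by (rule smooth_curve(2)[OF open_IJ(2) smooth_\<beta>])
  show "smooth_on I a'" unfolding a'_def[abs_def] by (rule smooth_curve(2)[OF open_IJ(1) 1])
  show "smooth_on J b'" unfolding b'_def[abs_def] by (rule smooth_curve(2)[OF open_IJ(2) 2])
  show "s \<in> I \<Longrightarrow> (\<alpha> has_vector_derivative a s) (at s)" unfolding a_def by (rule smooth_curve(1)[OF open_IJ(1) smooth_\<alpha>])
  show "t \<in> J \<Longrightarrow> (\<beta> has_vector_derivative b t) (at t)" unfolding b_def by (rule smooth_curve(1)[OF open_IJ(2) smooth_\<beta>])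
  show "s \<in> I \<Longrightarrow> (a has_vector_derivative a' s) (at s)" unfolding a'_def by (rule smooth_curve(1)[OF open_IJ(1) 1])
  show "t \<in> J \<Longrightarrow> (b has_vector_derivative b' t) (at t)" unfolding b'_def by (rule smooth_curve(1)[OF open_IJ(2) 2])
qed

lemma smooth_fields: "smooth_on (I \<times> J) (\<lambda>z. a (fst z))" "smooth_on (I \<times> J) (\<lambda>z. b (snd z))"
    "smooth_on (I \<times> J) (\<lambda>z. a' (fst z))" "smooth_on (I \<times> J) (\<lambda>z. b' (snd z))"
    "smooth_on (I \<times> J) (\<lambda>z. \<mu> (fst z) (snd z))"
proof -
  show *: "smooth_on (I \<times> J) (\<lambda>z. a (fst z))" "smooth_on (I \<times> J) (\<lambda>z. b (snd z))"
    "smooth_on (I \<times> J) (\<lambda>z. a' (fst z))" "smooth_on (I \<times> J) (\<lambda>z. b' (snd z))"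
    using smooth_curves by (auto intro: smooth_on_curve[OF open_IJ(1,2)])
  show "smooth_on (I \<times> J) (\<lambda>z. \<mu> (fst z) (snd z))"
    unfolding \<mu>_def by (intro smooth_on_mink open_IJ *)
qed

lemma field_derivatives:
  assumes "s \<in> I" "t \<in> J"
  shows "frechet_derivative (\<lambda>z. a (fst z)) (at (s, t)) c = fst c *\<^sub>R a' s"
    "frechet_derivative (\<lambda>z. b (snd z)) (at (s, t)) c = snd c *\<^sub>R b' t"
  using frechet_derivative_eqI[OF curve_has_derivative(1)[of a "a' s" "(s, t)"]]
    frechet_derivative_eqI[OF curve_has_derivative(2)[of b "b' t" "(s, t)"]] curve_derivatives(3,4) assms
  by simp_all

lemma differential:
  assumes "s \<in> I" "t \<in> J"
  shows "frechet_derivative (x \<circ> \<phi>) (at (s, t)) c = fst c *\<^sub>R a s + snd c *\<^sub>R b t"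
proof -
  have "((\<lambda>z. \<alpha> (fst z) + \<beta> (snd z)) has_derivative (\<lambda>c. fst c *\<^sub>R a s + snd c *\<^sub>R b t)) (at (s, t))"
    using curve_derivatives(1,2) assms by (intro has_derivative_add curve_has_derivative) auto
  then have "((x \<circ> \<phi>) has_derivative (\<lambda>c. fst c *\<^sub>R a s + snd c *\<^sub>R b t)) (at (s, t))"
    by (rule has_derivative_transform_within_open[OF _ open_IJ(3)]) (use assms pointwise(1) in auto)
  from frechet_derivative_eqI[OF this] show ?thesis by simp
qed

lemma tangent_span:
  assumes "s \<in> I" "t \<in> J"
  shows "tangent_space M x (\<phi> (s, t)) = span {a s, b t}"
proof -
  have st: "(s, t) \<in> I \<times> J" using assms by simp
  show ?thesis
    unfolding tangent_space_eq[OF par st] range_linear_plane(2)[OF local_param_has_derivative(2)[OF par st]]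
    by (simp add: differential[OF assms] del: comp_apply)
qed

lemma \<mu>_neg: "s \<in> I \<Longrightarrow> t \<in> J \<Longrightarrow> \<mu> s t < 0"
  unfolding \<mu>_def using null_pairD(7)[OF pointwise(2)] .

lemma acceleration:
  assumes "s \<in> I" "t \<in> J"
  shows "a' s $ 1 = 0" "mink (a' s) (a s) = 0" "b' t $ 1 = 0" "mink (b' t) (b t) = 0"
proof -
  have st: "(s, t) \<in> I \<times> J" using assms by simp
  have N: "a (fst z) $ 1 = 1 \<and> mink (a (fst z)) (a (fst z)) = 0" "b (snd z) $ 1 = 1 \<and> mink (b (snd z)) (b (snd z)) = 0"
    if "z \<in> I \<times> J" for z using null_pairD[OF pointwise(2)] that by auto
  show "a' s $ 1 = 0" "mink (a' s) (a s) = 0"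
    using null_field_derivative[OF open_IJ(3) st smooth_fields(1) N(1), of "(1,0)"]
    by (simp_all add: field_derivatives[OF assms])
  show "b' t $ 1 = 0" "mink (b' t) (b t) = 0"
    using null_field_derivative[OF open_IJ(3) st smooth_fields(2) N(2), of "(0,1)"]
    by (simp_all add: field_derivatives[OF assms])
qed

lemma AB_normal:
  assumes "s \<in> I" "t \<in> J"
  shows "mink (a s) (A s t) = 0" "mink (b t) (A s t) = 0" "mink (a s) (B s t) = 0" "mink (b t) (B s t) = 0"
  using null_pairD[OF pointwise(2)[OF assms]] acceleration[OF assms] \<mu>_neg[OF assms]
  unfolding A_def B_def mink_commute[of "a s" "_ - _"] mink_commute[of "b t" "_ - _"] mink.diff_left mink.scaleR_left
  by (simp_all add: mink_commute[of "b' t" "a s"] flip: \<mu>_def)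

text \<open>The acceleration has time component 0 and the velocity has time component 1, so the
  tangential coefficient can be read off the time component of \<open>A\<close>. In particular the
  vanishing of \<open>A s t\<close> does not depend on \<open>t\<close>, nor that of
  \<open>B s t\<close> on \<open>s\<close>.\<close>

lemma AB_zero:
  assumes "s \<in> I" "t \<in> J"
  shows "A s t = 0 \<longleftrightarrow> a' s = 0" "B s t = 0 \<longleftrightarrow> b' t = 0"
proof -
  have "A s t $ 1 = - (mink (a' s) (b t) / \<mu> s t)" "B s t $ 1 = - (mink (a s) (b' t) / \<mu> s t)"
    using acceleration[OF assms] null_pairD[OF pointwise(2)[OF assms]] by (simp_all add: A_def B_def)
  then have "A s t = 0 \<Longrightarrow> mink (a' s) (b t) / \<mu> s t = 0" "B s t = 0 \<Longrightarrow> mink (a s) (b' t) / \<mu> s t = 0"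
    by (metis neg_equal_0_iff_equal zero_index)+
  moreover have "a' s = A s t + (mink (a' s) (b t) / \<mu> s t) *\<^sub>R a s" "b' t = B s t + (mink (a s) (b' t) / \<mu> s t) *\<^sub>R b t"
    by (simp_all add: A_def B_def)
  moreover have "a' s = 0 \<Longrightarrow> A s t = 0" "b' t = 0 \<Longrightarrow> B s t = 0"
    by (simp_all add: A_def B_def mink.zero_left mink.zero_right)
  ultimately show "A s t = 0 \<longleftrightarrow> a' s = 0" "B s t = 0 \<longleftrightarrow> b' t = 0"
    by (metis add.right_neutral scaleR_zero_left)+
qed

lemma normal_part_acceleration:
  assumes "s \<in> I" "t \<in> J"
  shows "normal_part M x (\<phi> (s, t)) (a' s) = A s t" "normal_part M x (\<phi> (s, t)) (b' t) = B s t"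
  unfolding normal_part_def tangent_part_null_pair(1)[OF pointwise(2)[OF assms] tangent_span[OF assms]]
  by (simp_all add: acceleration[OF assms] A_def B_def mink_commute[of "b' t" "a s"] flip: \<mu>_def)

text \<open>The field \<open>a\<close> does not change in the t-direction, so the mixed term
  \<open>h(a, b)\<close> is zero; the pure terms are the normal parts of the accelerations.\<close>

lemma second_ff_null:
  assumes "s \<in> I" "t \<in> J"
  shows "second_ff M x (\<phi> (s, t)) (p *\<^sub>R a s + q *\<^sub>R b t) (p' *\<^sub>R a s + q' *\<^sub>R b t) =
    (p * p') *\<^sub>R A s t + (q * q') *\<^sub>R B s t"
proof -
  have st: "(s, t) \<in> I \<times> J" using assms by simp
  note h = second_ff_bilinear[OF par lor st]
  let ?h = "second_ff M x (\<phi> (s, t))" and ?T = "tangent_space M x (\<phi> (s, t))"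
  have T: "a s \<in> ?T" "b t \<in> ?T" and Tc: "v \<in> ?T \<Longrightarrow> w \<in> ?T \<Longrightarrow> v + w \<in> ?T" "v \<in> ?T \<Longrightarrow> c *\<^sub>R v \<in> ?T" for v w c
    unfolding tangent_span[OF assms] by (simp_all add: span_base span_add span_scale)
  have Ta: "a (fst z) \<in> tangent_space M x (\<phi> z)" "b (snd z) \<in> tangent_space M x (\<phi> z)" if "z \<in> I \<times> J" for z
    using that tangent_span by (auto simp: span_base)
  have aa: "?h (a s) (a s) = A s t" and ba: "?h (b t) (a s) = 0"
    using second_ff_eq[OF par lor st smooth_fields(1) Ta(1), of "(1,0)"]
      second_ff_eq[OF par lor st smooth_fields(1) Ta(1), of "(0,1)"] normal_part_acceleration[OF assms]
      linear_0[OF normal_part_null_pair(1)[OF pointwise(2)[OF assms] tangent_span[OF assms]]]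
    unfolding differential[OF assms] field_derivatives[OF assms] by simp_all
  have bb: "?h (b t) (b t) = B s t"
    using second_ff_eq[OF par lor st smooth_fields(2) Ta(2), of "(0,1)"] normal_part_acceleration[OF assms]
    unfolding differential[OF assms] field_derivatives[OF assms] by simp
  have ab: "?h (a s) (b t) = 0" using h(1)[OF T] ba by simp
  have lin: "?h (p *\<^sub>R a s + q *\<^sub>R b t) w = p *\<^sub>R ?h (a s) w + q *\<^sub>R ?h (b t) w" if "w \<in> ?T" for p q w
    using h(3)[OF Tc(2)[OF T(1)] that Tc(2)[OF T(2)]] h(2)[OF T(1) that] h(2)[OF T(2) that] by simp
  have W: "p' *\<^sub>R a s + q' *\<^sub>R b t \<in> ?T" by (intro Tc T)
  have "?h (a s) (p' *\<^sub>R a s + q' *\<^sub>R b t) = p' *\<^sub>R A s t" "?h (b t) (p' *\<^sub>R a s + q' *\<^sub>R b t) = q' *\<^sub>R B s t"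
    using h(1)[OF W T(1)] h(1)[OF W T(2)] lin[OF T(1), of p' q'] lin[OF T(2), of p' q'] h(1)[OF T(1) W] h(1)[OF T(2) W]
    by (simp_all add: aa ba ab bb)
  then show ?thesis unfolding lin[OF W] by simp
qed

lemma geodesic_point_iff:
  assumes "s \<in> I" "t \<in> J"
  shows "\<phi> (s, t) \<in> geodesic_points M x \<longleftrightarrow> a' s = 0 \<and> b' t = 0"
proof
  have ab: "a s \<in> tangent_space M x (\<phi> (s, t))" "b t \<in> tangent_space M x (\<phi> (s, t))"
    unfolding tangent_span[OF assms] by (simp_all add: span_base)
  assume "\<phi> (s, t) \<in> geodesic_points M x"
  then have "second_ff M x (\<phi> (s, t)) (a s) (a s) = 0" "second_ff M x (\<phi> (s, t)) (b t) (b t) = 0"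
    using ab unfolding geodesic_points_def by blast+
  then show "a' s = 0 \<and> b' t = 0"
    using second_ff_null[OF assms, of 1 0 1 0] second_ff_null[OF assms, of 0 1 0 1] AB_zero[OF assms] by simp
next
  assume "a' s = 0 \<and> b' t = 0"
  then have AB: "A s t = 0" "B s t = 0" using AB_zero[OF assms] by auto
  have "second_ff M x (\<phi> (s, t)) v w = 0"
    if "v \<in> tangent_space M x (\<phi> (s, t))" "w \<in> tangent_space M x (\<phi> (s, t))" for v w
    using that unfolding tangent_span[OF assms] span_pair by (auto simp: second_ff_null[OF assms] AB)
  moreover have "\<phi> (s, t) \<in> M" using local_paramD(6)[OF par] assms by auto
  ultimately show "\<phi> (s, t) \<in> geodesic_points M x" unfolding geodesic_points_def by blast
qed

text \<open>The relative null space is the whole Lorentzian plane if both accelerations vanish, a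
  null line if exactly one does, and zero otherwise. Only the null line is degenerate.\<close>

lemma degenerate_relative_null_iff:
  assumes "s \<in> I" "t \<in> J"
  shows "degenerate_space (relative_null_space M x (\<phi> (s, t))) \<longleftrightarrow> (a' s = 0 \<longleftrightarrow> b' t \<noteq> 0)"
proof -
  note n = null_pairD[OF pointwise(2)[OF assms]]
  have rel: "relative_null_space M x (\<phi> (s, t)) = {p *\<^sub>R a s + q *\<^sub>R b t | p q. p *\<^sub>R A s t = 0 \<and> q *\<^sub>R B s t = 0}"
  proof (intro equalityI subsetI)
    fix v assume v: "v \<in> relative_null_space M x (\<phi> (s, t))"
    then obtain p q where pq: "v = p *\<^sub>R a s + q *\<^sub>R b t"
      unfolding relative_null_space_def tangent_span[OF assms] span_pair by blast
    have "1 *\<^sub>R a s + 0 *\<^sub>R b t \<in> tangent_space M x (\<phi> (s, t))" "0 *\<^sub>R a s + 1 *\<^sub>R b t \<in> tangent_space M x (\<phi> (s, t))"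
      unfolding tangent_span[OF assms] by (simp_all add: span_base)
    then have "second_ff M x (\<phi> (s, t)) v (1 *\<^sub>R a s + 0 *\<^sub>R b t) = 0" "second_ff M x (\<phi> (s, t)) v (0 *\<^sub>R a s + 1 *\<^sub>R b t) = 0"
      using v unfolding relative_null_space_def by blast+
    then show "v \<in> {p *\<^sub>R a s + q *\<^sub>R b t | p q. p *\<^sub>R A s t = 0 \<and> q *\<^sub>R B s t = 0}"
      unfolding pq second_ff_null[OF assms] by auto
  next
    fix v assume "v \<in> {p *\<^sub>R a s + q *\<^sub>R b t | p q. p *\<^sub>R A s t = 0 \<and> q *\<^sub>R B s t = 0}"
    then obtain p q where pq: "v = p *\<^sub>R a s + q *\<^sub>R b t" "p *\<^sub>R A s t = 0 \<and> q *\<^sub>R B s t = 0" by blast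
    have "second_ff M x (\<phi> (s, t)) v w = 0" if "w \<in> tangent_space M x (\<phi> (s, t))" for w
    proof -
      obtain p' q' where w: "w = p' *\<^sub>R a s + q' *\<^sub>R b t"
        using \<open>w \<in> _\<close> unfolding tangent_span[OF assms] span_pair by blast
      show ?thesis unfolding pq(1) w second_ff_null[OF assms] using pq(2) by auto
    qed
    moreover have "v \<in> tangent_space M x (\<phi> (s, t))"
      unfolding tangent_span[OF assms] span_pair using pq(1) by metis
    ultimately show "v \<in> relative_null_space M x (\<phi> (s, t))"
      unfolding relative_null_space_def by simp
  qed
  have mab: "mink (p *\<^sub>R a s + q *\<^sub>R b t) (p' *\<^sub>R a s + q' *\<^sub>R b t) = (p * q' + q * p') * \<mu> s t" for p q p' q'
    using n by (simp add: mink.add_left mink.add_right mink.scaleR_left mink.scaleR_right \<mu>_def algebra_simps)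
  have nz: "\<mu> s t \<noteq> 0" "a s \<noteq> 0" "b t \<noteq> 0" using \<mu>_neg[OF assms] n by (auto simp: mink.zero_left \<mu>_def mink.zero_right)
  consider "a' s = 0" "b' t = 0" | "a' s = 0" "b' t \<noteq> 0" | "a' s \<noteq> 0" "b' t = 0" | "a' s \<noteq> 0" "b' t \<noteq> 0" by blast
  then show ?thesis
  proof cases
    case 1
    have "\<not> degenerate_space (relative_null_space M x (\<phi> (s, t)))"
      unfolding degenerate_space_def
    proof
      assume "\<exists>v\<in>relative_null_space M x (\<phi> (s, t)). v \<noteq> 0 \<and> (\<forall>w\<in>relative_null_space M x (\<phi> (s, t)). mink v w = 0)"
      then obtain p q where pq: "p *\<^sub>R a s + q *\<^sub>R b t \<noteq> 0"
        "\<forall>w\<in>relative_null_space M x (\<phi> (s, t)). mink (p *\<^sub>R a s + q *\<^sub>R b t) w = 0"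
        unfolding rel by blast
      have "p' *\<^sub>R a s + q' *\<^sub>R b t \<in> relative_null_space M x (\<phi> (s, t))" for p' q'
        unfolding rel using 1 AB_zero[OF assms] by auto
      then have "(p * q' + q * p') * \<mu> s t = 0" for p' q' using pq(2) mab by metis
      from this[of 0 1] this[of 1 0] have "p = 0" "q = 0" using nz by auto
      then show False using pq(1) by simp
    qed
    with 1 show ?thesis by simp
  next
    case 2
    then have "relative_null_space M x (\<phi> (s, t)) = {p *\<^sub>R a s + 0 *\<^sub>R b t | p. True}"
      unfolding rel using AB_zero[OF assms] by auto
    then have "degenerate_space (relative_null_space M x (\<phi> (s, t)))"
      unfolding degenerate_space_def using nz n
      by (intro bexI[of _ "a s"]) (auto simp: mink.scaleR_right intro: exI[of _ 1])
    with 2 show ?thesis by simp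
  next
    case 3
    then have "relative_null_space M x (\<phi> (s, t)) = {0 *\<^sub>R a s + q *\<^sub>R b t | q. True}"
      unfolding rel using AB_zero[OF assms] by auto
    then have "degenerate_space (relative_null_space M x (\<phi> (s, t)))"
      unfolding degenerate_space_def using nz n
      by (intro bexI[of _ "b t"]) (auto simp: mink.scaleR_right intro: exI[of _ 1])
    with 3 show ?thesis by simp
  next
    case 4
    then have "relative_null_space M x (\<phi> (s, t)) = {0}"
      unfolding rel using AB_zero[OF assms] by auto
    then show ?thesis using 4 by (simp add: degenerate_space_def)
  qed
qed

end

section \<open>The Laplacian of the Gauss map\<close>

context null_coordinates
begin

lemma deriv_along_null:
  assumes "s \<in> I" "t \<in> J" "(g \<circ> \<phi>) differentiable (at (s, t))"
  shows "deriv_along M x g (\<phi> (s, t)) (p *\<^sub>R a s + q *\<^sub>R b t) = frechet_derivative (g \<circ> \<phi>) (at (s, t)) (p, q)"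
proof -
  have "(s, t) \<in> I \<times> J" using assms by simp
  from deriv_along_eq[OF par this assms(3), of "(p, q)"] show ?thesis
    by (simp only: differential[OF assms(1,2)] fst_conv snd_conv)
qed

text \<open>Frames and fields are maps on the surface; this transports a map on the coordinate box
  there. Values outside the chart image are arbitrary and all uses stay inside it.\<close>

definition lift :: "(real \<times> real \<Rightarrow> 'b) \<Rightarrow> 'a \<Rightarrow> 'b" where
  "lift E = E \<circ> the_inv_into (I \<times> J) \<phi>"

lemma lift_eq: "z \<in> I \<times> J \<Longrightarrow> lift E (\<phi> z) = E z"
  unfolding lift_def comp_apply by (simp only: the_inv_into_f_f[OF local_paramD(4)[OF par]])

lemma lift_smooth:
  assumes "smooth_on (I \<times> J) E"
  shows "smooth_on (I \<times> J) (lift E \<circ> \<phi>)" "smooth_map_on M x (\<phi> ` (I \<times> J)) (lift E)"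
proof -
  show s: "smooth_on (I \<times> J) (lift E \<circ> \<phi>)"
    by (rule smooth_on_cong[OF assms open_IJ(3)]) (simp only: comp_apply lift_eq)
  show "smooth_map_on M x (\<phi> ` (I \<times> J)) (lift E)"
    by (rule smooth_map_onI) (use par s in blast)
qed

lemma lift_tangent_field:
  assumes "smooth_on (I \<times> J) E" "\<And>z. z \<in> I \<times> J \<Longrightarrow> E z \<in> tangent_space M x (\<phi> z)"
  shows "tangent_field M x (\<phi> ` (I \<times> J)) (lift E)"
  unfolding tangent_field_def
proof (intro conjI ballI)
  show "smooth_map_on M x (\<phi> ` (I \<times> J)) (lift E)" by (rule lift_smooth(2)[OF assms(1)])
  fix p assume "p \<in> \<phi> ` (I \<times> J)"
  then obtain z where z: "z \<in> I \<times> J" "p = \<phi> z" by blast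
  show "lift E p \<in> tangent_space M x p" unfolding z(2) lift_eq[OF z(1)] by (rule assms(2)[OF z(1)])
qed

text \<open>The orientation excludes the interchanged case, since \<open>- 1 / \<mu> s t\<close> is
  positive. The remaining factors are the time components because \<open>a s\<close> and
  \<open>b t\<close> have time component 1.\<close>

lemma oriented_pseudo_orthonormal:
  assumes st: "s \<in> I" "t \<in> J"
    and f: "f1 \<in> tangent_space M x (\<phi> (s, t))" "f2 \<in> tangent_space M x (\<phi> (s, t))"
    and po: "pseudo_orthonormal f1 f2" "(f1, f2) \<in> Or (\<phi> (s, t))"
  shows "f1 = (f1 $ 1) *\<^sub>R a s" "f2 = (f2 $ 1) *\<^sub>R b t" "f1 $ 1 * f2 $ 1 = - 1 / \<mu> s t"
proof -
  note N = pointwise(2)[OF st] and n = null_pairD[OF pointwise(2)[OF st]]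
  obtain p q p' q' where pq: "f1 = p *\<^sub>R a s + q *\<^sub>R b t" "f2 = p' *\<^sub>R a s + q' *\<^sub>R b t" "p * q' - p' * q > 0"
    using po(2) unfolding pointwise(3)[OF st] oriented_bases_def by blast
  have "q = 0 \<and> p' = 0 \<and> p * q' = - 1 / \<mu> s t \<or> p = 0 \<and> q' = 0 \<and> q * p' = - 1 / \<mu> s t"
    using po(1) pseudo_orthonormal_null_pair[OF N] unfolding pq \<mu>_def by blast
  moreover have "- 1 / \<mu> s t > 0" using \<mu>_neg[OF st] by (simp add: field_simps)
  ultimately have c: "q = 0" "p' = 0" "p * q' = - 1 / \<mu> s t" using pq(3) by (auto simp: mult.commute)
  show "f1 = (f1 $ 1) *\<^sub>R a s" "f2 = (f2 $ 1) *\<^sub>R b t" "f1 $ 1 * f2 $ 1 = - 1 / \<mu> s t"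
    using c n by (simp_all add: pq)
qed

text \<open>The Gauss map in null coordinates, computed from the frame formed by \<open>a\<close>
  and \<open>b\<close> divided by \<open>- \<mu>\<close>.\<close>

definition \<nu> :: "real \<Rightarrow> real \<Rightarrow> real^4^4" where
  "\<nu> s t = (- 1 / \<mu> s t) *\<^sub>R wedge (a s) (b t)"

lemma null_frame_exists:
  "pseudo_orthonormal_frame M x Or (\<phi> ` (I \<times> J)) (lift (\<lambda>z. a (fst z))) (lift (\<lambda>z. (- 1 / \<mu> (fst z) (snd z)) *\<^sub>R b (snd z)))"
  unfolding pseudo_orthonormal_frame_def
proof (intro conjI ballI)
  have nz: "\<mu> (fst z) (snd z) \<noteq> 0" if "z \<in> I \<times> J" for z using \<mu>_neg[of "fst z" "snd z"] that by auto
  show "openin (top_of_set M) (\<phi> ` (I \<times> J))" by (rule local_paramD(2)[OF par])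
  show "tangent_field M x (\<phi> ` (I \<times> J)) (lift (\<lambda>z. a (fst z)))"
    by (rule lift_tangent_field[OF smooth_fields(1)]) (auto simp: tangent_span span_base)
  show "tangent_field M x (\<phi> ` (I \<times> J)) (lift (\<lambda>z. (- 1 / \<mu> (fst z) (snd z)) *\<^sub>R b (snd z)))"
  proof (rule lift_tangent_field)
    show "smooth_on (I \<times> J) (\<lambda>z. (- 1 / \<mu> (fst z) (snd z)) *\<^sub>R b (snd z))"
      by (intro smooth_on_scaleR smooth_on_divide smooth_on_const smooth_fields open_IJ nz)
    fix z assume "z \<in> I \<times> J"
    then show "(- 1 / \<mu> (fst z) (snd z)) *\<^sub>R b (snd z) \<in> tangent_space M x (\<phi> z)"
      by (cases z) (simp add: tangent_span span_base span_scale span_neg)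
  qed
  fix p assume "p \<in> \<phi> ` (I \<times> J)"
  then obtain s t where st: "s \<in> I" "t \<in> J" and p: "p = \<phi> (s, t)" by auto
  have z: "(s, t) \<in> I \<times> J" using st by simp
  have c: "- 1 / mink (a s) (b t) > 0" using \<mu>_neg[OF st] by (simp add: \<mu>_def field_simps)
  show "pseudo_orthonormal (lift (\<lambda>z. a (fst z)) p) (lift (\<lambda>z. (- 1 / \<mu> (fst z) (snd z)) *\<^sub>R b (snd z)) p)"
    unfolding p lift_eq[OF z]
    using pseudo_orthonormal_null_pair[OF pointwise(2)[OF st], of 1 0 0 "- 1 / \<mu> s t"] by (simp add: \<mu>_def)
  have "(1 *\<^sub>R a s + 0 *\<^sub>R b t, 0 *\<^sub>R a s + (- 1 / \<mu> s t) *\<^sub>R b t) \<in> oriented_bases (a s) (b t)"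
    unfolding oriented_bases_def
    by (intro CollectI exI[of _ 1] exI[of _ 0] exI[of _ "- 1 / \<mu> s t"] conjI refl) (use c in \<open>simp add: \<mu>_def\<close>)
  then show "(lift (\<lambda>z. a (fst z)) p, lift (\<lambda>z. (- 1 / \<mu> (fst z) (snd z)) *\<^sub>R b (snd z)) p) \<in> Or p"
    unfolding p lift_eq[OF z] pointwise(3)[OF st] by simp
qed

lemma frame_components:
  assumes F: "pseudo_orthonormal_frame M x Or V f1 f2" and st: "s \<in> I" "t \<in> J" "\<phi> (s, t) \<in> V"
  shows "f1 (\<phi> (s, t)) = (f1 (\<phi> (s, t)) $ 1) *\<^sub>R a s" "f2 (\<phi> (s, t)) = (f2 (\<phi> (s, t)) $ 1) *\<^sub>R b t"
    "f1 (\<phi> (s, t)) $ 1 * f2 (\<phi> (s, t)) $ 1 = - 1 / \<mu> s t"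
  using F st(3) oriented_pseudo_orthonormal[OF st(1,2)]
  unfolding pseudo_orthonormal_frame_def tangent_field_def by blast+

lemma gauss_map_null:
  assumes "s \<in> I" "t \<in> J"
  shows "gauss_map M x Or (\<phi> (s, t)) = \<nu> s t"
  unfolding gauss_map_def
proof (rule the_equality)
  have z: "(s, t) \<in> I \<times> J" using assms by simp
  have w: "wedge f1 f2 = \<nu> s t" if "pseudo_orthonormal_frame M x Or V g1 g2" "\<phi> (s, t) \<in> V" "f1 = g1 (\<phi> (s, t))" "f2 = g2 (\<phi> (s, t))"
    for V f1 f2 g1 g2
  proof -
    note c = frame_components[OF that(1) assms that(2), folded that(3,4)]
    have "wedge f1 f2 = (f1 $ 1 * f2 $ 1) *\<^sub>R wedge (a s) (b t)"
      by (subst c(1), subst c(2)) (simp add: wedge.scaleR_left wedge.scaleR_right)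
    then show ?thesis unfolding c(3) \<nu>_def .
  qed
  show "\<exists>V f1 f2. pseudo_orthonormal_frame M x Or V f1 f2 \<and> \<phi> (s, t) \<in> V \<and> \<nu> s t = wedge (f1 (\<phi> (s, t))) (f2 (\<phi> (s, t)))"
    using null_frame_exists imageI[OF z] w[OF null_frame_exists imageI[OF z] refl refl, symmetric]
    by (intro exI conjI)
  show "y = \<nu> s t" if ex: "\<exists>V f1 f2. pseudo_orthonormal_frame M x Or V f1 f2 \<and> \<phi> (s, t) \<in> V \<and> y = wedge (f1 (\<phi> (s, t))) (f2 (\<phi> (s, t)))" for y
  proof -
    obtain V f1 f2 where "pseudo_orthonormal_frame M x Or V f1 f2" "\<phi> (s, t) \<in> V" "y = wedge (f1 (\<phi> (s, t))) (f2 (\<phi> (s, t)))"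
      using ex by (elim exE conjE)
    then show ?thesis using w[OF _ _ refl refl] by simp
  qed
qed

text \<open>One iterated derivative together with its connection term. Since the unscaled field
  \<open>v e2\<close> is parallel in direction \<open>e1\<close>, the covariant derivative of
  \<open>f2\<close> contains only the derivative of the factor \<open>d\<close>; it cancels the
  corresponding term of the product rule. So only the product of the two factors matters, not the
  choice of frame.\<close>

lemma frame_half_laplacian:
  fixes g :: "'a \<Rightarrow> 'b::euclidean_space" and e1 e2 :: "real \<times> real"
  defines "v \<equiv> \<lambda>e z. fst e *\<^sub>R a (fst z) + snd e *\<^sub>R b (snd z)"
  assumes g: "smooth_on (I \<times> J) (g \<circ> \<phi>)" and S: "open S" "S \<subseteq> I \<times> J" "z \<in> S"
    and d: "smooth_on S d" and f1: "f1 (\<phi> z) = c *\<^sub>R v e1 z" and f2: "\<And>w. w \<in> S \<Longrightarrow> f2 (\<phi> w) = d w *\<^sub>R v e2 w"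
    and par0: "frechet_derivative (v e2) (at z) e1 = 0"
  shows "deriv_along M x (\<lambda>q. deriv_along M x g q (f2 q)) (\<phi> z) (f1 (\<phi> z)) -
      deriv_along M x g (\<phi> z) (levi_civita M x f1 f2 (\<phi> z)) =
    (c * d z) *\<^sub>R frechet_derivative (\<lambda>w. frechet_derivative (g \<circ> \<phi>) (at w) e2) (at z) e1"
proof -
  let ?G = "g \<circ> \<phi>" and ?D = "frechet_derivative d (at z) e1"
  let ?H = "\<lambda>w. frechet_derivative ?G (at w) e2"
  have zIJ: "z \<in> I \<times> J" using S by blast
  have der: "deriv_along M x k (\<phi> w) (r *\<^sub>R v e w) = r *\<^sub>R frechet_derivative (k \<circ> \<phi>) (at w) e"
    if "(k \<circ> \<phi>) differentiable (at w)" "w \<in> S" for k :: "'a \<Rightarrow> 'c::real_normed_vector" and r e w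
  proof -
    have w: "fst w \<in> I" "snd w \<in> J" using that(2) S(2) by auto
    have "deriv_along M x k (\<phi> (fst w, snd w)) ((r * fst e) *\<^sub>R a (fst w) + (r * snd e) *\<^sub>R b (snd w)) =
        frechet_derivative (k \<circ> \<phi>) (at (fst w, snd w)) (r * fst e, r * snd e)"
      by (rule deriv_along_null[OF w]) (use that(1) in simp)
    moreover have "frechet_derivative (k \<circ> \<phi>) (at w) (r *\<^sub>R e) = r *\<^sub>R frechet_derivative (k \<circ> \<phi>) (at w) e"
      by (rule linear_cmul[OF linear_frechet_derivative[OF that(1)]])
    moreover have "r *\<^sub>R e = (r * fst e, r * snd e)" by (simp add: prod_eq_iff)
    ultimately show ?thesis by (simp add: v_def scaleR_add_right del: comp_apply)
  qed
  have sH: "smooth_on S ?H" using smooth_on_subset[OF smooth_on_frechet[OF g] S(2)] .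
  have sv: "smooth_on S (v e2)"
    unfolding v_def
    by (intro smooth_on_add smooth_on_scaleR smooth_on_const smooth_on_subset[OF smooth_fields(1) S(2)]
        smooth_on_subset[OF smooth_fields(2) S(2)] S(1))
  have second: "deriv_along M x k (\<phi> z) (c *\<^sub>R v e1 z) =
      c *\<^sub>R (d z *\<^sub>R frechet_derivative K (at z) e1 + ?D *\<^sub>R K z)"
    if sK: "smooth_on S K" and k: "\<And>w. w \<in> S \<Longrightarrow> k (\<phi> w) = d w *\<^sub>R K w"
    for k :: "'a \<Rightarrow> 'c::real_normed_vector" and K
  proof -
    have s: "smooth_on S (\<lambda>w. d w *\<^sub>R K w)" by (intro smooth_on_scaleR d sK S(1))
    have "smooth_on S (k \<circ> \<phi>)" by (rule smooth_on_cong[OF s S(1)]) (simp add: k)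
    from der[OF smooth_on_differentiable[OF this S(3)] S(3)]
    have "deriv_along M x k (\<phi> z) (c *\<^sub>R v e1 z) = c *\<^sub>R frechet_derivative (k \<circ> \<phi>) (at z) e1" .
    also have "frechet_derivative (k \<circ> \<phi>) (at z) = frechet_derivative (\<lambda>w. d w *\<^sub>R K w) (at z)"
      by (rule frechet_derivative_transform_within_open[OF smooth_on_differentiable[OF s S(3)] S(1,3), symmetric])
         (simp add: k)
    also have "frechet_derivative (\<lambda>w. d w *\<^sub>R K w) (at z) e1 = d z *\<^sub>R frechet_derivative K (at z) e1 + ?D *\<^sub>R K z"
      by (rule frechet_derivative_bilinear[OF bounded_bilinear_scaleR smooth_on_differentiable[OF d S(3)]
            smooth_on_differentiable[OF sK S(3)]])
    finally show ?thesis .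
  qed
  have 1: "deriv_along M x (\<lambda>q. deriv_along M x g q (f2 q)) (\<phi> z) (f1 (\<phi> z)) =
      c *\<^sub>R (d z *\<^sub>R frechet_derivative ?H (at z) e1 + ?D *\<^sub>R ?H z)"
    unfolding f1
  proof (rule second[OF sH])
    fix w assume w: "w \<in> S"
    then have "w \<in> I \<times> J" using S(2) by blast
    then show "deriv_along M x g (\<phi> w) (f2 (\<phi> w)) = d w *\<^sub>R ?H w"
      unfolding f2[OF w] by (intro der[OF smooth_on_differentiable[OF g] w])
  qed
  have "deriv_along M x f2 (\<phi> z) (f1 (\<phi> z)) = c *\<^sub>R (d z *\<^sub>R frechet_derivative (v e2) (at z) e1 + ?D *\<^sub>R v e2 z)"
    unfolding f1 by (rule second[OF sv f2])
  then have lc: "levi_civita M x f1 f2 (\<phi> z) = tangent_part M x (\<phi> z) ((c * ?D) *\<^sub>R v e2 z)"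
    unfolding levi_civita_def par0 by simp
  have "tangent_part M x (\<phi> z) ((c * ?D) *\<^sub>R v e2 z) = (c * ?D) *\<^sub>R v e2 z"
  proof -
    obtain s t where z: "z = (s, t)" by (cases z)
    have st: "s \<in> I" "t \<in> J" using zIJ z by auto
    have "(c * ?D) *\<^sub>R v e2 z \<in> tangent_space M x (\<phi> z)"
      unfolding z tangent_span[OF st] v_def fst_conv snd_conv by (intro span_scale span_add span_base) simp_all
    then have "normal_part M x (\<phi> z) ((c * ?D) *\<^sub>R v e2 z) = 0"
      using normal_part_null_pair(2)[OF pointwise(2)[OF st] tangent_span[OF st]] unfolding z by blast
    then show ?thesis unfolding normal_part_def by simp
  qed
  then have 2: "deriv_along M x g (\<phi> z) (levi_civita M x f1 f2 (\<phi> z)) = (c * ?D) *\<^sub>R ?H z"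
    unfolding lc using der[OF smooth_on_differentiable[OF g zIJ] S(3)] by simp
  show ?thesis unfolding 1 2 by (simp add: scaleR_add_right)
qed

text \<open>The two halves coincide by Schwarz' theorem, and the factors of every oriented
  pseudo-orthonormal frame multiply to \<open>- 1 / \<mu> s t\<close>.\<close>

lemma laplacian_null:
  fixes g :: "'a \<Rightarrow> 'b::euclidean_space"
  assumes g: "smooth_on (I \<times> J) (g \<circ> \<phi>)" and st: "s \<in> I" "t \<in> J"
  shows "laplacian M x Or g (\<phi> (s, t)) =
    (- 2 / \<mu> s t) *\<^sub>R frechet_derivative (\<lambda>w. frechet_derivative (g \<circ> \<phi>) (at w) (0,1)) (at (s, t)) (1,0)" (is "_ = ?R")
  unfolding laplacian_def
proof (rule the_equality)
  have z: "(s, t) \<in> I \<times> J" using st by simp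
  let ?L = "\<lambda>f1 f2. deriv_along M x (\<lambda>q. deriv_along M x g q (f2 q)) (\<phi> (s, t)) (f1 (\<phi> (s, t)))
          + deriv_along M x (\<lambda>q. deriv_along M x g q (f1 q)) (\<phi> (s, t)) (f2 (\<phi> (s, t)))
          - deriv_along M x g (\<phi> (s, t)) (levi_civita M x f1 f2 (\<phi> (s, t)))
          - deriv_along M x g (\<phi> (s, t)) (levi_civita M x f2 f1 (\<phi> (s, t)))"
  have val: "?L f1 f2 = ?R" if F: "pseudo_orthonormal_frame M x Or V f1 f2" "\<phi> (s, t) \<in> V" for V f1 f2
  proof -
    define S where "S = {w \<in> I \<times> J. \<phi> w \<in> V}"
    have oV: "openin (top_of_set M) V" and sf: "smooth_map_on M x V f1" "smooth_map_on M x V f2"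
      using F(1) unfolding pseudo_orthonormal_frame_def tangent_field_def by blast+
    have S: "open S" "S \<subseteq> I \<times> J" "(s, t) \<in> S"
      unfolding S_def using chart_preimage_open[OF par oV] F(2) z by auto
    have sd: "smooth_on S (\<lambda>w. (f1 \<circ> \<phi>) w $ 1)" "smooth_on S (\<lambda>w. (f2 \<circ> \<phi>) w $ 1)"
      by (rule smooth_on_nth[OF S(1) smooth_map_onD[OF sf(1) oV par, folded S_def]],
          rule smooth_on_nth[OF S(1) smooth_map_onD[OF sf(2) oV par, folded S_def]])
    have f1: "f1 (\<phi> w) = ((f1 \<circ> \<phi>) w $ 1) *\<^sub>R (fst (1,0) *\<^sub>R a (fst w) + snd (1,0) *\<^sub>R b (snd w))"
      and f2: "f2 (\<phi> w) = ((f2 \<circ> \<phi>) w $ 1) *\<^sub>R (fst (0,1) *\<^sub>R a (fst w) + snd (0,1) *\<^sub>R b (snd w))"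
      if "w \<in> S" for w
    proof -
      have "fst w \<in> I" "snd w \<in> J" "\<phi> (fst w, snd w) \<in> V" using that by (auto simp: S_def)
      from frame_components(1,2)[OF F(1) this]
      show "f1 (\<phi> w) = ((f1 \<circ> \<phi>) w $ 1) *\<^sub>R (fst (1,0) *\<^sub>R a (fst w) + snd (1,0) *\<^sub>R b (snd w))"
        "f2 (\<phi> w) = ((f2 \<circ> \<phi>) w $ 1) *\<^sub>R (fst (0,1) *\<^sub>R a (fst w) + snd (0,1) *\<^sub>R b (snd w))" by simp_all
    qed
    have par0: "frechet_derivative (\<lambda>z. fst (0,1) *\<^sub>R a (fst z) + snd (0,1) *\<^sub>R b (snd z)) (at (s, t)) (1,0) = 0"
      "frechet_derivative (\<lambda>z. fst (1,0) *\<^sub>R a (fst z) + snd (1,0) *\<^sub>R b (snd z)) (at (s, t)) (0,1) = 0"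
      by (simp_all add: field_derivatives[OF st])
    let ?c = "(f1 \<circ> \<phi>) (s, t) $ 1" and ?d = "(f2 \<circ> \<phi>) (s, t) $ 1"
    note h1 = frame_half_laplacian[where z = "(s, t)" and ?f1.0 = f1 and ?f2.0 = f2 and c = ?c and
        d = "\<lambda>w. (f2 \<circ> \<phi>) w $ 1" and ?e1.0 = "(1,0)" and ?e2.0 = "(0,1)", OF g S sd(2) f1[OF S(3)] f2 par0(1)]
    note h2 = frame_half_laplacian[where z = "(s, t)" and ?f1.0 = f2 and ?f2.0 = f1 and c = ?d and
        d = "\<lambda>w. (f1 \<circ> \<phi>) w $ 1" and ?e1.0 = "(0,1)" and ?e2.0 = "(1,0)", OF g S sd(1) f2[OF S(3)] f1 par0(2)]
    have sym: "frechet_derivative (\<lambda>w. frechet_derivative (g \<circ> \<phi>) (at w) (1,0)) (at (s, t)) (0,1) =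
      frechet_derivative (\<lambda>w. frechet_derivative (g \<circ> \<phi>) (at w) (0,1)) (at (s, t)) (1,0)"
      by (rule second_derivative_symmetric[OF open_IJ(3) g z])
    have "?L f1 f2 = (?c * ?d) *\<^sub>R frechet_derivative (\<lambda>w. frechet_derivative (g \<circ> \<phi>) (at w) (0,1)) (at (s, t)) (1,0) +
        (?d * ?c) *\<^sub>R frechet_derivative (\<lambda>w. frechet_derivative (g \<circ> \<phi>) (at w) (0,1)) (at (s, t)) (1,0)"
      using h1 h2 unfolding sym by (simp add: algebra_simps del: comp_apply)
    also have "\<dots> = (2 * (?c * ?d)) *\<^sub>R frechet_derivative (\<lambda>w. frechet_derivative (g \<circ> \<phi>) (at w) (0,1)) (at (s, t)) (1,0)"
      by (simp add: scaleR_add_left[symmetric] mult.commute del: comp_apply)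
    also have "?c * ?d = - 1 / \<mu> s t" using frame_components(3)[OF F(1) st F(2)] by simp
    finally show ?thesis by (simp del: comp_apply)
  qed
  show "\<exists>V f1 f2. pseudo_orthonormal_frame M x Or V f1 f2 \<and> \<phi> (s, t) \<in> V \<and> ?R = ?L f1 f2"
    using null_frame_exists val[OF null_frame_exists imageI[OF z], symmetric] imageI[OF z]
    by (intro exI conjI)
  fix y assume "\<exists>V f1 f2. pseudo_orthonormal_frame M x Or V f1 f2 \<and> \<phi> (s, t) \<in> V \<and> y = ?L f1 f2"
  then obtain V f1 f2 where "pseudo_orthonormal_frame M x Or V f1 f2" "\<phi> (s, t) \<in> V" "y = ?L f1 f2" by (elim exE conjE)
  then show "y = ?R" using val by (simp only:)
qed

lemma gauss_map_smooth: "smooth_on (I \<times> J) (gauss_map M x Or \<circ> \<phi>)"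
proof (rule smooth_on_cong[OF _ open_IJ(3)])
  have nz: "\<mu> (fst z) (snd z) \<noteq> 0" if "z \<in> I \<times> J" for z using \<mu>_neg[of "fst z" "snd z"] that by auto
  show "smooth_on (I \<times> J) (\<lambda>z. \<nu> (fst z) (snd z))"
    unfolding \<nu>_def
    by (intro smooth_on_scaleR smooth_on_divide smooth_on_const smooth_fields open_IJ nz
        smooth_on_bilinear[OF bounded_bilinear_wedge])
qed (use gauss_map_null in auto)

text \<open>The mixed derivative of \<open>\<nu>\<close> and the bivector
  \<open>wedge (A s t) (B s t)\<close> are both expanded in the wedge products of \<open>a\<close>,
  \<open>a'\<close> with \<open>b\<close>, \<open>b'\<close>. They agree up to a scalar, except in
  the coefficient of \<open>wedge (a s) (b t)\<close>, where the surplus is the multiple of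
  \<open>\<nu>\<close>.\<close>

lemma laplacian_gauss_map:
  assumes st: "s \<in> I" "t \<in> J"
  shows "laplacian M x Or (gauss_map M x Or) (\<phi> (s, t)) =
    (2 / (\<mu> s t)\<^sup>2) *\<^sub>R (mink (A s t) (B s t) *\<^sub>R \<nu> s t + wedge (A s t) (B s t))"
proof -
  have z: "(s, t) \<in> I \<times> J" using st by simp
  let ?G = "gauss_map M x Or \<circ> \<phi>"
  \<comment> \<open>The t-derivative of \<open>\<nu>\<close>; the bivector \<open>R\<close> below is
    the s-derivative of \<open>H\<close>. Both are written out by the product rule.\<close>
  define H where "H s t = (- 1 / \<mu> s t) *\<^sub>R wedge (a s) (b' t) + (mink (a s) (b' t) / (\<mu> s t)\<^sup>2) *\<^sub>R wedge (a s) (b t)" for s t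
  have d2: "((\<lambda>t. \<mu> s t) has_real_derivative mink (a s) (b' t)) (at t)"
    and d1: "((\<lambda>s. \<mu> s t) has_real_derivative mink (a' s) (b t)) (at s)"
    and d1': "((\<lambda>s. mink (a s) (b' t)) has_real_derivative mink (a' s) (b' t)) (at s)"
    if "s \<in> I" "t \<in> J" for s t
  proof -
    show "((\<lambda>t. \<mu> s t) has_real_derivative mink (a s) (b' t)) (at t)"
      using mink.has_vector_derivative[OF has_vector_derivative_const[of "a s"] curve_derivatives(4)[OF that(2)]]
      by (simp add: has_real_derivative_iff_has_vector_derivative \<mu>_def mink.zero_left)
    show "((\<lambda>s. \<mu> s t) has_real_derivative mink (a' s) (b t)) (at s)"
      using mink.has_vector_derivative[OF curve_derivatives(3)[OF that(1)] has_vector_derivative_const[of "b t"]]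
      by (simp add: has_real_derivative_iff_has_vector_derivative \<mu>_def mink.zero_right)
    show "((\<lambda>s. mink (a s) (b' t)) has_real_derivative mink (a' s) (b' t)) (at s)"
      using mink.has_vector_derivative[OF curve_derivatives(3)[OF that(1)] has_vector_derivative_const[of "b' t"]]
      by (simp add: has_real_derivative_iff_has_vector_derivative mink.zero_right)
  qed
  have w2: "((\<lambda>t. wedge (a s) (b t)) has_vector_derivative wedge (a s) (b' t)) (at t)" if "t \<in> J" for s t
    using wedge.has_vector_derivative[OF has_vector_derivative_const[of "a s"] curve_derivatives(4)[OF that]]
    by (simp add: wedge.zero_left)
  have w1: "((\<lambda>s. wedge (a s) v) has_vector_derivative wedge (a' s) v) (at s)" if "s \<in> I" for s v
    using wedge.has_vector_derivative[OF curve_derivatives(3)[OF that] has_vector_derivative_const[of v]]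
    by (simp add: wedge.zero_right)
  have q: "((\<lambda>r. - 1 / f r) has_real_derivative D / (f r)\<^sup>2) (at r)"
    if "(f has_real_derivative D) (at r)" "f r \<noteq> 0" for f D r
    using that by (auto intro!: derivative_eq_intros simp: power2_eq_square)
  have DG: "frechet_derivative ?G (at (s, t)) (0,1) = H s t" if st: "s \<in> I" "t \<in> J" for s t
  proof (rule frechet_derivative_slice(2))
    have z: "(s, t) \<in> I \<times> J" using st by simp
    show "?G differentiable at (s, t)" by (rule smooth_on_differentiable[OF gauss_map_smooth z])
    have "\<mu> s t \<noteq> 0" using \<mu>_neg[OF st] by simp
    then have "((\<lambda>t. \<nu> s t) has_vector_derivative H s t) (at t)"
      unfolding \<nu>_def H_def by (intro has_vector_derivative_scaleR q d2 w2 st)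
    then show "((\<lambda>t. ?G (s, t)) has_vector_derivative H s t) (at t)"
      by (rule has_vector_derivative_transform_within_open[OF _ open_IJ(2) st(2)]) (simp add: gauss_map_null[OF st(1)])
  qed
  let ?m1 = "mink (a' s) (b t)" and ?m2 = "mink (a s) (b' t)" and ?m12 = "mink (a' s) (b' t)" and ?m = "\<mu> s t"
  define R where "R = ((- 1 / ?m) *\<^sub>R wedge (a' s) (b' t) + (?m1 / ?m\<^sup>2) *\<^sub>R wedge (a s) (b' t)) +
      ((?m2 / ?m\<^sup>2) *\<^sub>R wedge (a' s) (b t) + ((?m12 * ?m\<^sup>2 - ?m2 * (2 * ?m * ?m1)) / (?m\<^sup>2 * ?m\<^sup>2)) *\<^sub>R wedge (a s) (b t))"
  have m: "?m \<noteq> 0" using \<mu>_neg[OF st] by simp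
  have "frechet_derivative (\<lambda>w. frechet_derivative ?G (at w) (0,1)) (at (s, t)) (1,0) = R"
  proof (rule frechet_derivative_slice(1))
    show "(\<lambda>w. frechet_derivative ?G (at w) (0,1)) differentiable at (s, t)"
      by (rule smooth_on_differentiable[OF smooth_on_frechet[OF gauss_map_smooth] z])
    have "((\<lambda>s. mink (a s) (b' t) / (\<mu> s t)\<^sup>2) has_real_derivative
        (?m12 * ?m\<^sup>2 - ?m2 * (2 * ?m * ?m1)) / (?m\<^sup>2 * ?m\<^sup>2)) (at s)"
      using m by (auto intro!: derivative_eq_intros d1 d1' st)
    then have "((\<lambda>s. H s t) has_vector_derivative R) (at s)"
      unfolding H_def R_def by (intro has_vector_derivative_add has_vector_derivative_scaleR q d1 w1 st m)
    then show "((\<lambda>s. frechet_derivative ?G (at (s, t)) (0,1)) has_vector_derivative R) (at s)"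
      by (rule has_vector_derivative_transform_within_open[OF _ open_IJ(1) st(1)]) (simp only: DG[OF _ st(2)])
  qed
  then have L: "laplacian M x Or (gauss_map M x Or) (\<phi> (s, t)) = (- 2 / ?m) *\<^sub>R R"
    using laplacian_null[OF gauss_map_smooth st] by simp
  have AB: "mink (A s t) (B s t) = ?m12 - ?m1 * ?m2 / ?m"
    using m acceleration[OF st]
    by (simp add: A_def B_def mink.diff_left mink.diff_right mink.scaleR_left mink.scaleR_right flip: \<mu>_def)
  have W: "wedge (A s t) (B s t) = 1 *\<^sub>R wedge (a' s) (b' t) + ((- (?m1 / ?m)) *\<^sub>R wedge (a s) (b' t) +
      ((- (?m2 / ?m)) *\<^sub>R wedge (a' s) (b t) + (?m1 * ?m2 / ?m\<^sup>2) *\<^sub>R wedge (a s) (b t)))"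
    by (simp add: A_def B_def wedge.diff_left wedge.diff_right wedge.scaleR_left wedge.scaleR_right
        scaleR_diff_right power2_eq_square mult.commute)
  \<comment> \<open>The four coefficients are rewritten one at a time, each with the common factor 2
    over the square of \<open>\<mu>\<close>.\<close>
  have "(- 2 / ?m) *\<^sub>R R = ((- 2 / ?m) * (- 1 / ?m)) *\<^sub>R wedge (a' s) (b' t) +
      (((- 2 / ?m) * (?m1 / ?m\<^sup>2)) *\<^sub>R wedge (a s) (b' t) +
      (((- 2 / ?m) * (?m2 / ?m\<^sup>2)) *\<^sub>R wedge (a' s) (b t) +
      ((- 2 / ?m) * ((?m12 * ?m\<^sup>2 - ?m2 * (2 * ?m * ?m1)) / (?m\<^sup>2 * ?m\<^sup>2))) *\<^sub>R wedge (a s) (b t)))"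
    unfolding R_def by (simp only: scaleR_add_right scaleR_scaleR add.assoc)
  also have "(- 2 / ?m) * (- 1 / ?m) = (2 / ?m\<^sup>2) * 1" by (simp add: power2_eq_square)
  also have "(- 2 / ?m) * (?m1 / ?m\<^sup>2) = (2 / ?m\<^sup>2) * (- (?m1 / ?m))" by simp
  also have "(- 2 / ?m) * (?m2 / ?m\<^sup>2) = (2 / ?m\<^sup>2) * (- (?m2 / ?m))" by simp
  also have "(- 2 / ?m) * ((?m12 * ?m\<^sup>2 - ?m2 * (2 * ?m * ?m1)) / (?m\<^sup>2 * ?m\<^sup>2)) =
      (2 / ?m\<^sup>2) * (mink (A s t) (B s t) * (- 1 / ?m)) + (2 / ?m\<^sup>2) * (?m1 * ?m2 / ?m\<^sup>2)"
    unfolding AB using m by (simp add: field_simps power2_eq_square)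
  also have "((2 / ?m\<^sup>2) * 1) *\<^sub>R wedge (a' s) (b' t) + (((2 / ?m\<^sup>2) * (- (?m1 / ?m))) *\<^sub>R wedge (a s) (b' t) +
      (((2 / ?m\<^sup>2) * (- (?m2 / ?m))) *\<^sub>R wedge (a' s) (b t) +
      ((2 / ?m\<^sup>2) * (mink (A s t) (B s t) * (- 1 / ?m)) + (2 / ?m\<^sup>2) * (?m1 * ?m2 / ?m\<^sup>2)) *\<^sub>R wedge (a s) (b t))) =
      (2 / ?m\<^sup>2) *\<^sub>R (mink (A s t) (B s t) *\<^sub>R \<nu> s t + wedge (A s t) (B s t))"
    unfolding W \<nu>_def by (simp only: scaleR_add_right scaleR_scaleR scaleR_add_left ac_simps)
  finally show ?thesis using L by simp
qed

end

section \<open>The normal curvature\<close>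

context null_coordinates
begin

lemma frechet_derivative_pair:
  fixes G :: "real \<times> real \<Rightarrow> 'b::real_normed_vector"
  assumes "G differentiable (at z)"
  shows "frechet_derivative G (at z) (p, q) =
    p *\<^sub>R frechet_derivative G (at z) (1,0) + q *\<^sub>R frechet_derivative G (at z) (0,1)"
  by (rule range_linear_plane(1)[OF linear_frechet_derivative[OF assms]])

lemma tangent_coefficients:
  assumes S: "open S" "S \<subseteq> I \<times> J" and X: "smooth_on S (X \<circ> \<phi>)" "\<And>w. w \<in> S \<Longrightarrow> X (\<phi> w) \<in> tangent_space M x (\<phi> w)"
  obtains c d where "smooth_on S c" "smooth_on S d"
    "\<And>w. w \<in> S \<Longrightarrow> X (\<phi> w) = c w *\<^sub>R a (fst w) + d w *\<^sub>R b (snd w)"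
proof -
  have nz: "\<mu> (fst w) (snd w) \<noteq> 0" if "w \<in> S" for w
    using \<mu>_neg[of "fst w" "snd w"] S that by auto
  note sf = smooth_fields[THEN smooth_on_subset, OF S(2)]
  have "smooth_on S (\<lambda>w. mink ((X \<circ> \<phi>) w) (b (snd w)) / \<mu> (fst w) (snd w))"
    "smooth_on S (\<lambda>w. mink ((X \<circ> \<phi>) w) (a (fst w)) / \<mu> (fst w) (snd w))"
    by (intro smooth_on_divide smooth_on_mink X(1) sf S(1) nz; assumption)+
  moreover have "X (\<phi> w) = (mink ((X \<circ> \<phi>) w) (b (snd w)) / \<mu> (fst w) (snd w)) *\<^sub>R a (fst w) +
      (mink ((X \<circ> \<phi>) w) (a (fst w)) / \<mu> (fst w) (snd w)) *\<^sub>R b (snd w)" if w: "w \<in> S" for w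
  proof -
    have st: "fst w \<in> I" "snd w \<in> J" using S w by auto
    have "X (\<phi> w) \<in> span {a (fst w), b (snd w)}"
      using X(2)[OF w] tangent_span[OF st] by simp
    from span_null_pair[OF pointwise(2)[OF st] this] show ?thesis unfolding \<mu>_def comp_apply .
  qed
  ultimately show ?thesis by (rule that)
qed

text \<open>This is the Ricci equation, for arbitrary fields as flatness quantifies over all of
  them. The normal derivatives of \<open>\<xi>\<close> along \<open>a\<close> and \<open>b\<close>
  are written as explicit fields \<open>P\<close> and \<open>Q\<close>; in the commutator the second
  derivatives of \<open>\<xi>\<close> cancel and only the accelerations entering through
  \<open>P\<close> and \<open>Q\<close> survive.\<close>

lemma normal_curvature_null:
  assumes V: "openin (top_of_set M) V" and X: "tangent_field M x V X" and Y: "tangent_field M x V Y"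
    and \<xi>: "normal_field M x V \<xi>" and st: "s \<in> I" "t \<in> J" "\<phi> (s, t) \<in> V"
  shows "\<exists>c d c' d'. X (\<phi> (s, t)) = c *\<^sub>R a s + d *\<^sub>R b t \<and> Y (\<phi> (s, t)) = c' *\<^sub>R a s + d' *\<^sub>R b t \<and>
    normal_curvature M x X Y \<xi> (\<phi> (s, t)) = ((c * d' - d * c') / \<mu> s t) *\<^sub>R
      (mink (\<xi> (\<phi> (s, t))) (B s t) *\<^sub>R A s t - mink (\<xi> (\<phi> (s, t))) (A s t) *\<^sub>R B s t)"
proof -
  define S where "S = {w \<in> I \<times> J. \<phi> w \<in> V}"
  let ?z = "(s, t)" and ?\<Xi> = "\<xi> \<circ> \<phi>" and ?n = "\<lambda>w. a (fst w)" and ?m = "\<lambda>w. b (snd w)"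
    and ?N = "normal_part M x (\<phi> (s, t))"
  let ?D = "\<lambda>w. frechet_derivative ?\<Xi> (at w)"
  have S: "open S" "S \<subseteq> I \<times> J" "?z \<in> S"
    unfolding S_def using chart_preimage_open[OF par V] st by auto
  have S': "fst w \<in> I" "snd w \<in> J" if "w \<in> S" for w using S(2) that by auto
  have s\<Xi>: "smooth_on S ?\<Xi>"
    using smooth_map_onD[OF _ V par] \<xi> unfolding S_def normal_field_def by blast
  note diff\<Xi> = smooth_on_differentiable[OF s\<Xi>]
  have sXY: "smooth_on S (X \<circ> \<phi>)" "smooth_on S (Y \<circ> \<phi>)"
    using smooth_map_onD[OF _ V par] X Y unfolding S_def tangent_field_def by blast+
  have tXY: "X (\<phi> w) \<in> tangent_space M x (\<phi> w)" "Y (\<phi> w) \<in> tangent_space M x (\<phi> w)" if "w \<in> S" for w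
    using X Y that unfolding S_def tangent_field_def by blast+
  obtain c d where cd: "smooth_on S c" "smooth_on S d" "\<forall>w\<in>S. X (\<phi> w) = c w *\<^sub>R ?n w + d w *\<^sub>R ?m w"
    using tangent_coefficients[OF S(1,2) sXY(1) tXY(1)] by metis
  obtain c' d' where cd': "smooth_on S c'" "smooth_on S d'" "\<forall>w\<in>S. Y (\<phi> w) = c' w *\<^sub>R ?n w + d' w *\<^sub>R ?m w"
    using tangent_coefficients[OF S(1,2) sXY(2) tXY(2)] by metis
  note sf = smooth_fields[THEN smooth_on_subset, OF S(2)]
  have nz: "\<mu> (fst w) (snd w) \<noteq> 0" if "w \<in> S" for w using \<mu>_neg[OF S'[OF that]] by simp
  have orth: "mink (?\<Xi> w) (?n w) = 0" "mink (?\<Xi> w) (?m w) = 0" if w: "w \<in> S" for w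
  proof -
    have "\<xi> (\<phi> w) \<in> normal_space M x (\<phi> w)" using \<xi> w unfolding S_def normal_field_def by blast
    then show "mink (?\<Xi> w) (?n w) = 0" "mink (?\<Xi> w) (?m w) = 0"
      using tangent_part_null_pair(2)[OF pointwise(2)[OF S'[OF w]] tangent_span[OF S'[OF w]]]
      by (simp_all add: mink_commute[of "\<xi> (\<phi> w)"])
  qed
  have dfield: "frechet_derivative ?n (at w) e = fst e *\<^sub>R a' (fst w)" "frechet_derivative ?m (at w) e = snd e *\<^sub>R b' (snd w)"
    if "w \<in> S" for w e using field_derivatives[OF S'[OF that]] by simp_all
  \<comment> \<open>The product rule applied to the vanishing products of \<open>\<xi>\<close> with
    \<open>a\<close> and \<open>b\<close>, each of which moves with one coordinate only.\<close>
  have dorth: "mink (?D w e) (?n w) = - fst e * mink (?\<Xi> w) (a' (fst w))"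
    "mink (?D w e) (?m w) = - snd e * mink (?\<Xi> w) (b' (snd w))" if w: "w \<in> S" for w e
  proof -
    have zero: "frechet_derivative (\<lambda>w. mink (?\<Xi> w) (F w)) (at w) e = 0"
      if "\<And>w. w \<in> S \<Longrightarrow> mink (?\<Xi> w) (F w) = 0" for F
    proof -
      have "((\<lambda>w. mink (?\<Xi> w) (F w)) has_derivative (\<lambda>e. 0)) (at w)"
        by (rule has_derivative_transform_within_open[OF has_derivative_const S(1) w]) (simp only: that)
      from frechet_derivative_eqI[OF this] show ?thesis by simp
    qed
    show "mink (?D w e) (?n w) = - fst e * mink (?\<Xi> w) (a' (fst w))"
      using trans[OF zero[OF orth(1), symmetric]
          frechet_derivative_bilinear[OF bounded_bilinear_mink diff\<Xi>[OF w] smooth_on_differentiable[OF sf(1) w], of e]]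
      unfolding dfield[OF w] mink.scaleR_right by simp
    show "mink (?D w e) (?m w) = - snd e * mink (?\<Xi> w) (b' (snd w))"
      using trans[OF zero[OF orth(2), symmetric]
          frechet_derivative_bilinear[OF bounded_bilinear_mink diff\<Xi>[OF w] smooth_on_differentiable[OF sf(2) w], of e]]
      unfolding dfield[OF w] mink.scaleR_right by simp
  qed
  \<comment> \<open>Up to sign, \<open>f\<close> and \<open>g\<close> are the tangential
    coefficients of the two derivatives of \<open>\<xi>\<close>; adding the corresponding multiples
    of \<open>b\<close> and \<open>a\<close> leaves the normal parts \<open>P\<close> and
    \<open>Q\<close>.\<close>
  define f where "f w = mink (?\<Xi> w) (a' (fst w)) / \<mu> (fst w) (snd w)" for w
  define g where "g w = mink (?\<Xi> w) (b' (snd w)) / \<mu> (fst w) (snd w)" for w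
  define P where "P w = ?D w (1,0) + f w *\<^sub>R ?m w" for w
  define Q where "Q w = ?D w (0,1) + g w *\<^sub>R ?n w" for w
  have sfg: "smooth_on S f" "smooth_on S g"
    unfolding f_def g_def by (intro smooth_on_divide smooth_on_mink s\<Xi> sf S(1) nz; assumption)+
  have sD: "smooth_on S (\<lambda>w. ?D w e)" for e by (rule smooth_on_frechet[OF s\<Xi>])
  have sPQ: "smooth_on S P" "smooth_on S Q"
    unfolding P_def Q_def by (intro smooth_on_add smooth_on_scaleR sD sfg sf S(1))+
  note lin = normal_part_null_pair(1)[OF pointwise(2) tangent_span]
  have tan0: "normal_part M x (\<phi> (s, t)) (a s) = 0" "normal_part M x (\<phi> (s, t)) (b t) = 0" if "s \<in> I" "t \<in> J" for s t
    unfolding normal_part_null_pair(2)[OF pointwise(2)[OF that] tangent_span[OF that]] tangent_span[OF that]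
    by (simp_all add: span_base)
  have NPQ: "normal_part M x (\<phi> w) (?D w (1,0)) = P w" "normal_part M x (\<phi> w) (?D w (0,1)) = Q w" if w: "w \<in> S" for w
  proof -
    have sp: "tangent_space M x (\<phi> w) = span {a (fst w), b (snd w)}" using tangent_span[OF S'[OF w]] by simp
    show "normal_part M x (\<phi> w) (?D w (1,0)) = P w" "normal_part M x (\<phi> w) (?D w (0,1)) = Q w"
      unfolding normal_part_def tangent_part_null_pair(1)[OF pointwise(2)[OF S'[OF w]] sp] dorth[OF w] P_def Q_def f_def g_def \<mu>_def
      by simp_all
  qed
  have nc: "normal_part M x (\<phi> w) (deriv_along M x \<xi> (\<phi> w) (p *\<^sub>R ?n w + q *\<^sub>R ?m w)) = p *\<^sub>R P w + q *\<^sub>R Q w"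
    if w: "w \<in> S" for w p q
  proof -
    have "deriv_along M x \<xi> (\<phi> w) (p *\<^sub>R ?n w + q *\<^sub>R ?m w) = p *\<^sub>R ?D w (1,0) + q *\<^sub>R ?D w (0,1)"
      using deriv_along_null[OF S'[OF w], of \<xi> p q] frechet_derivative_pair[OF diff\<Xi>[OF w], of p q] diff\<Xi>[OF w]
      by (simp del: comp_apply)
    moreover have "linear (normal_part M x (\<phi> w))" using lin[OF S'[OF w] S'[OF w]] by simp
    ultimately show ?thesis by (simp add: linear_add linear_cmul NPQ[OF w] del: comp_apply)
  qed
  have idem: "?N (P ?z) = P ?z" "?N (Q ?z) = Q ?z"
  proof -
    have "mink (a s) (?N v) = 0" "mink (b t) (?N v) = 0" for v
      using normal_part_null_pair(3,4)[OF pointwise(2)[OF st(1,2)] tangent_span[OF st(1,2)]] by blast+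
    then have "?N (?N v) = ?N v" for v
      by (intro normal_part_null_pair(5)[OF pointwise(2)[OF st(1,2)] tangent_span[OF st(1,2)]])
    then show "?N (P ?z) = P ?z" "?N (Q ?z) = Q ?z" using NPQ[OF S(3)] by metis+
  qed
  note linN = lin[OF st(1,2) st(1,2)]
  \<comment> \<open>The product rule for a combination of two fields. It is used with
    \<open>a\<close>, \<open>b\<close> for the bracket and with \<open>P\<close>, \<open>Q\<close>
    for the iterated normal derivatives.\<close>
  have along: "deriv_along M x k (\<phi> ?z) (p *\<^sub>R a s + q *\<^sub>R b t) =
      (u ?z *\<^sub>R (p *\<^sub>R frechet_derivative F (at ?z) (1,0) + q *\<^sub>R frechet_derivative F (at ?z) (0,1)) +
        frechet_derivative u (at ?z) (p, q) *\<^sub>R F ?z) +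
      (v ?z *\<^sub>R (p *\<^sub>R frechet_derivative G (at ?z) (1,0) + q *\<^sub>R frechet_derivative G (at ?z) (0,1)) +
        frechet_derivative v (at ?z) (p, q) *\<^sub>R G ?z)"
    if uv: "smooth_on S u" "smooth_on S v" and FG: "smooth_on S F" "smooth_on S G"
      and k: "\<forall>w\<in>S. k (\<phi> w) = u w *\<^sub>R F w + v w *\<^sub>R G w"
    for u v :: "real \<times> real \<Rightarrow> real" and F G :: "real \<times> real \<Rightarrow> real^4" and k p q
  proof -
    note du = smooth_on_differentiable[OF uv(1) S(3)] and dv = smooth_on_differentiable[OF uv(2) S(3)]
      and dF = smooth_on_differentiable[OF FG(1) S(3)] and dG = smooth_on_differentiable[OF FG(2) S(3)]
    have suF: "smooth_on S (\<lambda>w. u w *\<^sub>R F w)" "smooth_on S (\<lambda>w. v w *\<^sub>R G w)"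
      by (intro smooth_on_scaleR uv FG S(1))+
    have s: "smooth_on S (\<lambda>w. u w *\<^sub>R F w + v w *\<^sub>R G w)" by (intro smooth_on_add suF S(1))
    have "smooth_on S (k \<circ> \<phi>)" by (rule smooth_on_cong[OF s S(1)]) (simp add: k)
    then have "deriv_along M x k (\<phi> ?z) (p *\<^sub>R a s + q *\<^sub>R b t) = frechet_derivative (k \<circ> \<phi>) (at ?z) (p, q)"
      using smooth_on_differentiable S(3) by (intro deriv_along_null[OF st(1,2)]) blast
    also have "frechet_derivative (k \<circ> \<phi>) (at ?z) = frechet_derivative (\<lambda>w. u w *\<^sub>R F w + v w *\<^sub>R G w) (at ?z)"
      by (rule frechet_derivative_transform_within_open[OF smooth_on_differentiable[OF s S(3)] S(1,3), symmetric])
         (simp add: k)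
    finally show ?thesis
      unfolding frechet_derivative_plus[OF smooth_on_differentiable[OF suF(1) S(3)] smooth_on_differentiable[OF suF(2) S(3)]]
        frechet_derivative_bilinear[OF bounded_bilinear_scaleR du dF] frechet_derivative_bilinear[OF bounded_bilinear_scaleR dv dG]
        frechet_derivative_pair[OF dF, of p q] frechet_derivative_pair[OF dG, of p q] .
  qed
  let ?Dc = "frechet_derivative c (at ?z) (c' ?z, d' ?z)" and ?Dd = "frechet_derivative d (at ?z) (c' ?z, d' ?z)"
    and ?Dc' = "frechet_derivative c' (at ?z) (c ?z, d ?z)" and ?Dd' = "frechet_derivative d' (at ?z) (c ?z, d ?z)"
  let ?Ps = "frechet_derivative P (at ?z) (1,0)" and ?Pt = "frechet_derivative P (at ?z) (0,1)"
    and ?Qs = "frechet_derivative Q (at ?z) (1,0)" and ?Qt = "frechet_derivative Q (at ?z) (0,1)"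
  have Xz: "X (\<phi> ?z) = c ?z *\<^sub>R a s + d ?z *\<^sub>R b t" and Yz: "Y (\<phi> ?z) = c' ?z *\<^sub>R a s + d' ?z *\<^sub>R b t"
    using bspec[OF cd(3) S(3)] bspec[OF cd'(3) S(3)] by simp_all
  have second: "normal_connection M x Z (normal_connection M x W \<xi>) (\<phi> ?z) =
      (v1 ?z *\<^sub>R (p *\<^sub>R ?N ?Ps + q *\<^sub>R ?N ?Pt) + frechet_derivative v1 (at ?z) (p, q) *\<^sub>R P ?z) +
      (v2 ?z *\<^sub>R (p *\<^sub>R ?N ?Qs + q *\<^sub>R ?N ?Qt) + frechet_derivative v2 (at ?z) (p, q) *\<^sub>R Q ?z)"
    if "Z (\<phi> ?z) = p *\<^sub>R a s + q *\<^sub>R b t" and v: "smooth_on S v1" "smooth_on S v2"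
      "\<forall>w\<in>S. W (\<phi> w) = v1 w *\<^sub>R ?n w + v2 w *\<^sub>R ?m w" for Z W p q v1 v2
  proof -
    have "\<forall>w\<in>S. normal_connection M x W \<xi> (\<phi> w) = v1 w *\<^sub>R P w + v2 w *\<^sub>R Q w"
    proof
      fix w assume w: "w \<in> S"
      show "normal_connection M x W \<xi> (\<phi> w) = v1 w *\<^sub>R P w + v2 w *\<^sub>R Q w"
        unfolding normal_connection_def bspec[OF v(3) w] by (rule nc[OF w])
    qed
    note al = along[of v1 v2 P Q "normal_connection M x W \<xi>", OF v(1,2) sPQ this]
    show ?thesis
      unfolding normal_connection_def[of M x Z] that(1) al linear_add[OF linN] linear_cmul[OF linN] idem ..
  qed
  have br: "bracket M x X Y (\<phi> ?z) = (?Dc' - ?Dc) *\<^sub>R a s + (?Dd' - ?Dd) *\<^sub>R b t"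
    unfolding bracket_def Xz Yz along[of c d ?n ?m X, OF cd(1,2) sf(1,2) cd(3)] along[of c' d' ?n ?m Y, OF cd'(1,2) sf(1,2) cd'(3)] dfield[OF S(3)]
    by (simp add: algebra_simps)
  have third: "normal_connection M x (bracket M x X Y) \<xi> (\<phi> ?z) = (?Dc' - ?Dc) *\<^sub>R P ?z + (?Dd' - ?Dd) *\<^sub>R Q ?z"
    unfolding normal_connection_def br using nc[OF S(3)] by simp
  have "?N ?Qs - ?N ?Pt = (1 / \<mu> s t) *\<^sub>R (mink (?\<Xi> ?z) (B s t) *\<^sub>R A s t - mink (?\<Xi> ?z) (A s t) *\<^sub>R B s t)"
  proof -
    note df = smooth_on_differentiable[OF sfg(1) S(3)] and dg = smooth_on_differentiable[OF sfg(2) S(3)]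
      and dn = smooth_on_differentiable[OF sf(1) S(3)] and dm = smooth_on_differentiable[OF sf(2) S(3)]
    have sfm: "smooth_on S (\<lambda>w. f w *\<^sub>R ?m w)" "smooth_on S (\<lambda>w. g w *\<^sub>R ?n w)"
      by (intro smooth_on_scaleR sfg sf S(1))+
    have Qs: "?Qs = frechet_derivative (\<lambda>w. ?D w (0,1)) (at ?z) (1,0) + (g ?z *\<^sub>R a' s + frechet_derivative g (at ?z) (1,0) *\<^sub>R a s)"
      and Pt: "?Pt = frechet_derivative (\<lambda>w. ?D w (1,0)) (at ?z) (0,1) + (f ?z *\<^sub>R b' t + frechet_derivative f (at ?z) (0,1) *\<^sub>R b t)"
      unfolding P_def[abs_def] Q_def[abs_def]
        frechet_derivative_plus[OF smooth_on_differentiable[OF sD S(3)] smooth_on_differentiable[OF sfm(1) S(3)]]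
        frechet_derivative_plus[OF smooth_on_differentiable[OF sD S(3)] smooth_on_differentiable[OF sfm(2) S(3)]]
        frechet_derivative_bilinear[OF bounded_bilinear_scaleR df dm] frechet_derivative_bilinear[OF bounded_bilinear_scaleR dg dn]
        dfield[OF S(3)] by simp_all
    have sym: "frechet_derivative (\<lambda>w. ?D w (0,1)) (at ?z) (1,0) = frechet_derivative (\<lambda>w. ?D w (1,0)) (at ?z) (0,1)"
      by (rule second_derivative_symmetric[OF S(1) s\<Xi> S(3)])
    have "mink (?\<Xi> ?z) (a' s) = mink (?\<Xi> ?z) (A s t)" "mink (?\<Xi> ?z) (b' t) = mink (?\<Xi> ?z) (B s t)"
      using orth[OF S(3)] by (simp_all add: A_def B_def mink.diff_right mink.scaleR_right)
    then have "f ?z = mink (?\<Xi> ?z) (A s t) / \<mu> s t" "g ?z = mink (?\<Xi> ?z) (B s t) / \<mu> s t"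
      unfolding f_def g_def by simp_all
    then show ?thesis
      unfolding Qs Pt sym linear_add[OF linN] linear_cmul[OF linN] tan0[OF st(1,2)] normal_part_acceleration[OF st(1,2)]
      by (simp add: scaleR_diff_right)
  qed
  \<comment> \<open>The derivatives of the coefficients of \<open>X\<close> and \<open>Y\<close>
    cancel against the bracket term, and the pure second derivatives cancel by symmetry.\<close>
  moreover have "normal_curvature M x X Y \<xi> (\<phi> ?z) = (c ?z * d' ?z - d ?z * c' ?z) *\<^sub>R (?N ?Qs - ?N ?Pt)"
    unfolding normal_curvature_def third second[of X _ _ c' d' Y, OF Xz cd'] second[of Y _ _ c d X, OF Yz cd]
    by (simp add: algebra_simps)
  ultimately have "normal_curvature M x X Y \<xi> (\<phi> ?z) = ((c ?z * d' ?z - d ?z * c' ?z) / \<mu> s t) *\<^sub>R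
      (mink (?\<Xi> ?z) (B s t) *\<^sub>R A s t - mink (?\<Xi> ?z) (A s t) *\<^sub>R B s t)" by simp
  with Xz Yz show ?thesis unfolding comp_apply by (intro exI conjI)
qed

text \<open>The hypothesis makes \<open>B\<close> a multiple of \<open>A\<close>, because the normal
  plane is positive definite and so \<open>mink (A s t) (A s t)\<close> is nonzero unless
  \<open>A s t\<close> is zero.\<close>

lemma wedge_AB_zeroI:
  assumes st: "s \<in> I" "t \<in> J" and eq: "mink (A s t) (B s t) *\<^sub>R A s t = mink (A s t) (A s t) *\<^sub>R B s t"
  shows "wedge (A s t) (B s t) = 0"
proof (cases "A s t = 0")
  case False
  have "mink (A s t) (A s t) *\<^sub>R wedge (A s t) (B s t) = wedge (A s t) (mink (A s t) (B s t) *\<^sub>R A s t)"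
    unfolding eq by (simp add: wedge.scaleR_right)
  also have "\<dots> = 0" by (simp add: wedge.scaleR_right)
  finally show ?thesis
    using mink_normal_pos[OF pointwise(2)[OF st] AB_normal(1,2)[OF st] False] by simp
qed (simp add: wedge.zero_left)

text \<open>Inserting \<open>a\<close>, \<open>b\<close> and a normal field with value
  \<open>A s t\<close> into the curvature formula gives the relation required by
  \<open>wedge_AB_zeroI\<close>.\<close>

lemma flat_normal_bundle_wedge:
  assumes flat: "flat_normal_bundle M x" and st: "s \<in> I" "t \<in> J"
  shows "wedge (A s t) (B s t) = 0"
proof -
  let ?V = "\<phi> ` (I \<times> J)"
  define \<zeta> where "\<zeta> = A s t"
  \<comment> \<open>The normal projection of a constant vector: a smooth normal field, which at
    \<open>(s, t)\<close> returns the vector itself as that is already normal there.\<close>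
  define E where "E z = \<zeta> - ((mink \<zeta> (b (snd z)) / \<mu> (fst z) (snd z)) *\<^sub>R a (fst z) +
      (mink \<zeta> (a (fst z)) / \<mu> (fst z) (snd z)) *\<^sub>R b (snd z))" for z
  have z: "(s, t) \<in> I \<times> J" using st by simp
  have V: "openin (top_of_set M) ?V" by (rule local_paramD(2)[OF par])
  have nz: "\<mu> (fst z) (snd z) \<noteq> 0" if "z \<in> I \<times> J" for z using \<mu>_neg[of "fst z" "snd z"] that by auto
  have sE: "smooth_on (I \<times> J) E"
    unfolding E_def
    by (intro smooth_on_diff smooth_on_add smooth_on_scaleR smooth_on_divide smooth_on_mink smooth_on_const
        smooth_fields open_IJ nz; assumption)
  have X: "tangent_field M x ?V (lift (\<lambda>z. a (fst z)))"
    by (rule lift_tangent_field[OF smooth_fields(1)]) (auto simp: tangent_span span_base)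
  have Y: "tangent_field M x ?V (lift (\<lambda>z. b (snd z)))"
    by (rule lift_tangent_field[OF smooth_fields(2)]) (auto simp: tangent_span span_base)
  have \<xi>: "normal_field M x ?V (lift E)"
    unfolding normal_field_def
  proof (intro conjI ballI lift_smooth(2)[OF sE])
    fix p assume "p \<in> ?V"
    then obtain s t where st: "s \<in> I" "t \<in> J" "p = \<phi> (s, t)" by auto
    have "E (s, t) = normal_part M x p \<zeta>"
      unfolding st(3) normal_part_def tangent_part_null_pair(1)[OF pointwise(2)[OF st(1,2)] tangent_span[OF st(1,2)]]
      by (simp add: E_def \<mu>_def)
    moreover have "lift E p = E (s, t)" unfolding st(3) by (rule lift_eq) (use st in simp)
    ultimately show "lift E p \<in> normal_space M x p"
      using normal_part_null_pair(3,4)[OF pointwise(2)[OF st(1,2)] tangent_span[OF st(1,2)]]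
      unfolding st(3) tangent_part_null_pair(2)[OF pointwise(2)[OF st(1,2)] tangent_span[OF st(1,2)]] by simp
  qed
  have Ez: "lift E (\<phi> (s, t)) = A s t"
    using AB_normal(1,2)[OF st] unfolding lift_eq[OF z] E_def \<zeta>_def by (simp add: mink_commute)
  have "normal_curvature M x (lift (\<lambda>z. a (fst z))) (lift (\<lambda>z. b (snd z))) (lift E) (\<phi> (s, t)) = 0"
    by (rule flat[unfolded flat_normal_bundle_def, rule_format, OF conjI[OF V conjI[OF X conjI[OF Y \<xi>]]] imageI[OF z]])
  moreover obtain c d c' d' where k: "lift (\<lambda>z. a (fst z)) (\<phi> (s, t)) = c *\<^sub>R a s + d *\<^sub>R b t"
    "lift (\<lambda>z. b (snd z)) (\<phi> (s, t)) = c' *\<^sub>R a s + d' *\<^sub>R b t"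
    "normal_curvature M x (lift (\<lambda>z. a (fst z))) (lift (\<lambda>z. b (snd z))) (lift E) (\<phi> (s, t)) =
      ((c * d' - d * c') / \<mu> s t) *\<^sub>R (mink (A s t) (B s t) *\<^sub>R A s t - mink (A s t) (A s t) *\<^sub>R B s t)"
    using normal_curvature_null[OF V X Y \<xi> st imageI[OF z]] unfolding Ez by (elim exE conjE)
  moreover have "c = 1" "d = 0" "c' = 0" "d' = 1"
    using k(1,2) null_pair_coords[OF pointwise(2)[OF st], of 1 0 c d] null_pair_coords[OF pointwise(2)[OF st], of 0 1 c' d']
    unfolding lift_eq[OF z] by auto
  ultimately have "mink (A s t) (B s t) *\<^sub>R A s t = mink (A s t) (A s t) *\<^sub>R B s t"
    using \<mu>_neg[OF st] by simp
  then show ?thesis by (rule wedge_AB_zeroI[OF st])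
qed

lemma normal_curvature_zero:
  assumes "openin (top_of_set M) V" "tangent_field M x V X" "tangent_field M x V Y" "normal_field M x V \<xi>"
    and st: "s \<in> I" "t \<in> J" "\<phi> (s, t) \<in> V" and "a' s = 0 \<or> b' t = 0"
  shows "normal_curvature M x X Y \<xi> (\<phi> (s, t)) = 0"
proof -
  have "A s t = 0 \<or> B s t = 0" using AB_zero[OF st(1,2)] assms(8) by simp
  then have "mink (\<xi> (\<phi> (s, t))) (B s t) *\<^sub>R A s t - mink (\<xi> (\<phi> (s, t))) (A s t) *\<^sub>R B s t = 0"
    by (auto simp: mink.zero_right)
  then show ?thesis using normal_curvature_null[OF assms(1-4) st] by auto
qed

end

section \<open>Surfaces with pointwise 1-type Gauss map\<close>

text \<open>A bivector acts on space-time as the endomorphism that the metric associates with it.\<close>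

definition act :: "real^4^4 \<Rightarrow> real^4 \<Rightarrow> real^4" where
  "act C u = C *v (\<chi> i. if i = 1 then - u$i else u$i)"

lemma bounded_bilinear_act: "bounded_bilinear act"
proof -
  have "bilinear act"
    unfolding bilinear_def
    by (auto intro!: linearI simp: act_def matrix_vector_mult_def vec_eq_iff sum_4 algebra_simps)
  then show ?thesis by (simp add: bilinear_conv_bounded_bilinear)
qed

interpretation act: bounded_bilinear act
  by (rule bounded_bilinear_act)

lemma act_wedge: "act (wedge v w) u = mink w u *\<^sub>R v - mink v u *\<^sub>R w"
  by (simp add: act_def wedge_def matrix_vector_mult_def vec_eq_iff sum_4 mink_def algebra_simps)

lemma act_skew:
  assumes "C \<in> bivectors"
  shows "mink (act C u) v = - mink u (act C v)"
proof -
  have sk: "C$i$j = - C$j$i" for i j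
  proof -
    have "transpose C $ j $ i = (- C) $ j $ i" using assms by (simp add: bivectors_def)
    then show ?thesis by (simp add: transpose_def)
  qed
  have "C$1$1 = 0" "C$2$2 = 0" "C$3$3 = 0" "C$4$4 = 0"
    using sk[of 1 1] sk[of 2 2] sk[of 3 3] sk[of 4 4] by simp_all
  then show ?thesis
    by (simp add: act_def mink_def matrix_vector_mult_def sum_4 sk[of 2 1] sk[of 3 1] sk[of 4 1] sk[of 3 2] sk[of 4 2] sk[of 4 3]
        algebra_simps)
qed

lemma wedge_zero_parallel:
  assumes "wedge v w = 0" "v \<noteq> 0"
  shows "\<exists>c. w = c *\<^sub>R v"
proof -
  obtain j where j: "v$j \<noteq> 0" using assms(2) by (auto simp: vec_eq_iff)
  have "v$i * w$j = v$j * w$i" for i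
  proof -
    have "wedge v w $ i $ j = 0" using assms(1) by simp
    then show ?thesis by (simp add: wedge_def)
  qed
  then have "w = (w$j / v$j) *\<^sub>R v"
    using j by (simp add: vec_eq_iff nonzero_eq_divide_eq mult.commute)
  then show ?thesis by blast
qed

context null_coordinates
begin

text \<open>Applied to \<open>a\<close> and \<open>b\<close>, these relations remove the wedge term
  from the equation for the Laplacian and leave scalars, so that \<open>a\<close> and
  \<open>b\<close> become eigenvectors of the constant bivector.\<close>

lemma act_normal:
  assumes st: "s \<in> I" "t \<in> J"
  shows "act (\<nu> s t) (a s) = - a s" "act (\<nu> s t) (b t) = b t" "act (\<nu> s t) (A s t) = 0"
    "act (wedge (A s t) (B s t)) (a s) = 0" "act (wedge (A s t) (B s t)) (b t) = 0"
  using null_pairD[OF pointwise(2)[OF st]] AB_normal[OF st] \<mu>_neg[OF st]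
  unfolding \<nu>_def act.scaleR_left act_wedge
  by (simp_all add: mink_commute[of "A s t"] mink_commute[of "B s t"] flip: \<mu>_def)

end

text \<open>As \<open>n\<close> has time component 1, the eigenvalue is the time component of
  \<open>act C (n s)\<close> and hence differentiable. Differentiate the eigenvalue equation and
  pair it with \<open>n'\<close>: the left side vanishes by skewness, the term with
  \<open>n s\<close> by orthogonality, so the eigenvalue times the positive square of
  \<open>n'\<close> is zero.\<close>

lemma null_eigenvector_curve:
  fixes n :: "real \<Rightarrow> real^4"
  assumes I: "open I" "s \<in> I" and n: "\<And>s. s \<in> I \<Longrightarrow> n s $ 1 = 1" "(n has_vector_derivative n') (at s)"
    and eig: "\<And>s. s \<in> I \<Longrightarrow> \<exists>c. act C (n s) = c *\<^sub>R n s" and C: "C \<in> bivectors"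
    and n': "n' $ 1 = 0" "mink (n s) n' = 0" "n' \<noteq> 0"
  shows "act C (n s) = 0" "\<exists>c. act C n' = c *\<^sub>R n s"
proof -
  have norm: "act C (n r) = (act C (n r) $ 1) *\<^sub>R n r" if "r \<in> I" for r
  proof -
    obtain c where "act C (n r) = c *\<^sub>R n r" using eig[OF \<open>r \<in> I\<close>] by blast
    then show ?thesis using n(1)[OF \<open>r \<in> I\<close>] by simp
  qed
  have d: "((\<lambda>s. act C (n s)) has_vector_derivative act C n') (at s)"
    by (rule bounded_linear.has_vector_derivative[OF act.bounded_linear_right n(2)])
  have "((\<lambda>s. act C (n s) $ 1) has_real_derivative act C n' $ 1) (at s)"
    using bounded_linear.has_vector_derivative[OF bounded_linear_vec_nth d]
    by (simp add: has_real_derivative_iff_has_vector_derivative)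
  then have "((\<lambda>s. (act C (n s) $ 1) *\<^sub>R n s) has_vector_derivative
      (act C (n s) $ 1) *\<^sub>R n' + (act C n' $ 1) *\<^sub>R n s) (at s)"
    using n(2) by (rule has_vector_derivative_scaleR)
  then have "((\<lambda>s. act C (n s)) has_vector_derivative (act C (n s) $ 1) *\<^sub>R n' + (act C n' $ 1) *\<^sub>R n s) (at s)"
    by (rule has_vector_derivative_transform_within_open[OF _ I]) (rule norm[symmetric])
  then have eq: "act C n' = (act C (n s) $ 1) *\<^sub>R n' + (act C n' $ 1) *\<^sub>R n s"
    by (rule vector_derivative_unique_at[OF d])
  have "mink (act C n') n' = 0" using act_skew[OF C, of n' n'] by (simp add: mink_commute)
  then have "(act C (n s) $ 1) * mink n' n' = 0"
    by (subst (asm) eq) (simp add: mink.add_left mink.scaleR_left n'(2))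
  moreover have "mink n' n' > 0" by (rule mink_pos_if_time_zero[OF n'(1,3)])
  ultimately have "act C (n s) $ 1 = 0" by simp
  then show "act C (n s) = 0" "\<exists>c. act C n' = c *\<^sub>R n s"
    using norm[OF I(2)] eq by (simp, metis add_0 scaleR_zero_left)
qed

text \<open>Both \<open>\<langle>n, c\<rangle>\<close> and \<open>\<langle>c, w\<rangle>\<close> solve the same linear differential equation, so their quotient is
  constant.\<close>

lemma orthogonal_curve:
  assumes "is_interval I" "s0 \<in> I" "s \<in> I" and c: "\<And>s. s \<in> I \<Longrightarrow> (c has_vector_derivative c' s) (at s)"
    and nz: "\<And>s. s \<in> I \<Longrightarrow> mink (c s) w \<noteq> 0" and "mink n (c s0) = 0"
    and ode: "\<And>s. s \<in> I \<Longrightarrow> mink n (c' s) = mink (c' s) w / mink (c s) w * mink n (c s)"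
  shows "mink n (c s) = 0"
proof -
  let ?q = "\<lambda>s. mink n (c s) / mink (c s) w"
  have "(?q has_vector_derivative 0) (at s)" if s: "s \<in> I" for s
  proof -
    have "((\<lambda>s. mink n (c s)) has_real_derivative mink n (c' s)) (at s)"
      "((\<lambda>s. mink (c s) w) has_real_derivative mink (c' s) w) (at s)"
      using bounded_linear.has_vector_derivative[OF mink.bounded_linear_right c[OF s]]
        bounded_linear.has_vector_derivative[OF mink.bounded_linear_left c[OF s]]
      by (simp_all add: has_real_derivative_iff_has_vector_derivative)
    from DERIV_divide[OF this nz[OF s]] show ?thesis
      using nz[OF s] by (simp add: ode[OF s] has_real_derivative_iff_has_vector_derivative)
  qed
  then have "?q s = ?q s0" using vector_derivative_zero_constant[OF assms(1) _ assms(3,2)] by blast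
  then show ?thesis using assms(6) nz[OF assms(3)] by simp
qed

context null_coordinates
begin

text \<open>Where \<open>f\<close> vanishes, the equation itself kills the wedge product. Where it
  does not and neither acceleration is zero, the eigenvector relations show that \<open>C\<close>
  annihilates \<open>A s t\<close>, and the equation applied to \<open>A s t\<close> gives
  parallelism.\<close>

lemma pointwise_1_type_wedge:
  assumes "pointwise_1_type_gauss_map M x Or" and st: "s \<in> I" "t \<in> J"
  shows "wedge (A s t) (B s t) = 0"
proof -
  obtain f :: "'a \<Rightarrow> real" and C where f: "smooth_map_on M x M f" and C: "C \<in> bivectors"
    and eq: "\<forall>p\<in>M. laplacian M x Or (gauss_map M x Or) p = f p *\<^sub>R (gauss_map M x Or p + C)"
    using assms(1) unfolding pointwise_1_type_gauss_map_def by (elim exE conjE)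
  define k where "k s t = (2 / (\<mu> s t)\<^sup>2) * mink (A s t) (B s t)" for s t
  have E: "k s t *\<^sub>R \<nu> s t + (2 / (\<mu> s t)\<^sup>2) *\<^sub>R wedge (A s t) (B s t) = f (\<phi> (s, t)) *\<^sub>R (\<nu> s t + C)"
    if "s \<in> I" "t \<in> J" for s t
  proof -
    have "\<phi> (s, t) \<in> M" using local_paramD(6)[OF par] that by auto
    from bspec[OF eq this] show ?thesis
      unfolding laplacian_gauss_map[OF that] gauss_map_null[OF that] k_def by (simp add: scaleR_add_right)
  qed
  have Eact: "k s t *\<^sub>R act (\<nu> s t) u + (2 / (\<mu> s t)\<^sup>2) *\<^sub>R act (wedge (A s t) (B s t)) u =
      f (\<phi> (s, t)) *\<^sub>R (act (\<nu> s t) u + act C u)" if "s \<in> I" "t \<in> J" for s t u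
    using arg_cong[OF E[OF that], of "\<lambda>D. act D u"] by (simp only: act.add_left act.scaleR_left)
  have m: "2 / (\<mu> s t)\<^sup>2 \<noteq> 0" using \<mu>_neg[OF st] by simp
  note n = null_pairD[OF pointwise(2)[OF st]]
  have ab0: "a s \<noteq> 0" "b t \<noteq> 0" using n by auto
  show ?thesis
  proof (cases "f (\<phi> (s, t)) = 0")
    case True
    \<comment> \<open>Applied to \<open>a s\<close> the wedge term drops out while
      \<open>\<nu>\<close> acts as -1, so the scalar coefficient vanishes first.\<close>
    have "k s t = 0" using Eact[OF st, of "a s"] ab0 by (simp add: True act_normal[OF st])
    then show ?thesis using E[OF st] m by (simp add: True)
  next
    case False
    have z: "(s, t) \<in> I \<times> J" using st by simp
    have "smooth_on (I \<times> J) (f \<circ> \<phi>)"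
      using f par local_paramD(6)[OF par] unfolding smooth_map_on_def by blast
    then have "continuous_on (I \<times> J) (f \<circ> \<phi>)" by (rule smooth_on_continuous)
    then have "open ((I \<times> J) \<inter> (f \<circ> \<phi>) -` (- {0}))"
      by (rule continuous_open_preimage[OF _ open_IJ(3)]) (simp add: open_Compl)
    moreover have "(s, t) \<in> (I \<times> J) \<inter> (f \<circ> \<phi>) -` (- {0})" using z False by simp
    ultimately obtain I' J' where IJ': "open I'" "open J'" "(s, t) \<in> I' \<times> J'" "I' \<times> J' \<subseteq> (I \<times> J) \<inter> (f \<circ> \<phi>) -` (- {0})"
      using open_box_around by metis
    then have sub: "r \<in> I" "q \<in> J" "f (\<phi> (r, q)) \<noteq> 0" if "r \<in> I'" "q \<in> J'" for r q
      using that by auto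
    have st': "s \<in> I'" "t \<in> J'" using IJ'(3) by auto
    have eig: "\<exists>c. act C (a r) = c *\<^sub>R a r" "\<exists>c. act C (b q) = c *\<^sub>R b q" if rq: "r \<in> I'" "q \<in> J'" for r q
    proof -
      let ?f = "f (\<phi> (r, q))"
      note rq' = sub[OF rq]
      have "?f *\<^sub>R act C (a r) = (?f - k r q) *\<^sub>R a r"
        using Eact[OF rq'(1,2), of "a r"] by (simp add: act_normal[OF rq'(1,2)] algebra_simps)
      then have "act C (a r) = ((?f - k r q) / ?f) *\<^sub>R a r"
        using rq'(3) vector_fraction_eq_iff[of 1 ?f] by (simp add: eq_vector_fraction_iff)
      then show "\<exists>c. act C (a r) = c *\<^sub>R a r" ..
      have "?f *\<^sub>R act C (b q) = (k r q - ?f) *\<^sub>R b q"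
        using Eact[OF rq'(1,2), of "b q"] by (simp add: act_normal[OF rq'(1,2)] algebra_simps)
      then have "act C (b q) = ((k r q - ?f) / ?f) *\<^sub>R b q"
        using rq'(3) vector_fraction_eq_iff[of 1 ?f] by (simp add: eq_vector_fraction_iff)
      then show "\<exists>c. act C (b q) = c *\<^sub>R b q" ..
    qed
    consider "a' s = 0" | "b' t = 0" | "a' s \<noteq> 0" "b' t \<noteq> 0" by blast
    then show ?thesis
    proof cases
      case 1
      then show ?thesis using AB_zero[OF st] by (simp add: wedge.zero_left)
    next
      case 2
      then show ?thesis using AB_zero[OF st] by (simp add: wedge.zero_right)
    next
      case 3
      note acc = acceleration[OF st]
      have Ca: "act C (a s) = 0" "\<exists>c. act C (a' s) = c *\<^sub>R a s"
        by (rule null_eigenvector_curve[OF IJ'(1) st'(1) _ curve_derivatives(3)[OF st(1)] eig(1)[OF _ st'(2)] C acc(1) _ 3(1)];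
            use null_pairD(1)[OF pointwise(2)[OF sub(1,2)[OF _ st'(2)]]] acc(2) in \<open>simp add: st'(2) mink_commute\<close>)+
      have Cb: "act C (b t) = 0"
        by (rule null_eigenvector_curve(1)[OF IJ'(2) st'(2) _ curve_derivatives(4)[OF st(2)] eig(2)[OF st'(1)] C acc(3) _ 3(2)];
            use null_pairD(2)[OF pointwise(2)[OF sub(1,2)[OF st'(1)]]] acc(4) in \<open>simp add: st'(1) mink_commute\<close>)
      obtain c where c: "act C (a' s) = c *\<^sub>R a s" using Ca(2) by blast
      \<comment> \<open>Skewness moves \<open>C\<close> from \<open>a' s\<close> onto
        \<open>b t\<close>, which it annihilates.\<close>
      have "c * \<mu> s t = mink (act C (a' s)) (b t)" by (simp add: c mink.scaleR_left \<mu>_def)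
      also have "\<dots> = 0" by (simp add: act_skew[OF C] Cb mink.zero_right)
      finally have "c = 0" using \<mu>_neg[OF st] by simp
      then have "act C (A s t) = 0" by (simp add: A_def act.diff_right act.scaleR_right c Ca)
      \<comment> \<open>Both \<open>\<nu>\<close> and \<open>C\<close> annihilate
        \<open>A s t\<close>, so only the wedge term of the equation remains.\<close>
      then have "act (wedge (A s t) (B s t)) (A s t) = 0"
        using Eact[OF st, of "A s t"] m by (simp add: act_normal[OF st])
      then have "mink (A s t) (B s t) *\<^sub>R A s t = mink (A s t) (A s t) *\<^sub>R B s t"
        by (simp add: act_wedge mink_commute)
      then show ?thesis by (rule wedge_AB_zeroI[OF st])
    qed
  qed
qed

text \<open>The product of \<open>n\<close> with each of the two curves is constant, hence so is its
  product with \<open>x\<close>. The vector \<open>v\<close> is the Euclidean normal corresponding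
  to \<open>n\<close>.\<close>

lemma null_normal_hyperplane:
  assumes "n \<noteq> 0" "\<And>s. s \<in> I \<Longrightarrow> mink n (a s) = 0" "\<And>t. t \<in> J \<Longrightarrow> mink n (b t) = 0"
  shows "\<exists>v c. v \<noteq> 0 \<and> x ` \<phi> ` (I \<times> J) \<subseteq> {y. v \<bullet> y = c}"
proof (cases "I = {} \<or> J = {}")
  case True
  then show ?thesis using assms(1) by auto
next
  case False
  then obtain s0 t0 where 0: "s0 \<in> I" "t0 \<in> J" by blast
  have da: "((\<lambda>s. mink n (\<alpha> s)) has_vector_derivative 0) (at s)" if "s \<in> I" for s
    using bounded_linear.has_vector_derivative[OF mink.bounded_linear_right curve_derivatives(1)[OF that]] assms(2)[OF that]
    by metis
  have db: "((\<lambda>t. mink n (\<beta> t)) has_vector_derivative 0) (at t)" if "t \<in> J" for t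
    using bounded_linear.has_vector_derivative[OF mink.bounded_linear_right curve_derivatives(2)[OF that]] assms(3)[OF that]
    by metis
  define v :: "real^4" where "v = (\<chi> i. if i = 1 then - n$i else n$i)"
  have "v \<noteq> 0"
  proof
    assume v: "v = 0"
    have "n $ i = 0" for i using arg_cong[OF v, of "\<lambda>v. v $ i"] by (simp add: v_def split: if_splits)
    then show False using assms(1) by (simp add: vec_eq_iff)
  qed
  moreover have "v \<bullet> x (\<phi> (s, t)) = mink n (\<alpha> s0) + mink n (\<beta> t0)" if "s \<in> I" "t \<in> J" for s t
    unfolding v_def mink_eq_inner[symmetric] pointwise(1)[OF that] mink.add_right
    using vector_derivative_zero_constant[OF interval_IJ(1) da that(1) 0(1)]
      vector_derivative_zero_constant[OF interval_IJ(2) db that(2) 0(2)] by simp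
  ultimately show ?thesis by (intro exI[of _ v] exI[of _ "mink n (\<alpha> s0) + mink n (\<beta> t0)"]) auto
qed

text \<open>Used to exclude a region in which both null directions are constant, since the surface
  would be planar there.\<close>

lemma flat_null_chart_hyperplane:
  assumes "\<And>s. s \<in> I \<Longrightarrow> a s = v" "\<And>t. t \<in> J \<Longrightarrow> b t = w"
  shows "\<exists>v c. v \<noteq> 0 \<and> x ` \<phi> ` (I \<times> J) \<subseteq> {y. v \<bullet> y = c}"
proof -
  obtain n where n: "n \<noteq> 0" "mink n v = 0" "mink n w = 0" "mink n 0 = 0" by (rule common_normal_vector)
  show ?thesis by (rule null_normal_hyperplane[OF n(1)]) (simp_all add: assms n)
qed

text \<open>Orthogonality of \<open>n\<close> to \<open>A\<close> says exactly that
  \<open>mink n (a s)\<close> satisfies a homogeneous linear differential equation in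
  \<open>s\<close>, so a zero at \<open>s0\<close> persists.\<close>

lemma orthogonal_along_s:
  assumes "t \<in> J" "s0 \<in> I" "mink n (a s0) = 0" "\<And>s. s \<in> I \<Longrightarrow> mink n (A s t) = 0" "s \<in> I"
  shows "mink n (a s) = 0"
proof (rule orthogonal_curve[OF interval_IJ(1) assms(2,5) curve_derivatives(3) _ assms(3)])
  show "mink (a s) (b t) \<noteq> 0" if "s \<in> I" for s using \<mu>_neg[OF that assms(1)] by (simp add: \<mu>_def)
  show "mink n (a' s) = mink (a' s) (b t) / mink (a s) (b t) * mink n (a s)" if "s \<in> I" for s
    using assms(4)[OF that] by (simp add: A_def mink.diff_right mink.scaleR_right \<mu>_def)
qed

lemma orthogonal_along_t:
  assumes "s \<in> I" "t0 \<in> J" "mink n (b t0) = 0" "\<And>t. t \<in> J \<Longrightarrow> mink n (B s t) = 0" "t \<in> J"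
  shows "mink n (b t) = 0"
proof (rule orthogonal_curve[OF interval_IJ(2) assms(2,5) curve_derivatives(4) _ assms(3)])
  show "mink (b t) (a s) \<noteq> 0" if "t \<in> J" for t
    using \<mu>_neg[OF assms(1) that] by (simp add: \<mu>_def mink_commute)
  show "mink n (b' t) = mink (b' t) (a s) / mink (b t) (a s) * mink n (b t)" if "t \<in> J" for t
    using assms(4)[OF that] by (simp add: B_def mink.diff_right mink.scaleR_right \<mu>_def mink_commute[of _ "a s"])
qed

text \<open>Take \<open>n\<close> orthogonal to \<open>a s\<close>, \<open>b t\<close> and
  \<open>a' s\<close>. Orthogonality to \<open>A\<close> along the line through \<open>s\<close>
  passes to \<open>B\<close> by parallelism, in particular to \<open>b' t\<close>; from there it
  passes to \<open>B\<close>, and back to \<open>A\<close>, along the line through \<open>t\<close>.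
  The two differential equations then make \<open>n\<close> orthogonal to the whole chart.\<close>

lemma parallel_accelerations_dichotomy:
  assumes W: "\<And>s t. s \<in> I \<Longrightarrow> t \<in> J \<Longrightarrow> wedge (A s t) (B s t) = 0"
    and no_hyp: "\<And>v c. v \<noteq> 0 \<Longrightarrow> \<not> x ` \<phi> ` (I \<times> J) \<subseteq> {y. v \<bullet> y = c}" and st: "s \<in> I" "t \<in> J"
  shows "a' s = 0 \<or> b' t = 0"
proof (rule ccontr)
  assume "\<not> (a' s = 0 \<or> b' t = 0)"
  then have a': "a' s \<noteq> 0" and b': "b' t \<noteq> 0" by auto
  obtain n where n: "n \<noteq> 0" "mink n (a s) = 0" "mink n (b t) = 0" "mink n (a' s) = 0" by (rule common_normal_vector)
  have nA: "mink n (A s q) = 0" for q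
    using n by (simp add: A_def mink.diff_right mink.scaleR_right)
  have nB: "mink n (B s q) = 0" if q: "q \<in> J" for q
  proof -
    have "A s q \<noteq> 0" using a' AB_zero[OF st(1) q] by simp
    then obtain c where "B s q = c *\<^sub>R A s q" using wedge_zero_parallel[OF W[OF st(1) q]] by blast
    then show ?thesis using nA by (simp add: mink.scaleR_right)
  qed
  \<comment> \<open>The crossing point \<open>(s, t)\<close> belongs to both coordinate lines and
    transfers the information from one to the other.\<close>
  have "mink n (b' t) = 0" using nB[OF st(2)] n by (simp add: B_def mink.diff_right mink.scaleR_right)
  then have nB': "mink n (B r t) = 0" for r using n by (simp add: B_def mink.diff_right mink.scaleR_right)
  have nA': "mink n (A r t) = 0" if r: "r \<in> I" for r
  proof (cases "A r t = 0")
    case False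
    have "B r t \<noteq> 0" using b' AB_zero[OF r st(2)] by simp
    obtain c where c: "B r t = c *\<^sub>R A r t" using wedge_zero_parallel[OF W[OF r st(2)] False] by blast
    then have "c \<noteq> 0" using \<open>B r t \<noteq> 0\<close> by auto
    then show ?thesis using nB'[of r] unfolding c by (simp add: mink.scaleR_right)
  qed (simp add: mink.zero_right)
  have "\<exists>v c. v \<noteq> 0 \<and> x ` \<phi> ` (I \<times> J) \<subseteq> {y. v \<bullet> y = c}"
    by (rule null_normal_hyperplane[OF n(1) orthogonal_along_s[OF st(2,1) n(2) nA'] orthogonal_along_t[OF st n(3) nB]])
  then show False using no_hyp by blast
qed

text \<open>The coordinates are independent: a single parameter with \<open>a' s\<close> nonzero
  forces \<open>b'\<close> to vanish on all of \<open>J\<close>.\<close>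

lemma constant_null_direction:
  assumes ruled: "\<And>s t. s \<in> I \<Longrightarrow> t \<in> J \<Longrightarrow> a' s = 0 \<or> b' t = 0" and 0: "s0 \<in> I" "t0 \<in> J"
  shows "(\<forall>s\<in>I. a s = a s0) \<or> (\<forall>t\<in>J. b t = b t0)"
proof (cases "\<forall>s\<in>I. a' s = 0")
  case True
  then have "(a has_vector_derivative 0) (at s)" if "s \<in> I" for s using curve_derivatives(3)[OF that] that by simp
  then show ?thesis using vector_derivative_zero_constant[OF interval_IJ(1) _ _ 0(1)] by metis
next
  case False
  then have "\<forall>t\<in>J. b' t = 0" using ruled by blast
  then have "(b has_vector_derivative 0) (at t)" if "t \<in> J" for t using curve_derivatives(4)[OF that] that by simp
  then show ?thesis using vector_derivative_zero_constant[OF interval_IJ(2) _ _ 0(2)] by metis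
qed

end

section \<open>Isometries of space-time\<close>

lemma mink_nondegenerate:
  assumes "\<And>w. mink v w = 0"
  shows "v = 0"
proof -
  have "(\<chi> i. if i = 1 then - v$i else v$i) \<bullet> ((\<chi> i. if i = 1 then - v$i else v$i) :: real^4) = 0"
    using assms unfolding mink_eq_inner by blast
  then have *: "(\<chi> i. if i = 1 then - v$i else v$i) = (0 :: real^4)" by simp
  have "v $ i = 0" for i using arg_cong[OF *, of "\<lambda>v. v $ i"] by (simp split: if_splits)
  then show ?thesis by (simp add: vec_eq_iff)
qed

text \<open>The trilinear form \<open>\<langle>D\<^sup>2F(u, v), DF(w)\<rangle>\<close> is symmetric in \<open>u, v\<close> and skew in \<open>v, w\<close>, hence zero.\<close>

lemma mink_isometry_derivative_constant:
  assumes "mink_isometry F"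
  shows "frechet_derivative F (at y) = frechet_derivative F (at 0)"
proof -
  let ?D = "\<lambda>y. frechet_derivative F (at y)"
  have s: "smooth_on UNIV F" and iso: "mink (?D y v) (?D y w) = mink v w" for y v w
    using assms unfolding mink_isometry_def by blast+
  have sD: "smooth_on UNIV (\<lambda>y. ?D y v)" for v by (rule smooth_on_frechet[OF s])
  define H where "H y u v = frechet_derivative (\<lambda>y. ?D y v) (at y) u" for y u v
  have dD: "((\<lambda>y. ?D y v) has_derivative (\<lambda>u. H y u v)) (at y)" for y v
    unfolding H_def by (rule smooth_on_has_derivative[OF sD UNIV_I])
  have sym: "H y u v = H y v u" for y u v
    unfolding H_def by (rule second_derivative_symmetric[OF open_UNIV s UNIV_I])
  have skew: "mink (H y u v) (?D y w) = - mink (H y u w) (?D y v)" for y u v w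
  proof -
    have "((\<lambda>y. mink (?D y v) (?D y w)) has_derivative (\<lambda>u. mink (?D y v) (H y u w) + mink (H y u v) (?D y w))) (at y)"
      by (rule mink.FDERIV[OF dD dD])
    then have "((\<lambda>y. mink v w) has_derivative (\<lambda>u. mink (?D y v) (H y u w) + mink (H y u v) (?D y w))) (at y)"
      unfolding iso .
    then have "(\<lambda>u. mink (?D y v) (H y u w) + mink (H y u v) (?D y w)) = (\<lambda>u. 0)"
      by (rule has_derivative_unique[OF _ has_derivative_const])
    then have "mink (?D y v) (H y u w) + mink (H y u v) (?D y w) = 0" by meson
    then show ?thesis by (simp add: mink_commute[of "?D y v"])
  qed
  have H0: "H y u v = 0" for y u v
  proof (rule mink_nondegenerate)
    fix z
    have lin: "linear (?D y)" using smooth_on_has_derivative[OF s UNIV_I] has_derivative_linear by blast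
    have "inj (?D y)"
      unfolding linear_injective_0[OF lin]
    proof (intro allI impI)
      fix v assume "?D y v = 0"
      then have "mink v w = 0" for w using iso[of y v w] by (simp add: mink.zero_left)
      then show "v = 0" by (rule mink_nondegenerate)
    qed
    then have "surj (?D y)" using linear_injective_imp_surjective[OF lin] by blast
    then obtain w where w: "z = ?D y w" by (metis surjD)
    \<comment> \<open>Writing T for the trilinear form, T(u,v,w) = -T(u,w,v) = -T(w,u,v) = T(w,v,u)
      = T(v,w,u) = -T(v,u,w) = -T(u,v,w).\<close>
    have "mink (H y u v) (?D y w) = - mink (H y u v) (?D y w)"
      using skew[of y u v w] skew[of y w u v] skew[of y v w u] sym[of y u w] sym[of y w v] sym[of y v u] by simp
    then show "mink (H y u v) z = 0" unfolding w by simp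
  qed
  show ?thesis
  proof
    fix v
    have "((\<lambda>y. ?D y v) has_derivative (\<lambda>u. 0)) (at y within UNIV)" for y
      using dD[of v y] unfolding H0 .
    then show "?D y v = ?D 0 v"
      using has_derivative_zero_constant[of UNIV "\<lambda>y. ?D y v"] by (metis UNIV_I convex_UNIV)
  qed
qed

lemma mink_isometry_id: "mink_isometry id"
proof -
  have "smooth_on UNIV (id :: real^4 \<Rightarrow> real^4)" unfolding id_def by (rule smooth_on_ident)
  moreover have "frechet_derivative id (at y) = (id :: real^4 \<Rightarrow> real^4)" for y
    by (rule frechet_derivative_eqI[OF has_derivative_id])
  ultimately show ?thesis unfolding mink_isometry_def by simp
qed

section \<open>Null ruled surfaces\<close>

text \<open>The plane contains only two null vectors of time component 1, and equality of the
  orientation classes excludes their interchange.\<close>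

lemma oriented_null_pair_unique:
  assumes N: "null_pair n m" "null_pair n' m'" and sp: "span {n, m} = span {n', m'}"
    and ori: "oriented_bases n m = oriented_bases n' m'"
  shows "n' = n" "m' = m"
proof -
  note nm = null_pairD[OF N(1)] and nm' = null_pairD[OF N(2)]
  have alt: "v = n \<or> v = m" if v: "v \<in> span {n, m}" "v $ 1 = 1" "mink v v = 0" for v
  proof -
    obtain p q where pq: "v = p *\<^sub>R n + q *\<^sub>R m" using v(1) span_pair by blast
    have "2 * (p * q * mink n m) = 0"
      using v(3) nm by (simp add: pq mink.add_left mink.add_right mink.scaleR_left mink.scaleR_right)
    then have "p = 0 \<or> q = 0" using nm(7) by simp
    moreover have "p + q = 1" using v(2) nm by (simp add: pq)
    ultimately show ?thesis by (auto simp: pq)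
  qed
  have "n' \<in> span {n, m}" "m' \<in> span {n, m}" unfolding sp by (simp_all add: span_base)
  then have "n' = n \<or> n' = m" "m' = n \<or> m' = m" using alt nm' by blast+
  moreover have "\<not> (n' = m \<and> m' = n)"
  proof
    assume sw: "n' = m \<and> m' = n"
    have "(1 *\<^sub>R n' + 0 *\<^sub>R m', 0 *\<^sub>R n' + 1 *\<^sub>R m') \<in> oriented_bases n' m'"
      unfolding oriented_bases_def
      by (intro CollectI exI[of _ 1] exI[of _ 0] conjI refl) simp
    then have "(m, n) \<in> oriented_bases n m" using sw ori by simp
    then obtain p q p' q' where pq: "m = p *\<^sub>R n + q *\<^sub>R m" "n = p' *\<^sub>R n + q' *\<^sub>R m" "p * q' - p' * q > 0"
      unfolding oriented_bases_def by blast
    have "p = 0" "q = 1" "p' = 1" "q' = 0"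
      using null_pair_coords[OF N(1), of 0 1 p q] null_pair_coords[OF N(1), of 1 0 p' q'] pq(1,2) by simp_all
    then show False using pq(3) by simp
  qed
  ultimately show "n' = n" "m' = m" using nm'(5) by auto
qed

section \<open>From null charts to the whole surface\<close>

locale minimal_lorentzian_surface =
  fixes M :: "'a::topological_space set" and x :: "'a \<Rightarrow> real^4" and Or :: "'a \<Rightarrow> ((real^4) \<times> (real^4)) set"
  assumes surface: "immersed_surface M x"
    and orient: "surface_orientation M x Or"
    and lorentz: "lorentzian M x"
    and minimal: "minimal_surface M x"
    and no_hyperplane: "\<And>V a b. openin (top_of_set M) V \<Longrightarrow> V \<noteq> {} \<Longrightarrow> a \<noteq> 0 \<Longrightarrow> \<not> x ` V \<subseteq> {y. a \<bullet> y = b}"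
begin

lemma null_coordinates_at:
  assumes "openin (top_of_set M) V" "p \<in> V"
  obtains I J \<phi> \<alpha> \<beta> s t where "null_coordinates M x Or I J \<phi> \<alpha> \<beta>" "s \<in> I" "t \<in> J" "p = \<phi> (s, t)" "\<phi> ` (I \<times> J) \<subseteq> V"
proof -
  obtain I J \<phi> \<alpha> \<beta> where *: "null_chart M x Or I J \<phi> \<alpha> \<beta>" "p \<in> \<phi> ` (I \<times> J)" "\<phi> ` (I \<times> J) \<subseteq> V"
    using null_chart_exists[OF orient lorentz minimal assms] by metis
  then obtain s t where "s \<in> I" "t \<in> J" "p = \<phi> (s, t)" by auto
  with * lorentz show ?thesis by (intro that[of I J \<phi> \<alpha> \<beta> s t]) (simp_all add: null_coordinates_def)
qed

lemma null_coordinates_at_point: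
  assumes "p \<in> M"
  obtains I J \<phi> \<alpha> \<beta> s t where "null_coordinates M x Or I J \<phi> \<alpha> \<beta>" "s \<in> I" "t \<in> J" "p = \<phi> (s, t)"
  using null_coordinates_at[of M p] assms openin_subtopology_self by metis

text \<open>The condition to which all others are reduced. It is purely pointwise, so the
  alternative may vary from point to point; that one null direction is constant on the whole surface
  is derived from it.\<close>

definition ruled :: bool where
  "ruled \<longleftrightarrow> (\<forall>I J \<phi> \<alpha> \<beta>. null_coordinates M x Or I J \<phi> \<alpha> \<beta> \<longrightarrow>
    (\<forall>s\<in>I. \<forall>t\<in>J. null_coordinates.a' \<alpha> s = 0 \<or> null_coordinates.b' \<beta> t = 0))"

lemma ruledI:
  assumes "\<And>I J \<phi> \<alpha> \<beta> s t. null_coordinates M x Or I J \<phi> \<alpha> \<beta> \<Longrightarrow> s \<in> I \<Longrightarrow> t \<in> J \<Longrightarrow>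
    null_coordinates.a' \<alpha> s = 0 \<or> null_coordinates.b' \<beta> t = 0"
  shows ruled
  unfolding ruled_def using assms by simp

lemma ruledD:
  assumes ruled "null_coordinates M x Or I J \<phi> \<alpha> \<beta>" "s \<in> I" "t \<in> J"
  shows "null_coordinates.a' \<alpha> s = 0 \<or> null_coordinates.b' \<beta> t = 0"
  using assms unfolding ruled_def by metis

lemma chart_not_in_hyperplane:
  assumes "null_coordinates M x Or I J \<phi> \<alpha> \<beta>" "s \<in> I" "t \<in> J" "v \<noteq> 0"
  shows "\<not> x ` \<phi> ` (I \<times> J) \<subseteq> {y. v \<bullet> y = c}"
proof -
  interpret null_coordinates M x Or I J \<phi> \<alpha> \<beta> by (rule assms(1))
  show ?thesis by (rule no_hyperplane[OF local_paramD(2)[OF par] _ assms(4)]) (use assms in auto)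
qed

lemma ruled_if_parallel:
  assumes "\<And>I J \<phi> \<alpha> \<beta> s t. null_coordinates M x Or I J \<phi> \<alpha> \<beta> \<Longrightarrow> s \<in> I \<Longrightarrow> t \<in> J \<Longrightarrow>
    wedge (null_coordinates.A \<alpha> \<beta> s t) (null_coordinates.B \<alpha> \<beta> s t) = 0"
  shows ruled
proof (rule ruledI)
  fix I J \<phi> \<alpha> \<beta> s t
  assume nc: "null_coordinates M x Or I J \<phi> \<alpha> \<beta>" and st: "s \<in> I" "t \<in> J"
  interpret null_coordinates M x Or I J \<phi> \<alpha> \<beta> by (rule nc)
  show "a' s = 0 \<or> b' t = 0"
    by (rule parallel_accelerations_dichotomy[OF assms[OF nc] chart_not_in_hyperplane[OF nc st] st])
qed

text \<open>Degeneracy means that exactly one acceleration vanishes, whereas \<open>ruled\<close>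
  allows both to vanish. The difference consists of the geodesic points.\<close>

lemma ruled_iff_degenerate: "ruled \<longleftrightarrow> degenerate_relative_null_on M x (M - geodesic_points M x)"
proof
  assume r: ruled
  show "degenerate_relative_null_on M x (M - geodesic_points M x)"
    unfolding degenerate_relative_null_on_def
  proof
    fix p assume p: "p \<in> M - geodesic_points M x"
    then obtain I J \<phi> \<alpha> \<beta> s t where nc: "null_coordinates M x Or I J \<phi> \<alpha> \<beta>" "s \<in> I" "t \<in> J" "p = \<phi> (s, t)"
      using null_coordinates_at_point[of p] by blast
    interpret null_coordinates M x Or I J \<phi> \<alpha> \<beta> by (rule nc(1))
    show "degenerate_space (relative_null_space M x p)"
      using ruledD[OF r nc(1-3)] p
      unfolding nc(4) degenerate_relative_null_iff[OF nc(2,3)] by (auto simp: geodesic_point_iff[OF nc(2,3)])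
  qed
next
  assume d: "degenerate_relative_null_on M x (M - geodesic_points M x)"
  show ruled
  proof (rule ruledI)
    fix I J \<phi> \<alpha> \<beta> s t
    assume nc: "null_coordinates M x Or I J \<phi> \<alpha> \<beta>" and st: "s \<in> I" "t \<in> J"
    interpret null_coordinates M x Or I J \<phi> \<alpha> \<beta> by (rule nc)
    have "\<phi> (s, t) \<in> M" using local_paramD(6)[OF par] st by auto
    then have "\<phi> (s, t) \<in> geodesic_points M x \<or> degenerate_space (relative_null_space M x (\<phi> (s, t)))"
      using d unfolding degenerate_relative_null_on_def by blast
    then show "a' s = 0 \<or> b' t = 0"
      unfolding degenerate_relative_null_iff[OF st] geodesic_point_iff[OF st] by blast
  qed
qed

lemma ruled_imp_harmonic: "ruled \<Longrightarrow> harmonic_gauss_map M x Or"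
  unfolding harmonic_gauss_map_def
proof
  fix p assume r: ruled and "p \<in> M"
  then obtain I J \<phi> \<alpha> \<beta> s t where nc: "null_coordinates M x Or I J \<phi> \<alpha> \<beta>" "s \<in> I" "t \<in> J" "p = \<phi> (s, t)"
    using null_coordinates_at_point[of p] by blast
  interpret null_coordinates M x Or I J \<phi> \<alpha> \<beta> by (rule nc(1))
  have "A s t = 0 \<or> B s t = 0" using ruledD[OF r nc(1-3)] AB_zero[OF nc(2,3)] by blast
  then show "laplacian M x Or (gauss_map M x Or) p = 0"
    unfolding nc(4) laplacian_gauss_map[OF nc(2,3)]
    by (auto simp: mink.zero_left mink.zero_right wedge.zero_left wedge.zero_right)
qed

lemma harmonic_imp_first_kind: "harmonic_gauss_map M x Or \<Longrightarrow> pointwise_1_type_gauss_map_first_kind M x Or"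
  unfolding harmonic_gauss_map_def pointwise_1_type_gauss_map_first_kind_def
  by (intro exI[of _ "\<lambda>_. 0"]) (simp add: smooth_map_on_def o_def)

lemma first_kind_imp_1_type: "pointwise_1_type_gauss_map_first_kind M x Or \<Longrightarrow> pointwise_1_type_gauss_map M x Or"
proof -
  assume "pointwise_1_type_gauss_map_first_kind M x Or"
  then obtain f :: "'a \<Rightarrow> real" where f: "smooth_map_on M x M f"
    "\<forall>p\<in>M. laplacian M x Or (gauss_map M x Or) p = f p *\<^sub>R gauss_map M x Or p"
    unfolding pointwise_1_type_gauss_map_first_kind_def by (elim exE conjE)
  have "(0 :: real^4^4) \<in> bivectors" by (simp add: bivectors_def transpose_def vec_eq_iff)
  then show "pointwise_1_type_gauss_map M x Or"
    unfolding pointwise_1_type_gauss_map_def using f by (intro exI[of _ f] exI[of _ 0]) simp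
qed

lemma one_type_imp_ruled: "pointwise_1_type_gauss_map M x Or \<Longrightarrow> ruled"
  by (rule ruled_if_parallel) (rule null_coordinates.pointwise_1_type_wedge)

lemma flat_iff_ruled: "flat_normal_bundle M x \<longleftrightarrow> ruled"
proof
  show "flat_normal_bundle M x \<Longrightarrow> ruled"
    by (rule ruled_if_parallel) (rule null_coordinates.flat_normal_bundle_wedge)
  assume r: ruled
  show "flat_normal_bundle M x"
    unfolding flat_normal_bundle_def
  proof (intro allI impI ballI, elim conjE)
    fix V X Y \<xi> p
    assume V: "openin (top_of_set M) V" and F: "tangent_field M x V X" "tangent_field M x V Y" "normal_field M x V \<xi>"
      and p: "p \<in> V"
    obtain I J \<phi> \<alpha> \<beta> s t where nc: "null_coordinates M x Or I J \<phi> \<alpha> \<beta>" "s \<in> I" "t \<in> J" "p = \<phi> (s, t)"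
      using null_coordinates_at[OF V p] by metis
    interpret null_coordinates M x Or I J \<phi> \<alpha> \<beta> by (rule nc(1))
    show "normal_curvature M x X Y \<xi> p = 0"
      unfolding nc(4) by (rule normal_curvature_zero[OF V F nc(2,3) _ ruledD[OF r nc(1-3)]]) (use p nc(4) in simp)
  qed
qed

text \<open>The choice is unique by \<open>oriented_null_pair_unique\<close> wherever a null chart
  exists, so this is a chart-free pair of functions on the surface that can be tested for
  constancy.\<close>

definition null_directions :: "'a \<Rightarrow> (real^4) \<times> (real^4)" where
  "null_directions p = (SOME (n, m). null_pair n m \<and> tangent_space M x p = span {n, m} \<and> Or p = oriented_bases n m)"

lemma null_directions_eq:
  assumes "null_coordinates M x Or I J \<phi> \<alpha> \<beta>" and st: "s \<in> I" "t \<in> J"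
  shows "null_directions (\<phi> (s, t)) = (null_coordinates.a \<alpha> s, null_coordinates.b \<beta> t)"
proof -
  interpret null_coordinates M x Or I J \<phi> \<alpha> \<beta> by (rule assms(1))
  let ?P = "\<lambda>(n, m). null_pair n m \<and> tangent_space M x (\<phi> (s, t)) = span {n, m} \<and> Or (\<phi> (s, t)) = oriented_bases n m"
  have "?P (a s, b t)" using pointwise(2,3)[OF st] tangent_span[OF st] by simp
  then have "?P (null_directions (\<phi> (s, t)))" unfolding null_directions_def by (rule someI)
  then obtain n m where nm: "null_directions (\<phi> (s, t)) = (n, m)" "null_pair n m"
    "tangent_space M x (\<phi> (s, t)) = span {n, m}" "Or (\<phi> (s, t)) = oriented_bases n m"
    by (cases "null_directions (\<phi> (s, t))") simp
  note u = oriented_null_pair_unique[OF pointwise(2)[OF st] nm(2) trans[OF tangent_span[OF st, symmetric] nm(3)]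
      trans[OF pointwise(3)[OF st, symmetric] nm(4)]]
  show ?thesis unfolding nm(1) u ..
qed

text \<open>The points near which the first direction is constant, and those near which the second
  is, form two open sets covering the surface. Connectedness leaves only one of them, once they are
  disjoint.\<close>

lemma ruled_imp_constant_direction:
  assumes r: ruled
  shows "(\<exists>\<eta>. \<forall>p\<in>M. fst (null_directions p) = \<eta>) \<or> (\<exists>\<eta>. \<forall>p\<in>M. snd (null_directions p) = \<eta>)"
proof -
  define E where "E f = {p \<in> M. \<exists>V. openin (top_of_set M) V \<and> p \<in> V \<and> (\<forall>q\<in>V. f (null_directions q) = f (null_directions p))}"
    for f :: "(real^4) \<times> (real^4) \<Rightarrow> real^4"
  have op: "openin (top_of_set M) (E f)" for f
  proof (subst openin_subopen, intro ballI)
    fix p assume "p \<in> E f"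
    then obtain V where V: "openin (top_of_set M) V" "p \<in> V" "\<forall>q\<in>V. f (null_directions q) = f (null_directions p)"
      unfolding E_def by blast
    have "V \<subseteq> E f"
    proof
      fix q assume q: "q \<in> V"
      then have "\<forall>r\<in>V. f (null_directions r) = f (null_directions q)" using V(3) by metis
      then show "q \<in> E f" using q V(1) openin_imp_subset[OF V(1)] unfolding E_def by blast
    qed
    then show "\<exists>T. openin (top_of_set M) T \<and> p \<in> T \<and> T \<subseteq> E f" using V by blast
  qed
  have cover: "M \<subseteq> E fst \<union> E snd"
  proof
    fix p assume p: "p \<in> M"
    then obtain I J \<phi> \<alpha> \<beta> s t where nc: "null_coordinates M x Or I J \<phi> \<alpha> \<beta>" "s \<in> I" "t \<in> J" "p = \<phi> (s, t)"
      using null_coordinates_at_point[of p] by blast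
    interpret null_coordinates M x Or I J \<phi> \<alpha> \<beta> by (rule nc(1))
    have V: "openin (top_of_set M) (\<phi> ` (I \<times> J))" "p \<in> \<phi> ` (I \<times> J)" using local_paramD(2)[OF par] nc by auto
    have "(\<forall>s'\<in>I. a s' = a s) \<or> (\<forall>t'\<in>J. b t' = b t)"
      by (rule constant_null_direction[OF ruledD[OF r nc(1)] nc(2,3)])
    then have "(\<forall>q\<in>\<phi> ` (I \<times> J). fst (null_directions q) = fst (null_directions p)) \<or>
        (\<forall>q\<in>\<phi> ` (I \<times> J). snd (null_directions q) = snd (null_directions p))"
      unfolding nc(4) by (auto simp: null_directions_eq[OF nc(1)] nc(2,3))
    then show "p \<in> E fst \<union> E snd" using V p unfolding E_def by blast
  qed
  \<comment> \<open>Near a common point both null directions would be constant and the surface would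
    lie in a hyperplane.\<close>
  have disj: "E fst \<inter> E snd = {}"
  proof (rule ccontr)
    assume "E fst \<inter> E snd \<noteq> {}"
    then obtain p where "p \<in> E fst" "p \<in> E snd" by blast
    then obtain V1 V2 where V: "openin (top_of_set M) V1" "p \<in> V1" "\<forall>q\<in>V1. fst (null_directions q) = fst (null_directions p)"
      "openin (top_of_set M) V2" "p \<in> V2" "\<forall>q\<in>V2. snd (null_directions q) = snd (null_directions p)"
      unfolding E_def by blast
    obtain I J \<phi> \<alpha> \<beta> s t where nc: "null_coordinates M x Or I J \<phi> \<alpha> \<beta>" "s \<in> I" "t \<in> J" "p = \<phi> (s, t)"
      "\<phi> ` (I \<times> J) \<subseteq> V1 \<inter> V2"
      using null_coordinates_at[OF openin_Int[OF V(1,4)], of p] V(2,5) by blast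
    interpret null_coordinates M x Or I J \<phi> \<alpha> \<beta> by (rule nc(1))
    have in12: "\<phi> (s', t') \<in> V1" "\<phi> (s', t') \<in> V2" if "s' \<in> I" "t' \<in> J" for s' t' using nc(5) that by auto
    have "a s' = fst (null_directions p)" if "s' \<in> I" for s'
      using bspec[OF V(3) in12(1)[OF that nc(3)]] by (simp add: null_directions_eq[OF nc(1) that nc(3)])
    moreover have "b t' = snd (null_directions p)" if "t' \<in> J" for t'
      using bspec[OF V(6) in12(2)[OF nc(2) that]] by (simp add: null_directions_eq[OF nc(1) nc(2) that])
    ultimately have "\<exists>v c. v \<noteq> 0 \<and> x ` \<phi> ` (I \<times> J) \<subseteq> {y. v \<bullet> y = c}"
      by (rule flat_null_chart_hyperplane)
    then show False using chart_not_in_hyperplane[OF nc(1-3)] by blast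
  qed
  have con: "connected M" using surface unfolding immersed_surface_def by blast
  have const: "\<exists>\<eta>. \<forall>p\<in>M. f (null_directions p) = \<eta>" if "M \<subseteq> E f" for f
  proof -
    have "(\<lambda>p. f (null_directions p)) constant_on M"
    proof (rule locally_constant_imp_constant[OF con])
      fix p assume "p \<in> M"
      then show "\<exists>T. openin (top_of_set M) T \<and> p \<in> T \<and> (\<forall>q\<in>T. f (null_directions q) = f (null_directions p))"
        using that unfolding E_def by blast
    qed
    then show ?thesis unfolding constant_on_def .
  qed
  have "E fst = {} \<or> E snd = {}"
    using con op[of fst] op[of snd] cover disj unfolding connected_openin by blast
  then have "M \<subseteq> E fst \<or> M \<subseteq> E snd" using cover by blast
  then show ?thesis using const by blast
qed

end

section \<open>Congruence with surfaces swept out by parallel null lines\<close>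

lemma local_param_swap:
  assumes "local_param M x (I \<times> J) \<phi>" "open I" "open J"
  shows "local_param M x (J \<times> I) (\<phi> \<circ> prod.swap)"
proof (rule local_param_reparam(1)[OF assms(1)])
  show "open (J \<times> I)" "open (I \<times> J)" using assms by (auto intro: open_Times)
  show "homeomorphism (J \<times> I) (I \<times> J) prod.swap prod.swap"
    unfolding homeomorphism_def by (auto intro!: continuous_intros simp: prod.swap_def image_iff)
  have "smooth_on S (prod.swap :: real \<times> real \<Rightarrow> real \<times> real)" for S
  proof (rule smooth_on_linear)
    show "bounded_linear (prod.swap :: real \<times> real \<Rightarrow> real \<times> real)"
      unfolding prod.swap_def by (intro bounded_linear_Pair bounded_linear_fst bounded_linear_snd)
  qed
  then show "smooth_on (J \<times> I) (prod.swap :: real \<times> real \<Rightarrow> real \<times> real)"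
    "smooth_on (I \<times> J) (prod.swap :: real \<times> real \<Rightarrow> real \<times> real)" by blast+
qed simp

lemma affine_if_constant_derivative:
  assumes "is_interval I" "\<And>s. s \<in> I \<Longrightarrow> (\<gamma> has_vector_derivative \<eta>) (at s)" "s \<in> I" "s0 \<in> I"
  shows "\<gamma> s = s *\<^sub>R \<eta> + (\<gamma> s0 - s0 *\<^sub>R \<eta>)"
proof -
  have "\<gamma> s - s *\<^sub>R \<eta> = \<gamma> s0 - s0 *\<^sub>R \<eta>"
  proof (rule vector_derivative_zero_constant[OF assms(1) _ assms(3,4)])
    fix s assume "s \<in> I"
    from has_vector_derivative_diff[OF assms(2)[OF this] has_vector_derivative_scaleR[OF DERIV_ident has_vector_derivative_const[of \<eta>]]]
    show "((\<lambda>s. \<gamma> s - s *\<^sub>R \<eta>) has_vector_derivative 0) (at s)" by simp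
  qed
  then show ?thesis by (simp add: algebra_simps)
qed

lemma null_curve_translate:
  assumes "open J" "smooth_on J \<beta>" "\<And>t. t \<in> J \<Longrightarrow> (\<beta> has_vector_derivative b t) (at t)" "\<And>t. t \<in> J \<Longrightarrow> lightlike (b t)"
    "\<And>t. t \<in> J \<Longrightarrow> mink \<eta> (b t) \<noteq> 0"
  shows "null_curve_on J (\<lambda>t. \<beta> t + c)" "\<And>t. t \<in> J \<Longrightarrow> mink \<eta> (vector_derivative (\<lambda>t. \<beta> t + c) (at t)) \<noteq> 0"
proof -
  have v: "vector_derivative (\<lambda>t. \<beta> t + c) (at t) = b t" if "t \<in> J" for t
    using has_vector_derivative_add[OF assms(3)[OF that] has_vector_derivative_const[of c]] by (simp add: vector_derivative_at)
  show "null_curve_on J (\<lambda>t. \<beta> t + c)"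
    unfolding null_curve_on_def using v assms(4) by (auto intro!: smooth_on_add assms(1,2))
  show "\<And>t. t \<in> J \<Longrightarrow> mink \<eta> (vector_derivative (\<lambda>t. \<beta> t + c) (at t)) \<noteq> 0" using v assms(5) by simp
qed

lemma mink_isometry_linear_part:
  assumes "mink_isometry F"
  obtains L where "\<And>y. (F has_derivative L) (at y)" "\<And>v w. mink (L v) (L w) = mink v w" "inj L"
proof -
  let ?L = "frechet_derivative F (at 0)"
  have s: "smooth_on UNIV F" and iso: "mink (frechet_derivative F (at y) v) (frechet_derivative F (at y) w) = mink v w" for y v w
    using assms unfolding mink_isometry_def by blast+
  have d: "(F has_derivative ?L) (at y)" for y
    using smooth_on_has_derivative[OF s UNIV_I, of y] unfolding mink_isometry_derivative_constant[OF assms, of y] .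
  have "inj ?L"
    unfolding linear_injective_0[OF has_derivative_linear[OF d]]
  proof (intro allI impI)
    fix v assume "?L v = 0"
    then have "mink v w = 0" for w using iso[of 0 v w] by (simp add: mink.zero_left)
    then show "v = 0" by (rule mink_nondegenerate)
  qed
  with d iso show ?thesis by (rule that)
qed

text \<open>An isometry has one linear part \<open>L\<close> at all points, and differentiating
  along the ruling shows that \<open>L\<close> maps a tangent vector to
  \<open>\<eta>\<^sub>0\<close>. By injectivity of \<open>L\<close> this tangent vector is the same
  everywhere.\<close>

lemma congruent_imp_constant_null_tangent:
  assumes "congruent_to_null_line_surface M x" "M \<noteq> {}"
  shows "\<exists>\<eta>. lightlike \<eta> \<and> (\<forall>p\<in>M. \<eta> \<in> tangent_space M x p)"
proof -
  define R where "R F \<eta>\<^sub>0 p \<longleftrightarrow> (\<exists>I J \<phi> \<beta>. local_param M x (I \<times> J) \<phi> \<and> p \<in> \<phi> ` (I \<times> J) \<and>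
      (\<forall>s\<in>I. \<forall>t\<in>J. F (x (\<phi> (s, t))) = s *\<^sub>R \<eta>\<^sub>0 + \<beta> t))" for F :: "real^4 \<Rightarrow> real^4" and \<eta>\<^sub>0 p
  have "\<exists>F \<eta>\<^sub>0. mink_isometry F \<and> lightlike \<eta>\<^sub>0 \<and> (\<forall>p\<in>M. R F \<eta>\<^sub>0 p)"
    using assms(1) unfolding congruent_to_null_line_surface_def R_def by fast
  then obtain F \<eta>\<^sub>0 where F: "mink_isometry F" and \<eta>\<^sub>0: "lightlike \<eta>\<^sub>0" and R: "\<forall>p\<in>M. R F \<eta>\<^sub>0 p" by metis
  obtain L where L: "\<And>y. (F has_derivative L) (at y)" "\<And>v w. mink (L v) (L w) = mink v w" "inj L"
    using mink_isometry_linear_part[OF F] by metis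
  have pre: "\<exists>v\<in>tangent_space M x p. L v = \<eta>\<^sub>0" if p: "p \<in> M" for p
  proof -
    obtain I J \<phi> \<beta> where par: "local_param M x (I \<times> J) \<phi>" and "p \<in> \<phi> ` (I \<times> J)"
      and eq: "\<forall>s\<in>I. \<forall>t\<in>J. F (x (\<phi> (s, t))) = s *\<^sub>R \<eta>\<^sub>0 + \<beta> t"
      using bspec[OF R p] unfolding R_def by (elim exE conjE)
    then obtain s t where st: "(s, t) \<in> I \<times> J" and p: "p = \<phi> (s, t)" by auto
    let ?d = "frechet_derivative (x \<circ> \<phi>) (at (s, t))"
    obtain I' J' where I': "open I'" "(s, t) \<in> I' \<times> J'" "I' \<times> J' \<subseteq> I \<times> J"
      using open_box_around[OF local_paramD(1)[OF par] st] by metis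
    have "((\<lambda>z. F ((x \<circ> \<phi>) z)) has_derivative (\<lambda>c. L (?d c))) (at (s, t))"
      by (rule has_derivative_compose[OF local_param_has_derivative(1)[OF par st] L(1)])
    from has_vector_derivative_slice(1)[OF this]
    have "((\<lambda>s. F (x (\<phi> (s, t)))) has_vector_derivative L (?d (1,0))) (at s)" by simp
    moreover have "((\<lambda>s. F (x (\<phi> (s, t)))) has_vector_derivative \<eta>\<^sub>0) (at s)"
    proof (rule has_vector_derivative_transform_within_open[OF _ I'(1)])
      show "((\<lambda>s. s *\<^sub>R \<eta>\<^sub>0 + \<beta> t) has_vector_derivative \<eta>\<^sub>0) (at s)"
        by (auto intro!: derivative_eq_intros)
      show "s \<in> I'" using I'(2) by simp
      show "r *\<^sub>R \<eta>\<^sub>0 + \<beta> t = F (x (\<phi> (r, t)))" if "r \<in> I'" for r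
        using eq I'(2,3) that by auto
    qed
    ultimately have "L (?d (1,0)) = \<eta>\<^sub>0" by (rule vector_derivative_unique_at)
    then show ?thesis unfolding p tangent_space_eq[OF par st] by blast
  qed
  obtain p0 where "p0 \<in> M" using assms(2) by blast
  then obtain \<eta> where \<eta>: "L \<eta> = \<eta>\<^sub>0" using pre by blast
  have "\<eta> \<noteq> 0" using \<eta> \<eta>\<^sub>0 linear_0[OF has_derivative_linear[OF L(1)]] by (auto simp: lightlike_def)
  moreover have "mink \<eta> \<eta> = 0" using L(2)[of \<eta> \<eta>] \<eta>\<^sub>0 by (simp add: \<eta> lightlike_def)
  moreover have "\<eta> \<in> tangent_space M x p" if p: "p \<in> M" for p
  proof -
    obtain v where v: "v \<in> tangent_space M x p" "L v = \<eta>\<^sub>0" using pre[OF p] by blast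
    then have "v = \<eta>" using \<eta> L(3) by (metis injD)
    then show ?thesis using v by simp
  qed
  ultimately show ?thesis unfolding lightlike_def by blast
qed

context null_coordinates
begin

lemma lightlike_curves:
  assumes "s \<in> I" "t \<in> J"
  shows "lightlike (a s)" "lightlike (b t)"
  using null_pairD[OF pointwise(2)[OF assms]] unfolding lightlike_def by (metis zero_index zero_neq_one)+

text \<open>A curve with constant velocity \<open>\<eta>\<close> is
  \<open>s *\<^sub>R \<eta>\<close> plus a constant, and this constant is absorbed into the other
  curve. The isometry is the identity because nothing has to be moved.\<close>

lemma null_line_chart_s:
  assumes a: "\<And>s. s \<in> I \<Longrightarrow> a s = \<eta>" and st: "s \<in> I" "t \<in> J" "p = \<phi> (s, t)"
  shows "\<exists>I J \<phi> \<beta>. is_interval I \<and> is_interval J \<and> local_param M x (I \<times> J) \<phi> \<and> p \<in> \<phi> ` (I \<times> J) \<and>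
    null_curve_on J \<beta> \<and> (\<forall>t\<in>J. mink \<eta> (vector_derivative \<beta> (at t)) \<noteq> 0) \<and>
    (\<forall>s\<in>I. \<forall>t\<in>J. id (x (\<phi> (s, t))) = s *\<^sub>R \<eta> + \<beta> t)"
proof (intro exI conjI ballI)
  define c where "c = \<alpha> s - s *\<^sub>R \<eta>"
  have "mink \<eta> (b q) \<noteq> 0" if "q \<in> J" for q using \<mu>_neg[OF st(1) that] by (simp add: \<mu>_def a[OF st(1)])
  note tr = null_curve_translate[OF open_IJ(2) smooth_\<beta> curve_derivatives(2) lightlike_curves(2)[OF st(1)] this, where c = c]
  show "null_curve_on J (\<lambda>t. \<beta> t + c)" by (rule tr(1))
  show "mink \<eta> (vector_derivative (\<lambda>t. \<beta> t + c) (at q)) \<noteq> 0" if "q \<in> J" for q by (rule tr(2)) (use that in auto)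
  show "p \<in> \<phi> ` (I \<times> J)" using st by simp
  show "id (x (\<phi> (r, q))) = r *\<^sub>R \<eta> + (\<beta> q + c)" if rq: "r \<in> I" "q \<in> J" for r q
  proof -
    have "\<alpha> r = r *\<^sub>R \<eta> + c"
      unfolding c_def
      by (rule affine_if_constant_derivative[OF interval_IJ(1) _ rq(1) st(1)]) (use curve_derivatives(1) a in metis)
    then show ?thesis by (simp add: pointwise(1)[OF rq])
  qed
qed (rule interval_IJ par)+

lemma null_line_chart_t:
  assumes b: "\<And>t. t \<in> J \<Longrightarrow> b t = \<eta>" and st: "s \<in> I" "t \<in> J" "p = \<phi> (s, t)"
  shows "\<exists>I J \<phi> \<beta>. is_interval I \<and> is_interval J \<and> local_param M x (I \<times> J) \<phi> \<and> p \<in> \<phi> ` (I \<times> J) \<and>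
    null_curve_on J \<beta> \<and> (\<forall>t\<in>J. mink \<eta> (vector_derivative \<beta> (at t)) \<noteq> 0) \<and>
    (\<forall>s\<in>I. \<forall>t\<in>J. id (x (\<phi> (s, t))) = s *\<^sub>R \<eta> + \<beta> t)"
proof (intro exI conjI ballI)
  define c where "c = \<beta> t - t *\<^sub>R \<eta>"
  have "mink \<eta> (a r) \<noteq> 0" if "r \<in> I" for r
    using \<mu>_neg[OF that st(2)] by (simp add: \<mu>_def b[OF st(2)] mink_commute)
  note tr = null_curve_translate[OF open_IJ(1) smooth_\<alpha> curve_derivatives(1) lightlike_curves(1)[OF _ st(2)] this, where c = c]
  show "null_curve_on I (\<lambda>t. \<alpha> t + c)" by (rule tr(1))
  show "mink \<eta> (vector_derivative (\<lambda>t. \<alpha> t + c) (at r)) \<noteq> 0" if "r \<in> I" for r by (rule tr(2)) (use that in auto)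
  \<comment> \<open>The ruling parameter must be the first coordinate, so the two coordinates are
    exchanged.\<close>
  show "local_param M x (J \<times> I) (\<phi> \<circ> prod.swap)" by (rule local_param_swap[OF par open_IJ(1,2)])
  show "p \<in> (\<phi> \<circ> prod.swap) ` (J \<times> I)" using st by (intro image_eqI[of _ _ "(t, s)"]) simp_all
  show "id (x ((\<phi> \<circ> prod.swap) (q, r))) = q *\<^sub>R \<eta> + (\<alpha> r + c)" if rq: "q \<in> J" "r \<in> I" for r q
  proof -
    have "\<beta> q = q *\<^sub>R \<eta> + c"
      unfolding c_def
      by (rule affine_if_constant_derivative[OF interval_IJ(2) _ rq(1) st(2)]) (use curve_derivatives(2) b in metis)
    then show ?thesis by (simp add: pointwise(1)[OF rq(2,1)])
  qed
qed (rule interval_IJ)+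

text \<open>Scaled to time component 1, \<open>\<eta>\<close> equals \<open>a s\<close> or
  \<open>b t\<close> at every point. If it equals \<open>a s0\<close> for some \<open>s0\<close>,
  then it differs from \<open>b t\<close>, hence equals \<open>a r\<close> for every
  \<open>r\<close>; otherwise it equals \<open>b r\<close> for every \<open>r\<close>. So one
  velocity is constant.\<close>

lemma constant_null_tangent_ruled:
  assumes \<eta>: "lightlike \<eta>" "\<And>s t. s \<in> I \<Longrightarrow> t \<in> J \<Longrightarrow> \<eta> \<in> span {a s, b t}" and st: "s \<in> I" "t \<in> J"
  shows "a' s = 0 \<or> b' t = 0"
proof -
  define n where "n = (1 / \<eta> $ 1) *\<^sub>R \<eta>"
  have alt: "a s = n \<or> b t = n" if st: "s \<in> I" "t \<in> J" for s t
  proof -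
    note N = null_pairD[OF pointwise(2)[OF st]]
    obtain p q where pq: "\<eta> = p *\<^sub>R a s + q *\<^sub>R b t" using \<eta>(2)[OF st] span_pair by blast
    have "2 * (p * q * mink (a s) (b t)) = 0"
      using \<eta>(1) N by (simp add: lightlike_def pq mink.add_left mink.add_right mink.scaleR_left mink.scaleR_right)
    then have "p = 0 \<or> q = 0" using N(7) by simp
    moreover have "\<not> (p = 0 \<and> q = 0)" using \<eta>(1) by (auto simp: lightlike_def pq)
    ultimately show ?thesis using N by (auto simp: n_def pq)
  qed
  have const: "D = 0" if "open K" "r \<in> K" "\<And>r. r \<in> K \<Longrightarrow> g r = n" "(g has_vector_derivative D) (at r)"
    for g :: "real \<Rightarrow> real^4" and D K r
  proof -
    have "(g has_vector_derivative 0) (at r)"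
      by (rule has_vector_derivative_transform_within_open[OF has_vector_derivative_const that(1,2)]) (simp add: that(3))
    then show ?thesis using that(4) vector_derivative_unique_at by metis
  qed
  show ?thesis
  proof (cases "\<exists>s0\<in>I. a s0 = n")
    case True
    then obtain s0 where s0: "s0 \<in> I" "a s0 = n" by blast
    then have "b t \<noteq> n" using null_pairD(5)[OF pointwise(2)[OF s0(1) st(2)]] by simp
    then have "a r = n" if "r \<in> I" for r using alt[OF that st(2)] by simp
    from const[OF open_IJ(1) st(1) this curve_derivatives(3)[OF st(1)]] show ?thesis by simp
  next
    case False
    then have "b r = n" if "r \<in> J" for r using alt[OF st(1) that] st(1) by blast
    from const[OF open_IJ(2) st(2) this curve_derivatives(4)[OF st(2)]] show ?thesis by simp
  qed
qed

end

context minimal_lorentzian_surface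
begin

lemma nonempty: "M \<noteq> {}"
  using surface unfolding immersed_surface_def by blast

text \<open>A constant null tangent vector forces the alternative in every chart. Conversely the
  constant null direction serves as \<open>\<eta>\<^sub>0\<close> with the identity as
  isometry.\<close>

lemma congruent_iff_ruled: "congruent_to_null_line_surface M x \<longleftrightarrow> ruled"
proof
  assume c: "congruent_to_null_line_surface M x"
  obtain \<eta> where \<eta>: "lightlike \<eta>" "\<forall>p\<in>M. \<eta> \<in> tangent_space M x p"
    using congruent_imp_constant_null_tangent[OF c nonempty] by blast
  show ruled
  proof (rule ruledI)
    fix I J \<phi> \<alpha> \<beta> s t
    assume nc: "null_coordinates M x Or I J \<phi> \<alpha> \<beta>" and st: "s \<in> I" "t \<in> J"
    interpret null_coordinates M x Or I J \<phi> \<alpha> \<beta> by (rule nc)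
    have "\<eta> \<in> span {a s, b t}" if "s \<in> I" "t \<in> J" for s t
    proof -
      have "\<phi> (s, t) \<in> M" using local_paramD(6)[OF par] that by auto
      from bspec[OF \<eta>(2) this] show ?thesis unfolding tangent_span[OF that] .
    qed
    then show "a' s = 0 \<or> b' t = 0" by (rule constant_null_tangent_ruled[OF \<eta>(1) _ st])
  qed
next
  assume r: ruled
  define Q where "Q \<eta> p \<longleftrightarrow> (\<exists>I J \<phi> \<beta>. is_interval I \<and> is_interval J \<and> local_param M x (I \<times> J) \<phi> \<and> p \<in> \<phi> ` (I \<times> J) \<and>
    null_curve_on J \<beta> \<and> (\<forall>t\<in>J. mink \<eta> (vector_derivative \<beta> (at t)) \<noteq> 0) \<and>
    (\<forall>s\<in>I. \<forall>t\<in>J. id (x (\<phi> (s, t))) = s *\<^sub>R \<eta> + \<beta> t))" for \<eta> p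
  have "\<exists>\<eta>. \<forall>p\<in>M. lightlike \<eta> \<and> Q \<eta> p"
    using ruled_imp_constant_direction[OF r]
  proof (elim disjE exE)
    fix \<eta> assume \<eta>: "\<forall>p\<in>M. fst (null_directions p) = \<eta>"
    have "lightlike \<eta> \<and> Q \<eta> p" if "p \<in> M" for p
    proof -
      obtain I J \<phi> \<alpha> \<beta> s t where nc: "null_coordinates M x Or I J \<phi> \<alpha> \<beta>" "s \<in> I" "t \<in> J" "p = \<phi> (s, t)"
        using null_coordinates_at_point[OF \<open>p \<in> M\<close>] by metis
      interpret null_coordinates M x Or I J \<phi> \<alpha> \<beta> by (rule nc(1))
      have a: "a r = \<eta>" if "r \<in> I" for r
      proof -
        have "\<phi> (r, t) \<in> M" using local_paramD(6)[OF par] that nc(3) by auto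
        from bspec[OF \<eta> this] show ?thesis by (simp add: null_directions_eq[OF nc(1) that nc(3)])
      qed
      show ?thesis
        using lightlike_curves(1)[OF nc(2,3)] null_line_chart_s[OF a nc(2-4)] a[OF nc(2)] unfolding Q_def by simp
    qed
    then show ?thesis by blast
  next
    fix \<eta> assume \<eta>: "\<forall>p\<in>M. snd (null_directions p) = \<eta>"
    have "lightlike \<eta> \<and> Q \<eta> p" if "p \<in> M" for p
    proof -
      obtain I J \<phi> \<alpha> \<beta> s t where nc: "null_coordinates M x Or I J \<phi> \<alpha> \<beta>" "s \<in> I" "t \<in> J" "p = \<phi> (s, t)"
        using null_coordinates_at_point[OF \<open>p \<in> M\<close>] by metis
      interpret null_coordinates M x Or I J \<phi> \<alpha> \<beta> by (rule nc(1))
      have b: "b q = \<eta>" if "q \<in> J" for q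
      proof -
        have "\<phi> (s, q) \<in> M" using local_paramD(6)[OF par] that nc(2) by auto
        from bspec[OF \<eta> this] show ?thesis by (simp add: null_directions_eq[OF nc(1,2) that])
      qed
      show ?thesis
        using lightlike_curves(2)[OF nc(2,3)] null_line_chart_t[OF b nc(2-4)] b[OF nc(3)] unfolding Q_def by simp
    qed
    then show ?thesis by blast
  qed
  then obtain \<eta> where \<eta>: "\<forall>p\<in>M. lightlike \<eta> \<and> Q \<eta> p" ..
  then have "lightlike \<eta>" "\<forall>p\<in>M. Q \<eta> p" using nonempty by blast+
  then have "mink_isometry id \<and> lightlike \<eta> \<and> (\<forall>p\<in>M. Q \<eta> p)" using mink_isometry_id by blast
  then show "congruent_to_null_line_surface M x"
    unfolding congruent_to_null_line_surface_def Q_def by (intro exI)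
qed

lemma geodesic_point_not_degenerate:
  assumes "p \<in> geodesic_points M x"
  shows "\<not> degenerate_space (relative_null_space M x p)"
proof -
  have "p \<in> M" using assms unfolding geodesic_points_def by blast
  then obtain I J \<phi> \<alpha> \<beta> s t where nc: "null_coordinates M x Or I J \<phi> \<alpha> \<beta>" "s \<in> I" "t \<in> J" "p = \<phi> (s, t)"
    using null_coordinates_at_point[of p] by metis
  interpret null_coordinates M x Or I J \<phi> \<alpha> \<beta> by (rule nc(1))
  show ?thesis
    using assms unfolding nc(4) degenerate_relative_null_iff[OF nc(2,3)] geodesic_point_iff[OF nc(2,3)] by blast
qed

lemma degenerate_bundle_iff: "degenerate_relative_null_bundle M x \<longleftrightarrow> ruled \<and> geodesic_points M x = {}"
proof -
  have "geodesic_points M x \<subseteq> M" unfolding geodesic_points_def by blast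
  then show ?thesis
    using geodesic_point_not_degenerate
    unfolding ruled_iff_degenerate degenerate_relative_null_bundle_def degenerate_relative_null_on_def by blast
qed

end

text \<open>The equivalence with (iv) is stated on the complement of the geodesic points; the last
  conjunct locates degeneracy at every point, namely as the other conditions together with the
  absence of geodesic points.\<close>

theorem theorem3p5:
  fixes M :: "'a::{t2_space, second_countable_topology} set"
    and x :: "'a \<Rightarrow> real^4"
    and Or :: "'a \<Rightarrow> ((real^4) \<times> (real^4)) set"
  assumes surface: "immersed_surface M x"
    and orient: "surface_orientation M x Or"
    and lorentz: "lorentzian M x"
    and minimal: "minimal_surface M x"
    and no_hyperplane: "\<And>V a b. openin (top_of_set M) V \<Longrightarrow> V \<noteq> {} \<Longrightarrow> a \<noteq> 0 \<Longrightarrow> \<not> x ` V \<subseteq> {y. a \<bullet> y = b}"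
  shows "(pointwise_1_type_gauss_map M x Or \<longleftrightarrow> pointwise_1_type_gauss_map_first_kind M x Or) \<and>
         (pointwise_1_type_gauss_map M x Or \<longleftrightarrow> harmonic_gauss_map M x Or) \<and>
         (pointwise_1_type_gauss_map M x Or \<longleftrightarrow> degenerate_relative_null_on M x (M - geodesic_points M x)) \<and>
         (pointwise_1_type_gauss_map M x Or \<longleftrightarrow> flat_normal_bundle M x) \<and>
         (pointwise_1_type_gauss_map M x Or \<longleftrightarrow> congruent_to_null_line_surface M x) \<and>
         (degenerate_relative_null_bundle M x \<longleftrightarrow>
            pointwise_1_type_gauss_map M x Or \<and> geodesic_points M x = {})"
proof -
  interpret minimal_lorentzian_surface M x Or
    by unfold_locales (fact surface orient lorentz minimal no_hyperplane)+
  have "pointwise_1_type_gauss_map M x Or \<longleftrightarrow> ruled" "pointwise_1_type_gauss_map_first_kind M x Or \<longleftrightarrow> ruled"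
    "harmonic_gauss_map M x Or \<longleftrightarrow> ruled"
    using ruled_imp_harmonic harmonic_imp_first_kind first_kind_imp_1_type one_type_imp_ruled by blast+
  then show ?thesis
    using ruled_iff_degenerate flat_iff_ruled congruent_iff_ruled degenerate_bundle_iff by blast
qed

end
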